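(* Let $(I,\trianglelefteq)$ be a finite poset and $(\sigma,\iota,\pi)$ an $(I,\trianglelefteq)$-configuration in an abelian or exact category. Let $i\ne j\in I$ with $i\trianglelefteq j$, such that there exists no $k\in I$ with $i\ne k\ne j$ and $i\trianglelefteq k\trianglelefteq j$, and such that the short exact sequence $$0\to\sigma(\{i\})\xrightarrow{\ \iota(\{i\},\{i,j\})\ }\sigma(\{i,j\})\xrightarrow{\ \pi(\{i,j\},\{j\})\ }\sigma(\{j\})\to0$$ is split. Define $\preceq$ on $I$ by $a\preceq b$ if $a\trianglelefteq b$ and $(a,b)\ne(i,j)$, so that $\preceq$ is a partial order and $\trianglelefteq$ dominates $\preceq$ by one step. Then there exists an $(I,\preceq)$-improvement $(\tilde\sigma,\tilde\iota,\tilde\pi)$ of $(\sigma,\iota,\pi)$. Such improvements up to canonical isomorphism are in one-to-one correspondence with $\operatorname{Hom}\bigl(\sigma(\{j\}),\sigma(\{i\})\bigr)$.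
   Context: An exact category is a full additive subcategory $\mathcal A$ of an abelian category $\hat{\mathcal A}$, closed under extensions; its exact sequences are the short exact sequences of $\hat{\mathcal A}$ with all terms in $\mathcal A$. A short exact sequence $0\to X\to Y\to Z\to0$ is split if there is a compatible isomorphism $X\oplus Z\cong Y$. For a finite poset $(I,\preceq)$, $J\subseteq I$ is an f-set if $i\in I$, $h,j\in J$, $h\preceq i\preceq j$ imply $i\in J$. $\mathcal F_{(I,\preceq)}$ is the set of f-sets of $I$; $\mathcal G_{(I,\preceq)}$ is the set of pairs $(J,K)$ of f-sets with $J\subseteq K$ such that $j\in J$, $k\in K$, $k\preceq j$ imply $k\in J$; $\mathcal H_{(I,\preceq)}$ is the set of pairs $(J,K)$ of f-sets with $K\subseteq J$ such that $j\in J$, $k\in K$, $k\preceq j$ imply $j\in K$. An $(I,\preceq)$-configuration $(\sigma,\iota,\pi)$ in an abelian or exact category $\mathcal A$ consists of objects $\sigma(J)$ for $J\in\mathcal F_{(I,\preceq)}$ with $\sigma(\emptyset)=0$; injective morphisms $\iota(J,K):\sigma(J)\to\sigma(K)$ for $(J,K)\in\mathcal G_{(I,\preceq)}$ with $\iota(J,J)=\mathrm{id}_{\sigma(J)}$; and surjective morphisms $\pi(J,K):\sigma(J)\to\sigma(K)$ for $(J,K)\in\mathcal H_{(I,\preceq)}$ with $\pi(J,J)=\mathrm{id}_{\sigma(J)}$, such that: (A) if $(J,K)\in\mathcal G_{(I,\preceq)}$ and $L=K\setminus J$ then $0\to\sigma(J)\xrightarrow{\iota(J,K)}\sigma(K)\xrightarrow{\pi(K,L)}\sigma(L)\to0$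 is exact; (B) if $(J,K),(K,L)\in\mathcal G_{(I,\preceq)}$ then $\iota(J,L)=\iota(K,L)\circ\iota(J,K)$; (C) if $(J,K),(K,L)\in\mathcal H_{(I,\preceq)}$ then $\pi(J,L)=\pi(K,L)\circ\pi(J,K)$; (D) if $(J,K)\in\mathcal G_{(I,\preceq)}$ and $(K,L)\in\mathcal H_{(I,\preceq)}$ then $\pi(K,L)\circ\iota(J,K)=\iota(J\cap L,L)\circ\pi(J,J\cap L)$. Isomorphisms $\alpha$ of configurations are collections of isomorphisms $\alpha(J):\sigma(J)\to\sigma'(J)$, $J\in\mathcal F_{(I,\preceq)}$, commuting with all $\iota$'s and $\pi$'s. If $\trianglelefteq,\preceq$ are partial orders on $I$ such that $a\preceq b$ implies $a\trianglelefteq b$, then $\trianglelefteq$ dominates $\preceq$, by $s$ steps where $s$ is the number of pairs $(a,b)$ with $a\trianglelefteq b$ and $a\not\preceq b$. Then $\mathcal F_{(I,\trianglelefteq)}\subseteq\mathcal F_{(I,\preceq)}$, $\mathcal G_{(I,\trianglelefteq)}\subseteq\mathcal G_{(I,\preceq)}$, $\mathcal H_{(I,\trianglelefteq)}\subseteq\mathcal H_{(I,\preceq)}$, and an $(I,\preceq)$-improvement of an $(I,\trianglelefteq)$-configuration $(\sigma,\iota,\pi)$ is an $(I,\preceq)$-configuration $(\tilde\sigma,\tilde\iota,\tilde\pi)$ whose restriction to $\mathcal F_{(I,\trianglelefteq)},\mathcal G_{(I,\trianglelefteq)},\mathcal H_{(I,\trianglelefteq)}$ equals $(\sigma,\iota,\pi)$.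 Two improvements are identified "up to canonical isomorphism" if there is an isomorphism of $(I,\preceq)$-configurations between them which is the identity on $(\sigma,\iota,\pi)$, i.e. on all $\sigma(J)$ with $J\in\mathcal F_{(I,\trianglelefteq)}$. *)

theory Defs
  imports "HOL-Algebra.Group"
begin

record ('o, 'm) category_data =
  Obj :: "'o set"
  Hom :: "'o \<Rightarrow> 'o \<Rightarrow> 'm set"
  Id :: "'o \<Rightarrow> 'm"
  Comp :: "'m \<Rightarrow> 'm \<Rightarrow> 'm"  (infixr "\<cdot>\<index>" 70)
  Add :: "'m \<Rightarrow> 'm \<Rightarrow> 'm"  (infixl "\<^bold>+\<index>" 65)
  Zero :: "'o \<Rightarrow> 'o \<Rightarrow> 'm"

text \<open>Composition is in function order: \<open>g \<cdot> f\<close> is \<open>f\<close> followed by \<open>g\<close>. Values of the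
  fields on objects outside \<open>Obj\<close> or on non-composable morphisms are irrelevant.\<close>

locale category =
  fixes C :: "('o, 'm) category_data" (structure)
  assumes Hom_disjoint:
      "\<lbrakk>X \<in> Obj C; Y \<in> Obj C; X' \<in> Obj C; Y' \<in> Obj C; f \<in> Hom C X Y; f \<in> Hom C X' Y'\<rbrakk>
        \<Longrightarrow> X = X' \<and> Y = Y'"
    and Id_in_Hom: "X \<in> Obj C \<Longrightarrow> Id C X \<in> Hom C X X"
    and Comp_in_Hom:
      "\<lbrakk>X \<in> Obj C; Y \<in> Obj C; Z \<in> Obj C; f \<in> Hom C X Y; g \<in> Hom C Y Z\<rbrakk> \<Longrightarrow> g \<cdot> f \<in> Hom C X Z"
    and Comp_Id: "\<lbrakk>X \<in> Obj C; Y \<in> Obj C; f \<in> Hom C X Y\<rbrakk> \<Longrightarrow> f \<cdot> Id C X = f"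
    and Id_Comp: "\<lbrakk>X \<in> Obj C; Y \<in> Obj C; f \<in> Hom C X Y\<rbrakk> \<Longrightarrow> Id C Y \<cdot> f = f"
    and Comp_assoc:
      "\<lbrakk>W \<in> Obj C; X \<in> Obj C; Y \<in> Obj C; Z \<in> Obj C;
        f \<in> Hom C W X; g \<in> Hom C X Y; h \<in> Hom C Y Z\<rbrakk> \<Longrightarrow> (h \<cdot> g) \<cdot> f = h \<cdot> (g \<cdot> f)"

definition hom_group :: "('o, 'm) category_data \<Rightarrow> 'o \<Rightarrow> 'o \<Rightarrow> 'm monoid" where
  "hom_group C X Y = \<lparr>carrier = Hom C X Y, mult = Add C, one = Zero C X Y\<rparr>"

locale preadditive_category = category C for C :: "('o, 'm) category_data" (structure) +
  assumes hom_comm_group: "\<lbrakk>X \<in> Obj C; Y \<in> Obj C\<rbrakk> \<Longrightarrow> comm_group (hom_group C X Y)"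
    and Comp_Add:
      "\<lbrakk>X \<in> Obj C; Y \<in> Obj C; Z \<in> Obj C; f \<in> Hom C X Y; f' \<in> Hom C X Y; g \<in> Hom C Y Z\<rbrakk>
        \<Longrightarrow> g \<cdot> (f \<^bold>+ f') = (g \<cdot> f) \<^bold>+ (g \<cdot> f')"
    and Add_Comp:
      "\<lbrakk>X \<in> Obj C; Y \<in> Obj C; Z \<in> Obj C; f \<in> Hom C X Y; g \<in> Hom C Y Z; g' \<in> Hom C Y Z\<rbrakk>
        \<Longrightarrow> (g \<^bold>+ g') \<cdot> f = (g \<cdot> f) \<^bold>+ (g' \<cdot> f)"

definition is_zero_object :: "('o, 'm) category_data \<Rightarrow> 'o \<Rightarrow> bool" where
  "is_zero_object C Z \<longleftrightarrow> Z \<in> Obj C \<and>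
     (\<forall>X \<in> Obj C. (\<exists>!f. f \<in> Hom C Z X) \<and> (\<exists>!f. f \<in> Hom C X Z))"

definition is_iso :: "('o, 'm) category_data \<Rightarrow> 'o \<Rightarrow> 'o \<Rightarrow> 'm \<Rightarrow> bool" where
  "is_iso C X Y f \<longleftrightarrow> f \<in> Hom C X Y \<and>
     (\<exists>g \<in> Hom C Y X. g \<cdot>\<^bsub>C\<^esub> f = Id C X \<and> f \<cdot>\<^bsub>C\<^esub> g = Id C Y)"

definition is_mono :: "('o, 'm) category_data \<Rightarrow> 'o \<Rightarrow> 'o \<Rightarrow> 'm \<Rightarrow> bool" where
  "is_mono C X Y f \<longleftrightarrow> f \<in> Hom C X Y \<and>
     (\<forall>W \<in> Obj C. \<forall>g \<in> Hom C W X. \<forall>h \<in> Hom C W X. f \<cdot>\<^bsub>C\<^esub> g = f \<cdot>\<^bsub>C\<^esub> h \<longrightarrow> g = h)"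

definition is_epi :: "('o, 'm) category_data \<Rightarrow> 'o \<Rightarrow> 'o \<Rightarrow> 'm \<Rightarrow> bool" where
  "is_epi C X Y f \<longleftrightarrow> f \<in> Hom C X Y \<and>
     (\<forall>W \<in> Obj C. \<forall>g \<in> Hom C Y W. \<forall>h \<in> Hom C Y W. g \<cdot>\<^bsub>C\<^esub> f = h \<cdot>\<^bsub>C\<^esub> f \<longrightarrow> g = h)"

definition is_kernel :: "('o, 'm) category_data \<Rightarrow> 'o \<Rightarrow> 'o \<Rightarrow> 'm \<Rightarrow> 'o \<Rightarrow> 'm \<Rightarrow> bool" where
  "is_kernel C X Y f K k \<longleftrightarrow> f \<in> Hom C X Y \<and> K \<in> Obj C \<and> k \<in> Hom C K X \<and>
     f \<cdot>\<^bsub>C\<^esub> k = Zero C K Y \<and>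
     (\<forall>W \<in> Obj C. \<forall>h \<in> Hom C W X. f \<cdot>\<^bsub>C\<^esub> h = Zero C W Y \<longrightarrow>
        (\<exists>!u. u \<in> Hom C W K \<and> k \<cdot>\<^bsub>C\<^esub> u = h))"

definition is_cokernel :: "('o, 'm) category_data \<Rightarrow> 'o \<Rightarrow> 'o \<Rightarrow> 'm \<Rightarrow> 'o \<Rightarrow> 'm \<Rightarrow> bool" where
  "is_cokernel C X Y f Q q \<longleftrightarrow> f \<in> Hom C X Y \<and> Q \<in> Obj C \<and> q \<in> Hom C Y Q \<and>
     q \<cdot>\<^bsub>C\<^esub> f = Zero C X Q \<and>
     (\<forall>W \<in> Obj C. \<forall>h \<in> Hom C Y W. h \<cdot>\<^bsub>C\<^esub> f = Zero C X W \<longrightarrow>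
        (\<exists>!u. u \<in> Hom C Q W \<and> u \<cdot>\<^bsub>C\<^esub> q = h))"

definition is_direct_sum ::
  "('o, 'm) category_data \<Rightarrow> 'o \<Rightarrow> 'o \<Rightarrow> 'o \<Rightarrow> 'm \<Rightarrow> 'm \<Rightarrow> 'm \<Rightarrow> 'm \<Rightarrow> bool" where
  "is_direct_sum C X Y B i\<^sub>1 i\<^sub>2 p\<^sub>1 p\<^sub>2 \<longleftrightarrow> B \<in> Obj C \<and>
     i\<^sub>1 \<in> Hom C X B \<and> i\<^sub>2 \<in> Hom C Y B \<and> p\<^sub>1 \<in> Hom C B X \<and> p\<^sub>2 \<in> Hom C B Y \<and>
     p\<^sub>1 \<cdot>\<^bsub>C\<^esub> i\<^sub>1 = Id C X \<and> p\<^sub>2 \<cdot>\<^bsub>C\<^esub> i\<^sub>2 = Id C Y \<and>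
     p\<^sub>1 \<cdot>\<^bsub>C\<^esub> i\<^sub>2 = Zero C Y X \<and> p\<^sub>2 \<cdot>\<^bsub>C\<^esub> i\<^sub>1 = Zero C X Y \<and>
     (i\<^sub>1 \<cdot>\<^bsub>C\<^esub> p\<^sub>1) \<^bold>+\<^bsub>C\<^esub> (i\<^sub>2 \<cdot>\<^bsub>C\<^esub> p\<^sub>2) = Id C B"

locale abelian_category = preadditive_category C for C :: "('o, 'm) category_data" (structure) +
  assumes ex_zero_object: "\<exists>Z. is_zero_object C Z"
    and ex_direct_sum:
      "\<lbrakk>X \<in> Obj C; Y \<in> Obj C\<rbrakk> \<Longrightarrow> \<exists>B i\<^sub>1 i\<^sub>2 p\<^sub>1 p\<^sub>2. is_direct_sum C X Y B i\<^sub>1 i\<^sub>2 p\<^sub>1 p\<^sub>2"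
    and ex_kernel: "\<lbrakk>X \<in> Obj C; Y \<in> Obj C; f \<in> Hom C X Y\<rbrakk> \<Longrightarrow> \<exists>K k. is_kernel C X Y f K k"
    and ex_cokernel: "\<lbrakk>X \<in> Obj C; Y \<in> Obj C; f \<in> Hom C X Y\<rbrakk> \<Longrightarrow> \<exists>Q q. is_cokernel C X Y f Q q"
    and mono_is_kernel:
      "\<lbrakk>X \<in> Obj C; Y \<in> Obj C; is_mono C X Y f\<rbrakk> \<Longrightarrow> \<exists>Z \<in> Obj C. \<exists>g. is_kernel C Y Z g X f"
    and epi_is_cokernel:
      "\<lbrakk>X \<in> Obj C; Y \<in> Obj C; is_epi C X Y f\<rbrakk> \<Longrightarrow> \<exists>W \<in> Obj C. \<exists>g. is_cokernel C W X g Y f"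

text \<open>The image of a morphism is the kernel of its cokernel.\<close>

definition is_image :: "('o, 'm) category_data \<Rightarrow> 'o \<Rightarrow> 'o \<Rightarrow> 'm \<Rightarrow> 'o \<Rightarrow> 'm \<Rightarrow> bool" where
  "is_image C X Y f M m \<longleftrightarrow> (\<exists>Q q. is_cokernel C X Y f Q q \<and> is_kernel C Y Q q M m)"

definition short_exact ::
  "('o, 'm) category_data \<Rightarrow> 'o \<Rightarrow> 'm \<Rightarrow> 'o \<Rightarrow> 'm \<Rightarrow> 'o \<Rightarrow> bool" where
  "short_exact C X f Y g Z \<longleftrightarrow> X \<in> Obj C \<and> Y \<in> Obj C \<and> Z \<in> Obj C \<and>
     is_mono C X Y f \<and> is_epi C Y Z g \<and> (\<exists>M m. is_image C X Y f M m \<and> is_kernel C Y Z g M m)"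

definition split_short_exact ::
  "('o, 'm) category_data \<Rightarrow> 'o \<Rightarrow> 'm \<Rightarrow> 'o \<Rightarrow> 'm \<Rightarrow> 'o \<Rightarrow> bool" where
  "split_short_exact C X f Y g Z \<longleftrightarrow> short_exact C X f Y g Z \<and>
     (\<exists>B i\<^sub>1 i\<^sub>2 p\<^sub>1 p\<^sub>2 \<phi>. is_direct_sum C X Z B i\<^sub>1 i\<^sub>2 p\<^sub>1 p\<^sub>2 \<and> is_iso C B Y \<phi> \<and>
        \<phi> \<cdot>\<^bsub>C\<^esub> i\<^sub>1 = f \<and> g \<cdot>\<^bsub>C\<^esub> \<phi> = p\<^sub>2)"

text \<open>An exact category is a full additive subcategory, closed under extensions, of an ambient
  abelian category. Being full, it is given by its set \<open>A\<close> of objects.\<close>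

locale exact_category = abelian_category C for C :: "('o, 'm) category_data" (structure) +
  fixes A :: "'o set"
  assumes A_subset: "A \<subseteq> Obj C"
    and A_zero_object: "\<exists>Z \<in> A. is_zero_object C Z"
    and A_direct_sum:
      "\<lbrakk>X \<in> A; Y \<in> A\<rbrakk> \<Longrightarrow> \<exists>B \<in> A. \<exists>i\<^sub>1 i\<^sub>2 p\<^sub>1 p\<^sub>2. is_direct_sum C X Y B i\<^sub>1 i\<^sub>2 p\<^sub>1 p\<^sub>2"
    and A_extension: "\<lbrakk>X \<in> A; Z \<in> A; short_exact C X f Y g Z\<rbrakk> \<Longrightarrow> Y \<in> A"

text \<open>Abelian categories are the case \<open>A = Obj C\<close>.\<close>

lemma (in abelian_category) exact_category_Obj: "exact_category C (Obj C)"
proof unfold_locales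
  show "\<exists>Z \<in> Obj C. is_zero_object C Z"
    using ex_zero_object by (auto simp: is_zero_object_def)
  show "\<exists>B \<in> Obj C. \<exists>i\<^sub>1 i\<^sub>2 p\<^sub>1 p\<^sub>2. is_direct_sum C X Y B i\<^sub>1 i\<^sub>2 p\<^sub>1 p\<^sub>2"
    if "X \<in> Obj C" "Y \<in> Obj C" for X Y
    using ex_direct_sum[OF that] unfolding is_direct_sum_def by blast
  show "Y \<in> Obj C" if "short_exact C X f Y g Z" for X f Y g Z
    using that by (simp add: short_exact_def)
qed simp

definition fsets :: "'i set \<Rightarrow> 'i rel \<Rightarrow> 'i set set" where
  "fsets I r = {J. J \<subseteq> I \<and> (\<forall>i \<in> I. \<forall>h \<in> J. \<forall>j \<in> J. (h, i) \<in> r \<and> (i, j) \<in> r \<longrightarrow> i \<in> J)}"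

definition gpairs :: "'i set \<Rightarrow> 'i rel \<Rightarrow> ('i set \<times> 'i set) set" where
  "gpairs I r = {(J, K). J \<in> fsets I r \<and> K \<in> fsets I r \<and> J \<subseteq> K \<and>
     (\<forall>j \<in> J. \<forall>k \<in> K. (k, j) \<in> r \<longrightarrow> k \<in> J)}"

definition hpairs :: "'i set \<Rightarrow> 'i rel \<Rightarrow> ('i set \<times> 'i set) set" where
  "hpairs I r = {(J, K). J \<in> fsets I r \<and> K \<in> fsets I r \<and> K \<subseteq> J \<and>
     (\<forall>j \<in> J. \<forall>k \<in> K. (k, j) \<in> r \<longrightarrow> j \<in> K)}"

text \<open>Only the values of \<open>\<sigma>\<close>, \<open>\<iota>\<close>, \<open>\<pi>\<close> on \<open>fsets\<close>, \<open>gpairs\<close>, \<open>hpairs\<close> carry information;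
  elsewhere they are arbitrary.\<close>

record ('i, 'o, 'm) config_data =
  \<sigma> :: "'i set \<Rightarrow> 'o"
  \<iota> :: "'i set \<Rightarrow> 'i set \<Rightarrow> 'm"
  \<pi> :: "'i set \<Rightarrow> 'i set \<Rightarrow> 'm"

text \<open>\<open>\<sigma>(\<emptyset>) = 0\<close> is read as: \<open>\<sigma>(\<emptyset>)\<close> is a zero object. Injective and surjective mean mono and
  epi in the ambient abelian category.\<close>

definition is_configuration ::
  "('o, 'm) category_data \<Rightarrow> 'o set \<Rightarrow> 'i set \<Rightarrow> 'i rel \<Rightarrow> ('i, 'o, 'm) config_data \<Rightarrow> bool" where
  "is_configuration C A I r S \<longleftrightarrow>
     (\<forall>J \<in> fsets I r. \<sigma> S J \<in> A) \<and>
     is_zero_object C (\<sigma> S {}) \<and>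
     (\<forall>(J, K) \<in> gpairs I r. is_mono C (\<sigma> S J) (\<sigma> S K) (\<iota> S J K)) \<and>
     (\<forall>J \<in> fsets I r. \<iota> S J J = Id C (\<sigma> S J)) \<and>
     (\<forall>(J, K) \<in> hpairs I r. is_epi C (\<sigma> S J) (\<sigma> S K) (\<pi> S J K)) \<and>
     (\<forall>J \<in> fsets I r. \<pi> S J J = Id C (\<sigma> S J)) \<and>
     (\<forall>(J, K) \<in> gpairs I r.
        short_exact C (\<sigma> S J) (\<iota> S J K) (\<sigma> S K) (\<pi> S K (K - J)) (\<sigma> S (K - J))) \<and>
     (\<forall>J K L. (J, K) \<in> gpairs I r \<and> (K, L) \<in> gpairs I r \<longrightarrow>
        \<iota> S J L = \<iota> S K L \<cdot>\<^bsub>C\<^esub> \<iota> S J K) \<and>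
     (\<forall>J K L. (J, K) \<in> hpairs I r \<and> (K, L) \<in> hpairs I r \<longrightarrow>
        \<pi> S J L = \<pi> S K L \<cdot>\<^bsub>C\<^esub> \<pi> S J K) \<and>
     (\<forall>J K L. (J, K) \<in> gpairs I r \<and> (K, L) \<in> hpairs I r \<longrightarrow>
        \<pi> S K L \<cdot>\<^bsub>C\<^esub> \<iota> S J K = \<iota> S (J \<inter> L) L \<cdot>\<^bsub>C\<^esub> \<pi> S J (J \<inter> L))"

definition is_config_iso ::
  "('o, 'm) category_data \<Rightarrow> 'i set \<Rightarrow> 'i rel \<Rightarrow> ('i, 'o, 'm) config_data \<Rightarrow>
     ('i, 'o, 'm) config_data \<Rightarrow> ('i set \<Rightarrow> 'm) \<Rightarrow> bool" where
  "is_config_iso C I r S S' \<alpha> \<longleftrightarrow>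
     (\<forall>J \<in> fsets I r. is_iso C (\<sigma> S J) (\<sigma> S' J) (\<alpha> J)) \<and>
     (\<forall>(J, K) \<in> gpairs I r. \<alpha> K \<cdot>\<^bsub>C\<^esub> \<iota> S J K = \<iota> S' J K \<cdot>\<^bsub>C\<^esub> \<alpha> J) \<and>
     (\<forall>(J, K) \<in> hpairs I r. \<alpha> K \<cdot>\<^bsub>C\<^esub> \<pi> S J K = \<pi> S' J K \<cdot>\<^bsub>C\<^esub> \<alpha> J)"

text \<open>\<open>r\<close> dominates \<open>r'\<close> by \<open>s\<close> steps.\<close>

definition dominates_by :: "'i set \<Rightarrow> 'i rel \<Rightarrow> 'i rel \<Rightarrow> nat \<Rightarrow> bool" where
  "dominates_by I r r' s \<longleftrightarrow> partial_order_on I r \<and> partial_order_on I r' \<and> r' \<subseteq> r \<and>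
     card {(a, b). (a, b) \<in> r \<and> (a, b) \<notin> r'} = s"

text \<open>\<open>S'\<close> is an \<open>(I, r')\<close>-improvement of the \<open>(I, r)\<close>-configuration \<open>S\<close>.\<close>

definition is_improvement ::
  "('o, 'm) category_data \<Rightarrow> 'o set \<Rightarrow> 'i set \<Rightarrow> 'i rel \<Rightarrow> 'i rel \<Rightarrow>
     ('i, 'o, 'm) config_data \<Rightarrow> ('i, 'o, 'm) config_data \<Rightarrow> bool" where
  "is_improvement C A I r r' S S' \<longleftrightarrow> is_configuration C A I r' S' \<and>
     (\<forall>J \<in> fsets I r. \<sigma> S' J = \<sigma> S J) \<and>
     (\<forall>(J, K) \<in> gpairs I r. \<iota> S' J K = \<iota> S J K) \<and>
     (\<forall>(J, K) \<in> hpairs I r. \<pi> S' J K = \<pi> S J K)"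

definition improvements ::
  "('o, 'm) category_data \<Rightarrow> 'o set \<Rightarrow> 'i set \<Rightarrow> 'i rel \<Rightarrow> 'i rel \<Rightarrow>
     ('i, 'o, 'm) config_data \<Rightarrow> ('i, 'o, 'm) config_data set" where
  "improvements C A I r r' S = {S'. is_improvement C A I r r' S S'}"

text \<open>Improvements that differ only in their irrelevant values are also identified by this
  relation, so its quotient is insensitive to them.\<close>

definition canonical_iso_rel ::
  "('o, 'm) category_data \<Rightarrow> 'o set \<Rightarrow> 'i set \<Rightarrow> 'i rel \<Rightarrow> 'i rel \<Rightarrow>
     ('i, 'o, 'm) config_data \<Rightarrow> ('i, 'o, 'm) config_data rel" where
  "canonical_iso_rel C A I r r' S =
     {(S\<^sub>1, S\<^sub>2). S\<^sub>1 \<in> improvements C A I r r' S \<and> S\<^sub>2 \<in> improvements C A I r r' S \<and>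
        (\<exists>\<alpha>. is_config_iso C I r' S\<^sub>1 S\<^sub>2 \<alpha> \<and> (\<forall>J \<in> fsets I r. \<alpha> J = Id C (\<sigma> S J)))}"

end

theory Submission
  imports Defs
begin

text \<open>
  Write \<open>r\<close> for the given order, in which \<open>j\<close> covers \<open>i\<close>, and \<open>r'\<close> for \<open>r\<close> without the pair
  \<open>(i, j)\<close>. Every improvement \<open>S'\<close> contains the arrow \<open>\<iota>({j}, {i, j})\<close>, since \<open>j\<close> is minimal in
  \<open>{i, j}\<close> for \<open>r'\<close>, and this arrow is a section of \<open>\<pi>({i, j}, {j})\<close>. The theorem holds because
  improvements are classified by this section: every section occurs, and two improvements with the
  same section are canonically isomorphic. The sequence of \<open>\<sigma>({i})\<close>, \<open>\<sigma>({i, j})\<close>, \<open>\<sigma>({j})\<close> is split,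
  so its sections exist and any two of them differ by an arrow \<open>\<sigma>({j}) \<rightarrow> \<sigma>({i})\<close>.

  Both claims rest on the principle that a configuration is a lattice homomorphism \<open>U \<mapsto> \<sigma>(U)\<close> from
  the lower sets (down-closed subsets) of \<open>I\<close> to the subobjects of \<open>\<sigma>(I)\<close>. An f-set \<open>J\<close> is a
  difference of lower sets, \<open>J = U - (U - J)\<close>, and \<open>\<sigma>(J)\<close> is the quotient \<open>\<sigma>(U) / \<sigma>(U - J)\<close>. All arrows
  \<open>\<iota>\<close> and \<open>\<pi>\<close> are induced by inclusions of lower sets, which gives the composition rules at once,
  and exactness is the third isomorphism theorem (\<open>is_configuration_\<tau>\<close>). The quotient is independent of
  \<open>U\<close> by the second isomorphism theorem, and this is where meets and joins must be preserved
  (\<open>ses_restrict\<close>). In the other direction, isomorphisms on lower sets extend to isomorphisms of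
  configurations (\<open>config_iso_of_lower_isos\<close>).

  So only the lower sets matter. Those that \<open>r'\<close> has in addition to \<open>r\<close> are the \<open>U\<close> with \<open>j \<in> U\<close> and
  \<open>i \<notin> U\<close>. For them \<open>U \<union> {i}\<close> is a lower set of \<open>r\<close> with \<open>{i, j}\<close> as an upper part. A section \<open>s\<close>
  determines a retraction \<open>p\<close> of \<open>\<sigma>({i, j})\<close> onto \<open>\<sigma>({i})\<close> that vanishes on \<open>s\<close>, and any improvement
  with section \<open>s\<close> has as \<open>\<sigma>(U)\<close> the kernel of \<open>\<sigma>(U \<union> {i}) \<rightarrow> \<sigma>({i, j}) \<rightarrow> \<sigma>({i})\<close>, where the last arrow is
  \<open>p\<close>. This proves uniqueness (\<open>canonical_iso_if_same_section\<close>). Conversely, these kernels preserve meets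
  (\<open>e_meet\<close>) and joins (\<open>e_join\<close>) together with the old subobjects, so they define a configuration, and
  it is an improvement with section \<open>s\<close> (\<open>ex_improvement\<close>).
\<close>

section \<open>Arrows of a category\<close>

context category
begin

text \<open>Hom sets of different pairs of objects are disjoint, so an arrow has a domain and a codomain. Stated
  with \<open>arr\<close>, \<open>dom\<close> and \<open>cod\<close>, the side conditions of the category laws are equations between objects,
  which the simplifier can decide; with Hom sets it would have to guess the middle object of a
  composite.\<close>

definition arrow :: "'m \<Rightarrow> 'o \<Rightarrow> 'o \<Rightarrow> bool"  ("\<guillemotleft>_ : _ \<rightarrow> _\<guillemotright>") where
  "\<guillemotleft>f : X \<rightarrow> Y\<guillemotright> \<longleftrightarrow> X \<in> Obj C \<and> Y \<in> Obj C \<and> f \<in> Hom C X Y"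

definition arr :: "'m \<Rightarrow> bool" where
  "arr f \<longleftrightarrow> (\<exists>X Y. \<guillemotleft>f : X \<rightarrow> Y\<guillemotright>)"

definition dom :: "'m \<Rightarrow> 'o" where
  "dom f = (THE X. \<exists>Y. \<guillemotleft>f : X \<rightarrow> Y\<guillemotright>)"

definition cod :: "'m \<Rightarrow> 'o" where
  "cod f = (THE Y. \<exists>X. \<guillemotleft>f : X \<rightarrow> Y\<guillemotright>)"

lemma arrow_iff: "\<guillemotleft>f : X \<rightarrow> Y\<guillemotright> \<longleftrightarrow> arr f \<and> dom f = X \<and> cod f = Y"
proof -
  have "dom f = X \<and> cod f = Y" if "\<guillemotleft>f : X \<rightarrow> Y\<guillemotright>" for X Y
    unfolding dom_def cod_def
    using that by (auto simp: arrow_def dest: Hom_disjoint intro!: the_equality)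
  then show ?thesis
    by (auto simp: arr_def)
qed

lemma in_Hom_iff: "X \<in> Obj C \<Longrightarrow> Y \<in> Obj C \<Longrightarrow> f \<in> Hom C X Y \<longleftrightarrow> arr f \<and> dom f = X \<and> cod f = Y"
  by (simp add: arrow_iff[symmetric] arrow_def)

lemma dom_Obj [simp]: "arr f \<Longrightarrow> dom f \<in> Obj C"
  and cod_Obj [simp]: "arr f \<Longrightarrow> cod f \<in> Obj C"
  using arrow_iff[of f "dom f" "cod f"] by (auto simp: arrow_def)

lemma Comp_arrow:
  assumes "arr f" "arr g" "cod f = dom g"
  shows "\<guillemotleft>g \<cdot> f : dom f \<rightarrow> cod g\<guillemotright>"
  using assms arrow_iff[of f "dom f" "cod f"] arrow_iff[of g "dom g" "cod g"]
    Comp_in_Hom[of "dom f" "cod f" "cod g" f g]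
  unfolding arrow_def by auto

lemma arr_Comp [simp]:
  assumes "arr f" "arr g" "cod f = dom g"
  shows "arr (g \<cdot> f)" "dom (g \<cdot> f) = dom f" "cod (g \<cdot> f) = cod g"
  using Comp_arrow[OF assms] by (auto simp: arrow_iff)

lemma Id_arrow [simp]:
  assumes "X \<in> Obj C"
  shows "arr (Id C X)" "dom (Id C X) = X" "cod (Id C X) = X"
  using assms Id_in_Hom[of X] arrow_iff[of "Id C X" X X] unfolding arrow_def by auto

lemma arr_Comp_Id [simp]: "arr f \<Longrightarrow> dom f = X \<Longrightarrow> f \<cdot> Id C X = f"
  using Comp_Id[of "dom f" "cod f" f] by (auto simp: in_Hom_iff)

lemma arr_Id_Comp [simp]: "arr f \<Longrightarrow> cod f = X \<Longrightarrow> Id C X \<cdot> f = f"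
  using Id_Comp[of "dom f" "cod f" f] by (auto simp: in_Hom_iff)

lemma arr_Comp_assoc [simp]:
  "arr f \<Longrightarrow> arr g \<Longrightarrow> arr h \<Longrightarrow> cod f = dom g \<Longrightarrow> cod g = dom h \<Longrightarrow> (h \<cdot> g) \<cdot> f = h \<cdot> (g \<cdot> f)"
  by (rule Comp_assoc[of "dom f" "cod f" "cod g" "cod h"]) (auto simp: in_Hom_iff)

definition monic :: "'m \<Rightarrow> bool" where
  "monic f \<longleftrightarrow> arr f \<and> (\<forall>g h. arr g \<and> arr h \<and> dom g = dom h \<and> cod g = dom f \<and> cod h = dom f \<and>
     f \<cdot> g = f \<cdot> h \<longrightarrow> g = h)"

definition epic :: "'m \<Rightarrow> bool" where
  "epic f \<longleftrightarrow> arr f \<and> (\<forall>g h. arr g \<and> arr h \<and> cod g = cod h \<and> dom g = cod f \<and> dom h = cod f \<and>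
     g \<cdot> f = h \<cdot> f \<longrightarrow> g = h)"

lemma monic_defI:
  assumes "arr f"
    and "\<And>g h. arr g \<Longrightarrow> arr h \<Longrightarrow> dom g = dom h \<Longrightarrow> cod g = dom f \<Longrightarrow> cod h = dom f \<Longrightarrow>
      f \<cdot> g = f \<cdot> h \<Longrightarrow> g = h"
  shows "monic f"
  using assms unfolding monic_def by blast

lemma epic_defI:
  assumes "arr f"
    and "\<And>g h. arr g \<Longrightarrow> arr h \<Longrightarrow> cod g = cod h \<Longrightarrow> dom g = cod f \<Longrightarrow> dom h = cod f \<Longrightarrow>
      g \<cdot> f = h \<cdot> f \<Longrightarrow> g = h"
  shows "epic f"
  using assms unfolding epic_def by blast

lemma monic_arr [simp]: "monic f \<Longrightarrow> arr f"
  by (simp add: monic_def)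

lemma epic_arr [simp]: "epic f \<Longrightarrow> arr f"
  by (simp add: epic_def)

lemma monic_cancel:
  "monic f \<Longrightarrow> f \<cdot> g = f \<cdot> h \<Longrightarrow> arr g \<Longrightarrow> arr h \<Longrightarrow> dom g = dom h \<Longrightarrow> cod g = dom f \<Longrightarrow> cod h = dom f
    \<Longrightarrow> g = h"
  unfolding monic_def by blast

lemma epic_cancel:
  "epic f \<Longrightarrow> g \<cdot> f = h \<cdot> f \<Longrightarrow> arr g \<Longrightarrow> arr h \<Longrightarrow> cod g = cod h \<Longrightarrow> dom g = cod f \<Longrightarrow> dom h = cod f
    \<Longrightarrow> g = h"
  unfolding epic_def by blast

lemma is_mono_iff:
  assumes "X \<in> Obj C" "Y \<in> Obj C"
  shows "is_mono C X Y f \<longleftrightarrow> \<guillemotleft>f : X \<rightarrow> Y\<guillemotright> \<and> monic f"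
proof
  assume m: "is_mono C X Y f"
  then have f: "arr f" "dom f = X" "cod f = Y"
    using assms by (auto simp: is_mono_def in_Hom_iff)
  have "monic f"
  proof (rule monic_defI)
    fix g h
    assume "arr g" "arr h" "dom g = dom h" "cod g = dom f" "cod h = dom f" "f \<cdot> g = f \<cdot> h"
    moreover from this have "g \<in> Hom C (dom h) X" "h \<in> Hom C (dom h) X" "dom h \<in> Obj C"
      using assms f by (auto simp: in_Hom_iff)
    ultimately show "g = h" using m unfolding is_mono_def by blast
  qed fact
  then show "\<guillemotleft>f : X \<rightarrow> Y\<guillemotright> \<and> monic f" using f by (simp add: arrow_iff)
next
  assume e: "\<guillemotleft>f : X \<rightarrow> Y\<guillemotright> \<and> monic f"
  have "g = h" if "W \<in> Obj C" "g \<in> Hom C W X" "h \<in> Hom C W X" "f \<cdot> g = f \<cdot> h" for W g h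
    using that assms e by - (rule monic_cancel[of f], simp_all add: in_Hom_iff arrow_iff)
  then show "is_mono C X Y f"
    using e unfolding is_mono_def arrow_def by blast
qed

lemma is_epi_iff:
  assumes "X \<in> Obj C" "Y \<in> Obj C"
  shows "is_epi C X Y f \<longleftrightarrow> \<guillemotleft>f : X \<rightarrow> Y\<guillemotright> \<and> epic f"
proof
  assume m: "is_epi C X Y f"
  then have f: "arr f" "dom f = X" "cod f = Y"
    using assms by (auto simp: is_epi_def in_Hom_iff)
  have "epic f"
  proof (rule epic_defI)
    fix g h
    assume "arr g" "arr h" "cod g = cod h" "dom g = cod f" "dom h = cod f" "g \<cdot> f = h \<cdot> f"
    moreover from this have "g \<in> Hom C Y (cod h)" "h \<in> Hom C Y (cod h)" "cod h \<in> Obj C"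
      using assms f by (auto simp: in_Hom_iff)
    ultimately show "g = h" using m unfolding is_epi_def by blast
  qed fact
  then show "\<guillemotleft>f : X \<rightarrow> Y\<guillemotright> \<and> epic f" using f by (simp add: arrow_iff)
next
  assume e: "\<guillemotleft>f : X \<rightarrow> Y\<guillemotright> \<and> epic f"
  have "g = h" if "W \<in> Obj C" "g \<in> Hom C Y W" "h \<in> Hom C Y W" "g \<cdot> f = h \<cdot> f" for W g h
    using that assms e by - (rule epic_cancel[of f], simp_all add: in_Hom_iff arrow_iff)
  then show "is_epi C X Y f"
    using e unfolding is_epi_def arrow_def by blast
qed

lemma monic_Id [simp]: "X \<in> Obj C \<Longrightarrow> monic (Id C X)"
  by (rule monic_defI) simp_all

lemma epic_Id [simp]: "X \<in> Obj C \<Longrightarrow> epic (Id C X)"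
  by (rule epic_defI) simp_all

lemma monic_Comp:
  assumes "monic f" "monic g" "cod f = dom g"
  shows "monic (g \<cdot> f)"
proof (rule monic_defI)
  fix u v
  assume uv: "arr u" "arr v" "dom u = dom v" "cod u = dom (g \<cdot> f)" "cod v = dom (g \<cdot> f)"
    "(g \<cdot> f) \<cdot> u = (g \<cdot> f) \<cdot> v"
  with assms have "g \<cdot> (f \<cdot> u) = g \<cdot> (f \<cdot> v)" by simp
  then have "f \<cdot> u = f \<cdot> v" using assms uv by - (rule monic_cancel[OF assms(2)], auto)
  then show "u = v" using assms uv by - (rule monic_cancel[OF assms(1)], auto)
qed (use assms in simp)

lemma epic_Comp:
  assumes "epic f" "epic g" "cod f = dom g"
  shows "epic (g \<cdot> f)"
proof (rule epic_defI)
  fix u v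
  assume uv: "arr u" "arr v" "cod u = cod v" "dom u = cod (g \<cdot> f)" "dom v = cod (g \<cdot> f)"
    "u \<cdot> (g \<cdot> f) = v \<cdot> (g \<cdot> f)"
  with assms have "(u \<cdot> g) \<cdot> f = (v \<cdot> g) \<cdot> f" by simp
  then have "u \<cdot> g = v \<cdot> g" using assms uv by - (rule epic_cancel[OF assms(1)], auto)
  then show "u = v" using assms uv by - (rule epic_cancel[OF assms(2)], auto)
qed (use assms in simp)

lemma epic_of_Comp:
  assumes "epic (g \<cdot> f)" "arr f" "arr g" "cod f = dom g"
  shows "epic g"
proof (rule epic_defI)
  fix u v
  assume uv: "arr u" "arr v" "cod u = cod v" "dom u = cod g" "dom v = cod g" "u \<cdot> g = v \<cdot> g"
  then have "u \<cdot> (g \<cdot> f) = v \<cdot> (g \<cdot> f)" using assms by (simp flip: arr_Comp_assoc)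
  then show "u = v" using assms uv by - (rule epic_cancel[OF assms(1)], auto)
qed (fact assms)

lemma monic_of_Comp:
  assumes "monic (g \<cdot> f)" "arr f" "arr g" "cod f = dom g"
  shows "monic f"
proof (rule monic_defI)
  fix u v
  assume uv: "arr u" "arr v" "dom u = dom v" "cod u = dom f" "cod v = dom f" "f \<cdot> u = f \<cdot> v"
  then have "g \<cdot> (f \<cdot> u) = g \<cdot> (f \<cdot> v)" by simp
  then show "u = v" using assms uv by - (rule monic_cancel[OF assms(1)], auto)
qed (fact assms)

lemma is_isoI:
  assumes "\<guillemotleft>f : X \<rightarrow> Y\<guillemotright>" "\<guillemotleft>g : Y \<rightarrow> X\<guillemotright>" "g \<cdot> f = Id C X" "f \<cdot> g = Id C Y"
  shows "is_iso C X Y f"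
  using assms unfolding is_iso_def arrow_def by blast

end

section \<open>Kernels, cokernels and exactness\<close>

context preadditive_category
begin

text \<open>The zero arrow between whatever objects \<open>f\<close> connects.\<close>

definition null :: "'m \<Rightarrow> bool" where
  "null f \<longleftrightarrow> f = Zero C (dom f) (cod f)"

lemma Zero_arrow [simp]:
  assumes "X \<in> Obj C" "Y \<in> Obj C"
  shows "arr (Zero C X Y)" "dom (Zero C X Y) = X" "cod (Zero C X Y) = Y"
proof -
  interpret G: comm_group "hom_group C X Y" using hom_comm_group assms .
  have "Zero C X Y \<in> Hom C X Y"
    using G.one_closed by (simp add: hom_group_def)
  then show "arr (Zero C X Y)" "dom (Zero C X Y) = X" "cod (Zero C X Y) = Y"
    using assms by (auto simp: in_Hom_iff)
qed

lemma null_Zero [simp]: "X \<in> Obj C \<Longrightarrow> Y \<in> Obj C \<Longrightarrow> null (Zero C X Y)"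
  by (simp add: null_def)

lemma eq_Zero_iff: "arr f \<Longrightarrow> dom f = X \<Longrightarrow> cod f = Y \<Longrightarrow> f = Zero C X Y \<longleftrightarrow> null f"
  by (auto simp: null_def)

lemma null_eqI: "null f \<Longrightarrow> null g \<Longrightarrow> dom f = dom g \<Longrightarrow> cod f = cod g \<Longrightarrow> f = g"
  by (simp add: null_def)

lemma Hom_group_idem:
  assumes "f \<in> Hom C X Y" "X \<in> Obj C" "Y \<in> Obj C" "f \<^bold>+ f = f"
  shows "f = Zero C X Y"
proof -
  interpret G: comm_group "hom_group C X Y" using hom_comm_group assms(2,3) .
  show ?thesis
    using G.r_cancel_one[of f f] assms by (simp add: hom_group_def)
qed

lemma Zero_Add_Zero:
  assumes "X \<in> Obj C" "Y \<in> Obj C"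
  shows "Zero C X Y \<^bold>+ Zero C X Y = Zero C X Y"
proof -
  interpret G: comm_group "hom_group C X Y" using hom_comm_group assms .
  show ?thesis
    using G.l_one[OF G.one_closed] by (simp add: hom_group_def)
qed

lemma null_Comp_left [simp]:
  assumes "null g" "arr f" "arr g" "cod f = dom g"
  shows "null (g \<cdot> f)"
proof -
  have g: "g \<^bold>+ g = g"
    using assms Zero_Add_Zero[of "dom g" "cod g"] by (simp add: null_def)
  have "(g \<cdot> f) \<^bold>+ (g \<cdot> f) = g \<cdot> f"
    using Add_Comp[of "dom f" "cod f" "cod g" f g g] assms g by (simp add: in_Hom_iff)
  then have "g \<cdot> f = Zero C (dom f) (cod g)"
    using assms by (intro Hom_group_idem) (auto simp: in_Hom_iff)
  then show ?thesis using assms by (simp add: null_def)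
qed

lemma null_Comp_right [simp]:
  assumes "null f" "arr f" "arr g" "cod f = dom g"
  shows "null (g \<cdot> f)"
proof -
  have f: "f \<^bold>+ f = f"
    using assms Zero_Add_Zero[of "dom f" "cod f"] by (simp add: null_def)
  have "(g \<cdot> f) \<^bold>+ (g \<cdot> f) = g \<cdot> f"
    using Comp_Add[of "dom f" "cod f" "cod g" f f g] assms f by (simp add: in_Hom_iff)
  then have "g \<cdot> f = Zero C (dom f) (cod g)"
    using assms by (intro Hom_group_idem) (auto simp: in_Hom_iff)
  then show ?thesis using assms by (simp add: null_def)
qed

lemma monic_null:
  assumes "monic f" "null (f \<cdot> g)" "arr g" "cod g = dom f"
  shows "null g"
proof -
  have "f \<cdot> g = f \<cdot> Zero C (dom g) (cod g)"
    using assms by - (rule null_eqI, auto)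
  then have "g = Zero C (dom g) (cod g)"
    using assms by - (rule monic_cancel[OF assms(1)], auto)
  then show ?thesis by (simp add: null_def)
qed

lemma epic_null:
  assumes "epic f" "null (g \<cdot> f)" "arr g" "dom g = cod f"
  shows "null g"
proof -
  have "g \<cdot> f = Zero C (dom g) (cod g) \<cdot> f"
    using assms by - (rule null_eqI, auto)
  then have "g = Zero C (dom g) (cod g)"
    using assms by - (rule epic_cancel[OF assms(1)], auto)
  then show ?thesis by (simp add: null_def)
qed

lemma ex_difference:
  assumes "arr f" "arr g" "dom f = dom g" "cod f = cod g"
  obtains d where "\<guillemotleft>d : dom g \<rightarrow> cod g\<guillemotright>" "f = g \<^bold>+ d"
proof -
  interpret G: comm_group "hom_group C (dom g) (cod g)" using hom_comm_group assms by auto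
  have fg: "f \<in> carrier (hom_group C (dom g) (cod g))" "g \<in> carrier (hom_group C (dom g) (cod g))"
    using assms by (auto simp: hom_group_def in_Hom_iff)
  let ?d = "inv\<^bsub>hom_group C (dom g) (cod g)\<^esub> g \<otimes>\<^bsub>hom_group C (dom g) (cod g)\<^esub> f"
  have "?d \<in> carrier (hom_group C (dom g) (cod g))"
    using fg by simp
  moreover have "f = g \<otimes>\<^bsub>hom_group C (dom g) (cod g)\<^esub> ?d"
    using fg G.m_assoc[symmetric] by simp
  ultimately show ?thesis
    using assms by (intro that[of ?d]) (auto simp: hom_group_def arrow_def)
qed

lemma Add_cancel_Zero:
  assumes "\<guillemotleft>g : X \<rightarrow> Y\<guillemotright>" "\<guillemotleft>d : X \<rightarrow> Y\<guillemotright>" "g \<^bold>+ d = g"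
  shows "null d"
proof -
  interpret G: comm_group "hom_group C X Y" using hom_comm_group assms unfolding arrow_def by auto
  have "d = Zero C X Y"
    using G.r_cancel_one[of g d] G.m_comm[of g d] assms by (simp add: hom_group_def arrow_def)
  then show ?thesis using assms by (auto simp: arrow_def)
qed

lemma Add_null:
  assumes "\<guillemotleft>g : X \<rightarrow> Y\<guillemotright>" "\<guillemotleft>d : X \<rightarrow> Y\<guillemotright>" "null d"
  shows "g \<^bold>+ d = g" and "d \<^bold>+ g = g"
proof -
  interpret G: comm_group "hom_group C X Y" using hom_comm_group assms unfolding arrow_def by auto
  have "d = Zero C X Y" using assms by (auto simp: arrow_iff null_def)
  then show "g \<^bold>+ d = g" "d \<^bold>+ g = g"
    using G.r_one[of g] G.l_one[of g] assms by (auto simp: hom_group_def arrow_def)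
qed

lemma Add_arrow:
  assumes "\<guillemotleft>g : X \<rightarrow> Y\<guillemotright>" "\<guillemotleft>d : X \<rightarrow> Y\<guillemotright>"
  shows "\<guillemotleft>g \<^bold>+ d : X \<rightarrow> Y\<guillemotright>"
proof -
  interpret G: comm_group "hom_group C X Y" using hom_comm_group assms unfolding arrow_def by auto
  show ?thesis
    using G.m_closed[of g d] assms by (auto simp: hom_group_def arrow_def)
qed

text \<open>The difference of two arrows that \<open>f\<close> identifies is killed by \<open>f\<close>.\<close>

lemma monicI:
  assumes "arr f" and "\<And>g. arr g \<Longrightarrow> cod g = dom f \<Longrightarrow> null (f \<cdot> g) \<Longrightarrow> null g"
  shows "monic f"
proof (rule monic_defI)
  fix u v
  assume uv: "arr u" "arr v" "dom u = dom v" "cod u = dom f" "cod v = dom f" "f \<cdot> u = f \<cdot> v"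
  obtain d where d: "\<guillemotleft>d : dom v \<rightarrow> cod v\<guillemotright>" "u = v \<^bold>+ d"
    using ex_difference[of u v] uv by auto
  have "f \<cdot> u = (f \<cdot> v) \<^bold>+ (f \<cdot> d)"
    unfolding d(2) using uv d(1) assms(1)
    by (intro Comp_Add[of "dom v" "cod v" "cod f"]) (auto simp: in_Hom_iff arrow_iff)
  then have "null (f \<cdot> d)"
    using uv d(1) assms(1) Comp_arrow[of v f] Comp_arrow[of d f]
    by (intro Add_cancel_Zero[of "f \<cdot> v" "dom v" "cod f"]) (auto simp: arrow_iff)
  then have "null d" using assms(2)[of d] d(1) uv by (auto simp: arrow_iff)
  then show "u = v" using Add_null[of v "dom v" "cod v" d] d uv by (auto simp: arrow_iff)
qed (fact assms(1))

lemma epicI: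
  assumes "arr f" and "\<And>g. arr g \<Longrightarrow> dom g = cod f \<Longrightarrow> null (g \<cdot> f) \<Longrightarrow> null g"
  shows "epic f"
proof (rule epic_defI)
  fix u v
  assume uv: "arr u" "arr v" "cod u = cod v" "dom u = cod f" "dom v = cod f" "u \<cdot> f = v \<cdot> f"
  obtain d where d: "\<guillemotleft>d : dom v \<rightarrow> cod v\<guillemotright>" "u = v \<^bold>+ d"
    using ex_difference[of u v] uv by auto
  have "u \<cdot> f = (v \<cdot> f) \<^bold>+ (d \<cdot> f)"
    unfolding d(2) using uv d(1) assms(1)
    by (intro Add_Comp[of "dom f" "cod f" "cod v"]) (auto simp: in_Hom_iff arrow_iff)
  then have "null (d \<cdot> f)"
    using uv d(1) assms(1) Comp_arrow[of f v] Comp_arrow[of f d]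
    by (intro Add_cancel_Zero[of "v \<cdot> f" "dom f" "cod v"]) (auto simp: arrow_iff)
  then have "null d" using assms(2)[of d] d(1) uv by (auto simp: arrow_iff)
  then show "u = v" using Add_null[of v "dom v" "cod v" d] d uv by (auto simp: arrow_iff)
qed (fact assms(1))

text \<open>Uniqueness of factorizations is expressed by \<open>monic k\<close>, so that existence and uniqueness can be used
  separately. The same holds for \<open>cokernel\<close>.\<close>

definition kernel :: "'m \<Rightarrow> 'm \<Rightarrow> bool" where
  "kernel k f \<longleftrightarrow> monic k \<and> arr f \<and> cod k = dom f \<and> null (f \<cdot> k) \<and>
     (\<forall>h. arr h \<and> cod h = dom f \<and> null (f \<cdot> h) \<longrightarrow>
       (\<exists>u. \<guillemotleft>u : dom h \<rightarrow> dom k\<guillemotright> \<and> k \<cdot> u = h))"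

definition cokernel :: "'m \<Rightarrow> 'm \<Rightarrow> bool" where
  "cokernel q f \<longleftrightarrow> epic q \<and> arr f \<and> dom q = cod f \<and> null (q \<cdot> f) \<and>
     (\<forall>h. arr h \<and> dom h = cod f \<and> null (h \<cdot> f) \<longrightarrow>
       (\<exists>u. \<guillemotleft>u : cod q \<rightarrow> cod h\<guillemotright> \<and> u \<cdot> q = h))"

definition ses :: "'m \<Rightarrow> 'm \<Rightarrow> bool" where
  "ses f g \<longleftrightarrow> kernel f g \<and> cokernel g f"

lemma kernelE:
  assumes "kernel k f" "arr h" "cod h = dom f" "null (f \<cdot> h)"
  obtains u where "\<guillemotleft>u : dom h \<rightarrow> dom k\<guillemotright>" "k \<cdot> u = h"
  using assms unfolding kernel_def by blast

lemma cokernelE: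
  assumes "cokernel q f" "arr h" "dom h = cod f" "null (h \<cdot> f)"
  obtains u where "\<guillemotleft>u : cod q \<rightarrow> cod h\<guillemotright>" "u \<cdot> q = h"
  using assms unfolding cokernel_def by blast

lemma is_kernel_iff:
  assumes XY: "X \<in> Obj C" "Y \<in> Obj C"
  shows "is_kernel C X Y f K k \<longleftrightarrow> \<guillemotleft>f : X \<rightarrow> Y\<guillemotright> \<and> \<guillemotleft>k : K \<rightarrow> X\<guillemotright> \<and> kernel k f"
proof
  assume k: "is_kernel C X Y f K k"
  then have f: "\<guillemotleft>f : X \<rightarrow> Y\<guillemotright>" and kk: "\<guillemotleft>k : K \<rightarrow> X\<guillemotright>" and z: "f \<cdot> k = Zero C K Y"
    using XY by (auto simp: is_kernel_def arrow_def)
  have u: "\<exists>!u. u \<in> Hom C (dom h) K \<and> k \<cdot> u = h" if "arr h" "cod h = X" "null (f \<cdot> h)" for h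
  proof -
    have "f \<cdot> h = Zero C (dom h) Y" using that f by (simp add: arrow_iff null_def)
    moreover have "h \<in> Hom C (dom h) X" using that by (auto simp: in_Hom_iff)
    ultimately show ?thesis using k that(1) unfolding is_kernel_def by simp
  qed
  have n: "null (f \<cdot> k)"
    unfolding z using kk XY by (auto simp: arrow_def)
  have "monic k"
  proof (rule monicI)
    fix g assume g: "arr g" "cod g = dom k" "null (k \<cdot> g)"
    let ?z = "Zero C (dom g) (cod g)"
    have "k \<cdot> g = k \<cdot> ?z"
      using g kk by - (rule null_eqI, auto simp: arrow_iff)
    moreover have "\<exists>!u. u \<in> Hom C (dom g) K \<and> k \<cdot> u = k \<cdot> g"
      using u[of "k \<cdot> g"] g kk f by (simp add: arrow_iff)
    then obtain w where "\<And>v. v \<in> Hom C (dom g) K \<Longrightarrow> k \<cdot> v = k \<cdot> g \<Longrightarrow> v = w"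
      by (elim ex1E) blast
    moreover have "g \<in> Hom C (dom g) K" "?z \<in> Hom C (dom g) K"
      using g kk by (auto simp: arrow_iff in_Hom_iff)
    ultimately have "g = ?z" by (metis (no_types))
    then show "null g" by (simp add: null_def)
  qed (use kk in \<open>simp add: arrow_iff\<close>)
  moreover have "\<exists>u. \<guillemotleft>u : dom h \<rightarrow> dom k\<guillemotright> \<and> k \<cdot> u = h" if "arr h" "cod h = dom f" "null (f \<cdot> h)" for h
  proof -
    have "cod h = X" "dom k = K" using that f kk by (simp_all add: arrow_iff)
    moreover have "K \<in> Obj C" using kk by (simp add: arrow_def)
    ultimately show ?thesis using u[of h] that by (auto simp: arrow_def)
  qed
  ultimately show "\<guillemotleft>f : X \<rightarrow> Y\<guillemotright> \<and> \<guillemotleft>k : K \<rightarrow> X\<guillemotright> \<and> kernel k f"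
    using f kk n unfolding kernel_def by (auto simp: arrow_iff)
next
  assume r: "\<guillemotleft>f : X \<rightarrow> Y\<guillemotright> \<and> \<guillemotleft>k : K \<rightarrow> X\<guillemotright> \<and> kernel k f"
  have "\<exists>!u. u \<in> Hom C W K \<and> k \<cdot> u = h" if W: "W \<in> Obj C" and h: "h \<in> Hom C W X" and
    z: "f \<cdot> h = Zero C W Y" for W h
  proof -
    have h': "arr h" "dom h = W" "cod h = X" using h W XY by (auto simp: in_Hom_iff)
    have "null (f \<cdot> h)" using z W XY by simp
    then obtain u where u: "\<guillemotleft>u : W \<rightarrow> K\<guillemotright>" "k \<cdot> u = h"
      using r h' by - (rule kernelE[of k f h], auto simp: arrow_iff)
    then have "u \<in> Hom C W K" by (simp add: arrow_def)
    moreover have "v = u" if "v \<in> Hom C W K" "k \<cdot> v = h" for v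
    proof (rule monic_cancel[of k])
      have "K \<in> Obj C" using r by (auto simp: arrow_def)
      then show "arr v" "dom v = dom u" "cod v = dom k"
        using that W r u by (auto simp: in_Hom_iff arrow_iff)
    qed (use r u that in \<open>auto simp: kernel_def arrow_iff\<close>)
    ultimately show ?thesis using u(2) by blast
  qed
  moreover have "f \<cdot> k = Zero C K Y"
    using r unfolding kernel_def by (subst eq_Zero_iff) (auto simp: arrow_iff)
  ultimately show "is_kernel C X Y f K k"
    using r unfolding is_kernel_def arrow_def by blast
qed

lemma is_cokernel_iff:
  assumes XY: "X \<in> Obj C" "Y \<in> Obj C"
  shows "is_cokernel C X Y f Q q \<longleftrightarrow> \<guillemotleft>f : X \<rightarrow> Y\<guillemotright> \<and> \<guillemotleft>q : Y \<rightarrow> Q\<guillemotright> \<and> cokernel q f"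
proof
  assume k: "is_cokernel C X Y f Q q"
  then have f: "\<guillemotleft>f : X \<rightarrow> Y\<guillemotright>" and kk: "\<guillemotleft>q : Y \<rightarrow> Q\<guillemotright>" and z: "q \<cdot> f = Zero C X Q"
    using XY by (auto simp: is_cokernel_def arrow_def)
  have u: "\<exists>!u. u \<in> Hom C Q (cod h) \<and> u \<cdot> q = h" if "arr h" "dom h = Y" "null (h \<cdot> f)" for h
  proof -
    have "h \<cdot> f = Zero C X (cod h)" using that f by (simp add: arrow_iff null_def)
    moreover have "h \<in> Hom C Y (cod h)" using that by (auto simp: in_Hom_iff)
    ultimately show ?thesis using k that(1) unfolding is_cokernel_def by simp
  qed
  have n: "null (q \<cdot> f)"
    unfolding z using kk XY by (auto simp: arrow_def)
  have "epic q"
  proof (rule epicI)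
    fix g assume g: "arr g" "dom g = cod q" "null (g \<cdot> q)"
    let ?z = "Zero C (dom g) (cod g)"
    have "g \<cdot> q = ?z \<cdot> q"
      using g kk by - (rule null_eqI, auto simp: arrow_iff)
    moreover have "\<exists>!u. u \<in> Hom C Q (cod g) \<and> u \<cdot> q = g \<cdot> q"
      using u[of "g \<cdot> q"] g kk f n by (simp add: arrow_iff)
    then obtain w where "\<And>v. v \<in> Hom C Q (cod g) \<Longrightarrow> v \<cdot> q = g \<cdot> q \<Longrightarrow> v = w"
      by (elim ex1E) blast
    moreover have "g \<in> Hom C Q (cod g)" "?z \<in> Hom C Q (cod g)"
      using g kk by (auto simp: arrow_iff in_Hom_iff)
    ultimately have "g = ?z" by (metis (no_types))
    then show "null g" by (simp add: null_def)
  qed (use kk in \<open>simp add: arrow_iff\<close>)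
  moreover have "\<exists>u. \<guillemotleft>u : cod q \<rightarrow> cod h\<guillemotright> \<and> u \<cdot> q = h" if "arr h" "dom h = cod f" "null (h \<cdot> f)" for h
  proof -
    have "dom h = Y" "cod q = Q" using that f kk by (simp_all add: arrow_iff)
    moreover have "Q \<in> Obj C" using kk by (simp add: arrow_def)
    ultimately show ?thesis using u[of h] that by (auto simp: arrow_def)
  qed
  ultimately show "\<guillemotleft>f : X \<rightarrow> Y\<guillemotright> \<and> \<guillemotleft>q : Y \<rightarrow> Q\<guillemotright> \<and> cokernel q f"
    using f kk n unfolding cokernel_def by (auto simp: arrow_iff)
next
  assume r: "\<guillemotleft>f : X \<rightarrow> Y\<guillemotright> \<and> \<guillemotleft>q : Y \<rightarrow> Q\<guillemotright> \<and> cokernel q f"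
  have "\<exists>!u. u \<in> Hom C Q W \<and> u \<cdot> q = h" if W: "W \<in> Obj C" and h: "h \<in> Hom C Y W" and
    z: "h \<cdot> f = Zero C X W" for W h
  proof -
    have h': "arr h" "dom h = Y" "cod h = W" using h W XY by (auto simp: in_Hom_iff)
    have "null (h \<cdot> f)" using z W XY by simp
    then obtain u where u: "\<guillemotleft>u : Q \<rightarrow> W\<guillemotright>" "u \<cdot> q = h"
      using r h' by - (rule cokernelE[of q f h], auto simp: arrow_iff)
    then have "u \<in> Hom C Q W" by (simp add: arrow_def)
    moreover have "v = u" if "v \<in> Hom C Q W" "v \<cdot> q = h" for v
    proof (rule epic_cancel[of q])
      have "Q \<in> Obj C" using r by (auto simp: arrow_def)
      then show "arr v" "cod v = cod u" "dom v = cod q"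
        using that W r u by (auto simp: in_Hom_iff arrow_iff)
    qed (use r u that in \<open>auto simp: cokernel_def arrow_iff\<close>)
    ultimately show ?thesis using u(2) by blast
  qed
  moreover have "q \<cdot> f = Zero C X Q"
    using r unfolding cokernel_def by (subst eq_Zero_iff) (auto simp: arrow_iff)
  ultimately show "is_cokernel C X Y f Q q"
    using r unfolding is_cokernel_def arrow_def by blast
qed

end

section \<open>Exactness in abelian categories\<close>

context preadditive_category
begin

lemma kernelD:
  assumes "kernel k f"
  shows "monic k" "arr k" "arr f" "cod k = dom f" "null (f \<cdot> k)"
  using assms by (auto simp: kernel_def)

lemma cokernelD:
  assumes "cokernel q f"
  shows "epic q" "arr q" "arr f" "dom q = cod f" "null (q \<cdot> f)"
  using assms by (auto simp: cokernel_def)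

lemma sesD:
  assumes "ses f g"
  shows "kernel f g" "cokernel g f" "monic f" "epic g" "arr f" "arr g" "dom g = cod f" "null (g \<cdot> f)"
  using assms kernelD[of f g] cokernelD[of g f] by (auto simp: ses_def)

lemma kernelI:
  assumes "monic k" "arr f" "cod k = dom f" "null (f \<cdot> k)"
    and "\<And>h. arr h \<Longrightarrow> cod h = dom f \<Longrightarrow> null (f \<cdot> h) \<Longrightarrow> \<exists>u. \<guillemotleft>u : dom h \<rightarrow> dom k\<guillemotright> \<and> k \<cdot> u = h"
  shows "kernel k f"
  using assms unfolding kernel_def by blast

lemma cokernelI:
  assumes "epic q" "arr f" "dom q = cod f" "null (q \<cdot> f)"
    and "\<And>h. arr h \<Longrightarrow> dom h = cod f \<Longrightarrow> null (h \<cdot> f) \<Longrightarrow> \<exists>u. \<guillemotleft>u : cod q \<rightarrow> cod h\<guillemotright> \<and> u \<cdot> q = h"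
  shows "cokernel q f"
  using assms unfolding cokernel_def by blast

lemma kernel_isoE:
  assumes "kernel k f" "kernel k' f"
  obtains u where "\<guillemotleft>u : dom k \<rightarrow> dom k'\<guillemotright>" "k' \<cdot> u = k" "is_iso C (dom k) (dom k') u"
proof -
  note k = kernelD[OF assms(1)] and k' = kernelD[OF assms(2)]
  obtain u where u: "\<guillemotleft>u : dom k \<rightarrow> dom k'\<guillemotright>" "k' \<cdot> u = k"
    using kernelE[OF assms(2), of k] k by auto
  obtain v where v: "\<guillemotleft>v : dom k' \<rightarrow> dom k\<guillemotright>" "k \<cdot> v = k'"
    using kernelE[OF assms(1), of k'] k' by auto
  have "k \<cdot> (v \<cdot> u) = (k \<cdot> v) \<cdot> u"
    using u(1) v(1) k by (simp add: arrow_iff)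
  then have kvu: "k \<cdot> (v \<cdot> u) = k \<cdot> Id C (dom k)"
    using u v(2) k by (simp add: arrow_iff)
  have "k' \<cdot> (u \<cdot> v) = (k' \<cdot> u) \<cdot> v"
    using u(1) v(1) k' by (simp add: arrow_iff)
  then have kuv: "k' \<cdot> (u \<cdot> v) = k' \<cdot> Id C (dom k')"
    using v u(2) k' by (simp add: arrow_iff)
  have "v \<cdot> u = Id C (dom k)"
    using u(1) v(1) k by - (rule monic_cancel[OF k(1) kvu], auto simp: arrow_iff)
  moreover have "u \<cdot> v = Id C (dom k')"
    using u(1) v(1) k' by - (rule monic_cancel[OF k'(1) kuv], auto simp: arrow_iff)
  ultimately show ?thesis using that u v by (auto intro: is_isoI)
qed

lemma cokernel_isoE:
  assumes "cokernel q f" "cokernel q' f"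
  obtains u where "\<guillemotleft>u : cod q \<rightarrow> cod q'\<guillemotright>" "u \<cdot> q = q'" "is_iso C (cod q) (cod q') u"
proof -
  note q = cokernelD[OF assms(1)] and q' = cokernelD[OF assms(2)]
  obtain u where u: "\<guillemotleft>u : cod q \<rightarrow> cod q'\<guillemotright>" "u \<cdot> q = q'"
    using cokernelE[OF assms(1), of q'] q' by auto
  obtain v where v: "\<guillemotleft>v : cod q' \<rightarrow> cod q\<guillemotright>" "v \<cdot> q' = q"
    using cokernelE[OF assms(2), of q] q by auto
  have "(v \<cdot> u) \<cdot> q = v \<cdot> (u \<cdot> q)" "(u \<cdot> v) \<cdot> q' = u \<cdot> (v \<cdot> q')"
    using u(1) v(1) q q' by (simp_all add: arrow_iff)
  then have quv: "(v \<cdot> u) \<cdot> q = Id C (cod q) \<cdot> q" "(u \<cdot> v) \<cdot> q' = Id C (cod q') \<cdot> q'"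
    unfolding u(2) v(2) using q q' by simp_all
  have "v \<cdot> u = Id C (cod q)"
    using u(1) v(1) q by - (rule epic_cancel[OF q(1) quv(1)], auto simp: arrow_iff)
  moreover have "u \<cdot> v = Id C (cod q')"
    using u(1) v(1) q' by - (rule epic_cancel[OF q'(1) quv(2)], auto simp: arrow_iff)
  ultimately show ?thesis using that u v by (auto intro: is_isoI)
qed

end

context abelian_category
begin

lemma arr_ex_kernel:
  assumes "arr f"
  obtains k where "kernel k f"
proof -
  have "dom f \<in> Obj C" "cod f \<in> Obj C" "f \<in> Hom C (dom f) (cod f)"
    using assms by (auto simp: in_Hom_iff)
  from ex_kernel[OF this] show ?thesis using assms that by (auto simp: is_kernel_iff)
qed

lemma arr_ex_cokernel:
  assumes "arr f"
  obtains q where "cokernel q f"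
proof -
  have "dom f \<in> Obj C" "cod f \<in> Obj C" "f \<in> Hom C (dom f) (cod f)"
    using assms by (auto simp: in_Hom_iff)
  from ex_cokernel[OF this] show ?thesis using assms that by (auto simp: is_cokernel_iff)
qed

text \<open>A monomorphism is the kernel of some \<open>g\<close>. As \<open>g\<close> factors through the cokernel \<open>q\<close>, whatever \<open>q\<close>
  kills is killed by \<open>g\<close>.\<close>

lemma monic_kernel_of_cokernel:
  assumes "monic f" "cokernel q f"
  shows "kernel f q"
proof -
  note q = cokernelD[OF assms(2)]
  have "is_mono C (dom f) (cod f) f"
    using assms by (simp add: is_mono_iff arrow_iff)
  then obtain Z g where "Z \<in> Obj C" "is_kernel C (cod f) Z g (dom f) f"
    using mono_is_kernel[of "dom f" "cod f" f] assms by auto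
  then have g: "kernel f g" using assms by (simp add: is_kernel_iff)
  note g' = kernelD[OF g]
  obtain u where u: "\<guillemotleft>u : cod q \<rightarrow> cod g\<guillemotright>" "u \<cdot> q = g"
    using cokernelE[OF assms(2), of g] g' by auto
  show ?thesis
  proof (rule kernelI)
    fix h assume h: "arr h" "cod h = dom q" "null (q \<cdot> h)"
    have "g \<cdot> h = u \<cdot> (q \<cdot> h)"
      using u h q by (auto simp: arrow_iff)
    then have "null (g \<cdot> h)" using h u(1) q by (simp add: arrow_iff)
    then obtain v where "\<guillemotleft>v : dom h \<rightarrow> dom f\<guillemotright>" "f \<cdot> v = h"
      using kernelE[OF g, of h] h q g' by auto
    then show "\<exists>v. \<guillemotleft>v : dom h \<rightarrow> dom f\<guillemotright> \<and> f \<cdot> v = h" by blast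
  qed (use assms q in auto)
qed

lemma epic_cokernel_of_kernel:
  assumes "epic f" "kernel k f"
  shows "cokernel f k"
proof -
  note k = kernelD[OF assms(2)]
  have "is_epi C (dom f) (cod f) f"
    using assms by (simp add: is_epi_iff arrow_iff)
  then obtain W g where "W \<in> Obj C" "is_cokernel C W (dom f) g (cod f) f"
    using epi_is_cokernel[of "dom f" "cod f" f] assms by auto
  then have g: "cokernel f g" using assms by (simp add: is_cokernel_iff)
  note g' = cokernelD[OF g]
  obtain u where u: "\<guillemotleft>u : dom g \<rightarrow> dom k\<guillemotright>" "k \<cdot> u = g"
    using kernelE[OF assms(2), of g] g' by auto
  show ?thesis
  proof (rule cokernelI)
    fix h assume h: "arr h" "dom h = cod k" "null (h \<cdot> k)"
    have "h \<cdot> g = (h \<cdot> k) \<cdot> u"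
      using u h k by (auto simp: arrow_iff)
    moreover have "null ((h \<cdot> k) \<cdot> u)" using h u(1) k by - (rule null_Comp_left, auto simp: arrow_iff)
    ultimately have "null (h \<cdot> g)" by simp
    then obtain v where "\<guillemotleft>v : cod f \<rightarrow> cod h\<guillemotright>" "v \<cdot> f = h"
      using cokernelE[OF g, of h] h k g' by auto
    then show "\<exists>v. \<guillemotleft>v : cod f \<rightarrow> cod h\<guillemotright> \<and> v \<cdot> f = h" by blast
  qed (use assms k in auto)
qed

lemma ses_if_cokernel: "monic f \<Longrightarrow> cokernel g f \<Longrightarrow> ses f g"
  by (simp add: ses_def monic_kernel_of_cokernel)

lemma ses_if_kernel: "epic g \<Longrightarrow> kernel f g \<Longrightarrow> ses f g"
  by (simp add: ses_def epic_cokernel_of_kernel)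

text \<open>Exactness in the middle identifies the kernel of the cokernel of \<open>f\<close>, which is \<open>f\<close> itself as \<open>f\<close> is
  monic, with the kernel of \<open>g\<close>.\<close>

lemma short_exact_iff: "short_exact C X f Y g Z \<longleftrightarrow> \<guillemotleft>f : X \<rightarrow> Y\<guillemotright> \<and> \<guillemotleft>g : Y \<rightarrow> Z\<guillemotright> \<and> ses f g"
proof
  assume s: "short_exact C X f Y g Z"
  then have XYZ: "X \<in> Obj C" "Y \<in> Obj C" "Z \<in> Obj C"
    by (auto simp: short_exact_def)
  have f: "\<guillemotleft>f : X \<rightarrow> Y\<guillemotright>" "monic f" and g: "\<guillemotleft>g : Y \<rightarrow> Z\<guillemotright>" "epic g"
    using s XYZ by (auto simp: short_exact_def is_mono_iff is_epi_iff)
  obtain M m Q q where mq: "is_cokernel C X Y f Q q" "is_kernel C Y Q q M m" "is_kernel C Y Z g M m"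
    using s by (auto simp: short_exact_def is_image_def)
  then have "Q \<in> Obj C" by (simp add: is_cokernel_def)
  then have q: "cokernel q f" and m: "kernel m q" "kernel m g"
    using mq XYZ by (auto simp: is_cokernel_iff is_kernel_iff)
  have fq: "kernel f q" using monic_kernel_of_cokernel[OF f(2) q] .
  \<comment> \<open>\<open>f\<close> and \<open>m\<close> are both kernels of \<open>q\<close>, so each factors through the other, and \<open>f\<close> is a kernel of
    \<open>g\<close> because \<open>m\<close> is.\<close>
  note F = kernelD[OF fq] and M1 = kernelD[OF m(1)] and M2 = kernelD[OF m(2)]
  obtain u where u: "\<guillemotleft>u : dom m \<rightarrow> dom f\<guillemotright>" "f \<cdot> u = m"
    using kernelE[OF fq, of m] M1 by auto
  obtain v where v: "\<guillemotleft>v : dom f \<rightarrow> dom m\<guillemotright>" "m \<cdot> v = f"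
    using kernelE[OF m(1), of f] F by auto
  have "g \<cdot> f = (g \<cdot> m) \<cdot> v" using v M2 by (auto simp: arrow_iff)
  moreover have "null ((g \<cdot> m) \<cdot> v)" using v(1) M2 by - (rule null_Comp_left, auto simp: arrow_iff)
  ultimately have gf: "null (g \<cdot> f)" by simp
  have "kernel f g"
  proof (rule kernelI)
    fix h assume h: "arr h" "cod h = dom g" "null (g \<cdot> h)"
    obtain w where w: "\<guillemotleft>w : dom h \<rightarrow> dom m\<guillemotright>" "m \<cdot> w = h"
      using kernelE[OF m(2) h] by auto
    have "f \<cdot> (u \<cdot> w) = (f \<cdot> u) \<cdot> w"
      using u(1) w(1) F by (simp add: arrow_iff)
    then have "f \<cdot> (u \<cdot> w) = h"
      using u(2) w(2) by simp
    moreover have "\<guillemotleft>u \<cdot> w : dom h \<rightarrow> dom f\<guillemotright>"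
      using u(1) w(1) by (simp add: arrow_iff)
    ultimately show "\<exists>u. \<guillemotleft>u : dom h \<rightarrow> dom f\<guillemotright> \<and> f \<cdot> u = h" by blast
  qed (use f g gf in \<open>auto simp: arrow_iff\<close>)
  then show "\<guillemotleft>f : X \<rightarrow> Y\<guillemotright> \<and> \<guillemotleft>g : Y \<rightarrow> Z\<guillemotright> \<and> ses f g"
    using f g ses_if_kernel by blast
next
  assume s: "\<guillemotleft>f : X \<rightarrow> Y\<guillemotright> \<and> \<guillemotleft>g : Y \<rightarrow> Z\<guillemotright> \<and> ses f g"
  then have XYZ: "X \<in> Obj C" "Y \<in> Obj C" "Z \<in> Obj C"
    by (auto simp: arrow_def)
  have "is_kernel C Y Z g X f" "is_cokernel C X Y f Z g"
    using s XYZ sesD[of f g] by (auto simp: is_kernel_iff is_cokernel_iff)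
  then show "short_exact C X f Y g Z"
    using s XYZ sesD[of f g] unfolding short_exact_def is_image_def
    by (auto simp: is_mono_iff is_epi_iff)
qed

text \<open>In terms of elements: \<open>t\<close> is injective if \<open>t (q x) = 0\<close> forces \<open>q x = 0\<close>, because every element
  of the domain of \<open>t\<close> is some \<open>q x\<close>. Dividing by the kernel of \<open>t\<close> replaces the choice of \<open>x\<close>,
  which would need pullbacks of epimorphisms.\<close>

lemma monic_if_null_after_epic:
  assumes q: "epic q" and t: "arr t" "cod q = dom t"
    and null: "\<And>f. arr f \<Longrightarrow> cod f = dom q \<Longrightarrow> null (t \<cdot> (q \<cdot> f)) \<Longrightarrow> null (q \<cdot> f)"
  shows "monic t"
proof (rule monicI)
  fix g assume g: "arr g" "cod g = dom t" "null (t \<cdot> g)"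
  obtain k where k: "kernel k t" using arr_ex_kernel[OF t(1)] by blast
  note K = kernelD[OF k]
  obtain u where u: "cokernel u k" using arr_ex_cokernel[OF K(2)] by blast
  note U = cokernelD[OF u]
  obtain t' where t': "\<guillemotleft>t' : cod u \<rightarrow> cod t\<guillemotright>" "t' \<cdot> u = t"
    using cokernelE[OF u, of t] K by auto
  obtain n where n: "kernel n (u \<cdot> q)" using arr_ex_kernel[of "u \<cdot> q"] q U K t by auto
  note N = kernelD[OF n]
  have "cokernel (u \<cdot> q) n"
    using n q U t K by - (rule epic_cokernel_of_kernel, rule epic_Comp, simp_all)
  moreover have "null (q \<cdot> n)"
  proof (rule null)
    have "(t' \<cdot> u) \<cdot> (q \<cdot> n) = t' \<cdot> ((u \<cdot> q) \<cdot> n)"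
      using t'(1) t q U K N by (simp add: arrow_iff)
    then have "t \<cdot> (q \<cdot> n) = t' \<cdot> ((u \<cdot> q) \<cdot> n)"
      unfolding t'(2) .
    moreover have "null (t' \<cdot> ((u \<cdot> q) \<cdot> n))"
      using t'(1) q U K N t by - (rule null_Comp_right, auto simp: arrow_iff)
    ultimately show "null (t \<cdot> (q \<cdot> n))" by simp
  qed (use N q U t K in auto)
  ultimately obtain v where v: "\<guillemotleft>v : cod (u \<cdot> q) \<rightarrow> cod q\<guillemotright>" "v \<cdot> (u \<cdot> q) = q"
    using cokernelE[of "u \<cdot> q" n q] q N U t K by auto
  have "v \<cdot> u = Id C (cod q)"
  proof (rule epic_cancel[OF q])
    show "(v \<cdot> u) \<cdot> q = Id C (cod q) \<cdot> q"
      using v q U t K by (simp add: arrow_iff)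
  qed (use v U K q t in \<open>auto simp: arrow_iff\<close>)
  moreover have "null ((v \<cdot> u) \<cdot> k)"
    using v U K q t by (simp add: arrow_iff)
  ultimately have k0: "null k" using K q t by simp
  obtain w where "\<guillemotleft>w : dom g \<rightarrow> dom k\<guillemotright>" "k \<cdot> w = g"
    using kernelE[OF k g] by auto
  then show "null g" using k0 K by (auto simp: arrow_iff)
qed (fact t)

text \<open>The third isomorphism theorem: \<open>0 \<rightarrow> U/D \<rightarrow> W/D \<rightarrow> W/U \<rightarrow> 0\<close> is exact for \<open>D \<subseteq> U \<subseteq> W\<close>.\<close>

lemma ses_of_quotients:
  assumes a: "ses a c" and ba: "ses (b \<cdot> a) c'" and b: "ses b c''"
    and ab: "cod a = dom b"
    and t: "\<guillemotleft>t : cod c \<rightarrow> cod c'\<guillemotright>" "t \<cdot> c = c' \<cdot> b"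
    and p: "\<guillemotleft>p : cod c' \<rightarrow> cod c''\<guillemotright>" "p \<cdot> c' = c''"
  shows "ses t p"
proof (rule ses_if_cokernel)
  note A = sesD[OF a] and BA = sesD[OF ba] and B = sesD[OF b]
  show "monic t"
  proof (rule monic_if_null_after_epic[of c])
    fix f assume f: "arr f" "cod f = dom c" "null (t \<cdot> (c \<cdot> f))"
    have "t \<cdot> (c \<cdot> f) = (t \<cdot> c) \<cdot> f"
      using t(1) f A by (simp add: arrow_iff)
    then have "null (c' \<cdot> (b \<cdot> f))"
      using t(2) f A B BA ab by simp
    then obtain g where g: "\<guillemotleft>g : dom f \<rightarrow> dom a\<guillemotright>" "(b \<cdot> a) \<cdot> g = b \<cdot> f"
      using kernelE[OF BA(1), of "b \<cdot> f"] f A B BA ab by auto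
    then have "b \<cdot> (a \<cdot> g) = b \<cdot> f"
      using A B ab by (simp add: arrow_iff)
    then have "a \<cdot> g = f"
      using g(1) f A B ab by - (rule monic_cancel[OF B(3)], auto simp: arrow_iff)
    then have "c \<cdot> f = (c \<cdot> a) \<cdot> g"
      using g(1) A by (auto simp: arrow_iff)
    moreover have "null ((c \<cdot> a) \<cdot> g)"
      using g(1) A by - (rule null_Comp_left, auto simp: arrow_iff)
    ultimately show "null (c \<cdot> f)" by simp
  qed (use A t in \<open>auto simp: arrow_iff\<close>)
  show "cokernel p t"
  proof (rule cokernelI)
    show "epic p"
      using epic_of_Comp[of p c'] p BA B by (auto simp: arrow_iff)
    have "null (c'' \<cdot> b)" using B by simp
    moreover have "(p \<cdot> t) \<cdot> c = c'' \<cdot> b"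
    proof -
      have "(p \<cdot> t) \<cdot> c = p \<cdot> (t \<cdot> c)" using p(1) t(1) A by (simp add: arrow_iff)
      also have "\<dots> = (p \<cdot> c') \<cdot> b" unfolding t(2) using p(1) A B BA ab by (simp add: arrow_iff)
      finally show ?thesis using p(2) by simp
    qed
    ultimately show "null (p \<cdot> t)"
      using A t(1) p(1) by - (rule epic_null[OF A(4)], auto simp: arrow_iff)
    fix h assume h: "arr h" "dom h = cod t" "null (h \<cdot> t)"
    have "(h \<cdot> c') \<cdot> b = (h \<cdot> t) \<cdot> c"
      using h t A B BA ab by (simp add: arrow_iff)
    moreover have "null ((h \<cdot> t) \<cdot> c)"
      using h t(1) A by - (rule null_Comp_left, auto simp: arrow_iff)
    ultimately have "null ((h \<cdot> c') \<cdot> b)" by simp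
    then obtain u where u: "\<guillemotleft>u : cod c'' \<rightarrow> cod h\<guillemotright>" "u \<cdot> c'' = h \<cdot> c'"
      using cokernelE[OF B(2), of "h \<cdot> c'"] h t(1) A B BA ab by (auto simp: arrow_iff)
    have "(u \<cdot> p) \<cdot> c' = h \<cdot> c'"
      using u p BA by (simp add: arrow_iff)
    then have "u \<cdot> p = h"
      using u(1) p(1) h t(1) BA by - (rule epic_cancel[OF BA(4)], auto simp: arrow_iff)
    then show "\<exists>u. \<guillemotleft>u : cod p \<rightarrow> cod h\<guillemotright> \<and> u \<cdot> p = h"
      using u(1) p(1) by (auto simp: arrow_iff)
  qed (use t p in \<open>auto simp: arrow_iff\<close>)
qed

text \<open>The second isomorphism theorem: if \<open>d\<close> represents \<open>U \<inter> D'\<close> and \<open>U + D' = U'\<close>, then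
  \<open>U / (U \<inter> D') \<cong> U' / D'\<close>. The sum condition is that \<open>u\<close> and \<open>d'\<close> are jointly epic, which is what makes
  the composite of \<open>u\<close> with the quotient by \<open>D'\<close> epic; its kernel is the meet.\<close>

lemma ses_of_meet_and_join:
  assumes c: "ses d' c" and u: "monic u" "cod u = cod d'"
    and d: "monic d" "cod d = dom u" and cud: "null (c \<cdot> (u \<cdot> d))"
    and meet: "\<And>f g. arr f \<Longrightarrow> arr g \<Longrightarrow> dom f = dom g \<Longrightarrow> cod f = dom u \<Longrightarrow> cod g = dom d' \<Longrightarrow>
      u \<cdot> f = d' \<cdot> g \<Longrightarrow> \<exists>h. \<guillemotleft>h : dom f \<rightarrow> dom d\<guillemotright> \<and> d \<cdot> h = f"
    and join: "\<And>h. arr h \<Longrightarrow> dom h = cod u \<Longrightarrow> null (h \<cdot> u) \<Longrightarrow> null (h \<cdot> d') \<Longrightarrow> null h"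
  shows "ses d (c \<cdot> u)"
proof (rule ses_if_kernel)
  note c' = sesD[OF c]
  show "epic (c \<cdot> u)"
  proof (rule epicI)
    fix g assume g: "arr g" "dom g = cod (c \<cdot> u)" "null (g \<cdot> (c \<cdot> u))"
    have "null (g \<cdot> c)"
    proof (rule join)
      show "null ((g \<cdot> c) \<cdot> u)" using g c' u by simp
      show "null ((g \<cdot> c) \<cdot> d')" using g c' u by simp
    qed (use g c' u in auto)
    then show "null g" using g c' u by - (rule epic_null[OF c'(4)], auto)
  qed (use c' u in auto)
  show "kernel d (c \<cdot> u)"
  proof (rule kernelI)
    fix f assume f: "arr f" "cod f = dom (c \<cdot> u)" "null ((c \<cdot> u) \<cdot> f)"
    then have "null (c \<cdot> (u \<cdot> f))" using c' u by simp
    then obtain g where "\<guillemotleft>g : dom f \<rightarrow> dom d'\<guillemotright>" "d' \<cdot> g = u \<cdot> f"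
      using kernelE[OF c'(1), of "u \<cdot> f"] f c' u by auto
    then show "\<exists>h. \<guillemotleft>h : dom f \<rightarrow> dom d\<guillemotright> \<and> d \<cdot> h = f"
      using meet[of f g] f c' u by (auto simp: arrow_iff)
  qed (use c' u d cud in auto)
qed

end

context preadditive_category
begin

lemma zero_object_null:
  assumes "is_zero_object C Z" "arr f" "dom f = Z \<or> cod f = Z"
  shows "null f"
proof -
  have "\<exists>!g. g \<in> Hom C (dom f) (cod f)"
    using assms(3) assms(1) dom_Obj[OF assms(2)] cod_Obj[OF assms(2)]
    unfolding is_zero_object_def by blast
  moreover have "f \<in> Hom C (dom f) (cod f)" "Zero C (dom f) (cod f) \<in> Hom C (dom f) (cod f)"
    using assms(2) by (simp_all add: in_Hom_iff)
  ultimately have "f = Zero C (dom f) (cod f)" by blast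
  then show ?thesis by (simp add: null_def)
qed

end

text \<open>Zero objects are isomorphic, and closure under extensions implies closure under isomorphism:
  a zero object is an extension of any zero object by itself.\<close>

lemma (in exact_category) zero_object_in_A:
  assumes "is_zero_object C Y"
  shows "Y \<in> A"
proof -
  obtain Z where Z: "Z \<in> A" "is_zero_object C Z" using A_zero_object by blast
  then have O: "Z \<in> Obj C" "Y \<in> Obj C" using assms by (auto simp: is_zero_object_def)
  note null = zero_object_null[OF assms] zero_object_null[OF Z(2)]
  let ?f = "Zero C Z Y" and ?g = "Zero C Y Z"
  have f: "monic ?f" using O by (intro monicI) (simp_all add: null)
  have g: "epic ?g" using O by (intro epicI) (simp_all add: null)
  have "kernel ?f ?g"
  proof (rule kernelI)
    fix h assume h: "arr h" "cod h = dom ?g" "null (?g \<cdot> h)"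
    have "?f \<cdot> Zero C (dom h) Z = h"
      using h O by - (rule null_eqI, simp_all add: null)
    then show "\<exists>u. \<guillemotleft>u : dom h \<rightarrow> dom ?f\<guillemotright> \<and> ?f \<cdot> u = h"
      using h O by (intro exI[of _ "Zero C (dom h) Z"]) (simp add: arrow_iff)
  qed (use f O in simp_all)
  then have "ses ?f ?g" using g by (simp add: ses_if_kernel)
  then have "short_exact C Z ?f Y ?g Z" using O by (simp add: short_exact_iff arrow_iff)
  then show ?thesis using A_extension Z by blast
qed

section \<open>Lower sets of a poset\<close>

definition lower_sets :: "'i set \<Rightarrow> 'i rel \<Rightarrow> 'i set set" where
  "lower_sets I r = {U. U \<subseteq> I \<and> (\<forall>x y. x \<in> U \<and> (y, x) \<in> r \<longrightarrow> y \<in> U)}"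

definition down :: "'i rel \<Rightarrow> 'i set \<Rightarrow> 'i set" where
  "down r J = {x. \<exists>y \<in> J. (x, y) \<in> r}"

text \<open>A presentation of \<open>J\<close> as a difference of the lower sets \<open>U\<close> and \<open>U - J\<close>. In a configuration
  \<open>\<sigma>(J)\<close> is then the quotient of \<open>\<sigma>(U)\<close> by \<open>\<sigma>(U - J)\<close>.\<close>

definition upper :: "'i set \<Rightarrow> 'i rel \<Rightarrow> 'i set \<Rightarrow> 'i set \<Rightarrow> bool" where
  "upper I r U J \<longleftrightarrow> U \<in> lower_sets I r \<and> J \<subseteq> U \<and> U - J \<in> lower_sets I r"

text \<open>The largest lower set of which \<open>J\<close> is an upper part; \<open>down r J\<close> is the smallest one.\<close>

definition widest :: "'i set \<Rightarrow> 'i rel \<Rightarrow> 'i set \<Rightarrow> 'i set" where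
  "widest I r J = {x \<in> I. x \<in> J \<or> (\<forall>y \<in> J. (y, x) \<notin> r)}"

lemma fsets_antimono: "r \<subseteq> r0 \<Longrightarrow> J \<in> fsets I r0 \<Longrightarrow> J \<in> fsets I r"
  unfolding fsets_def by blast

lemma lower_sets_antimono: "r \<subseteq> r0 \<Longrightarrow> U \<in> lower_sets I r0 \<Longrightarrow> U \<in> lower_sets I r"
  unfolding lower_sets_def by blast

lemma upper_antimono: "r \<subseteq> r0 \<Longrightarrow> upper I r0 U J \<Longrightarrow> upper I r U J"
  using lower_sets_antimono unfolding upper_def by metis

locale poset =
  fixes I :: "'i set" and r :: "'i rel"
  assumes partial_order: "partial_order_on I r"
begin

lemma r_refl: "x \<in> I \<Longrightarrow> (x, x) \<in> r"
  using partial_order by (auto simp: partial_order_on_def preorder_on_def refl_on_def)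

lemma r_field: "(x, y) \<in> r \<Longrightarrow> x \<in> I \<and> y \<in> I"
  using partial_order by (auto simp: partial_order_on_def preorder_on_def)

lemma r_trans: "(x, y) \<in> r \<Longrightarrow> (y, z) \<in> r \<Longrightarrow> (x, z) \<in> r"
  using partial_order by (auto simp: partial_order_on_def preorder_on_def dest: transD)

lemma r_antisym: "(x, y) \<in> r \<Longrightarrow> (y, x) \<in> r \<Longrightarrow> x = y"
  using partial_order by (auto simp: partial_order_on_def dest: antisymD)

lemma lower_closed: "U \<in> lower_sets I r \<Longrightarrow> x \<in> U \<Longrightarrow> (y, x) \<in> r \<Longrightarrow> y \<in> U"
  by (auto simp: lower_sets_def)

lemma lower_setsI: "U \<subseteq> I \<Longrightarrow> (\<And>x y. x \<in> U \<Longrightarrow> (y, x) \<in> r \<Longrightarrow> y \<in> U) \<Longrightarrow> U \<in> lower_sets I r"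
  by (auto simp: lower_sets_def)

lemma empty_lower [simp]: "{} \<in> lower_sets I r"
  by (auto simp: lower_sets_def)

lemma whole_lower [simp]: "I \<in> lower_sets I r"
  using r_field by (auto simp: lower_sets_def)

lemma Un_lower [simp]: "U \<in> lower_sets I r \<Longrightarrow> V \<in> lower_sets I r \<Longrightarrow> U \<union> V \<in> lower_sets I r"
  by (auto simp: lower_sets_def)

lemma Int_lower [simp]: "U \<in> lower_sets I r \<Longrightarrow> V \<in> lower_sets I r \<Longrightarrow> U \<inter> V \<in> lower_sets I r"
  by (auto simp: lower_sets_def)

lemma down_lower [simp]: "down r J \<in> lower_sets I r"
  using r_field r_trans by (fastforce simp: lower_sets_def down_def)

lemma subset_down: "J \<subseteq> I \<Longrightarrow> J \<subseteq> down r J"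
  using r_refl by (auto simp: down_def)

lemma down_subset: "U \<in> lower_sets I r \<Longrightarrow> J \<subseteq> U \<Longrightarrow> down r J \<subseteq> U"
  by (auto simp: lower_sets_def down_def)

lemma down_mono: "J \<subseteq> K \<Longrightarrow> down r J \<subseteq> down r K"
  by (auto simp: down_def)

lemma fsets_subset: "J \<in> fsets I r \<Longrightarrow> J \<subseteq> I"
  by (auto simp: fsets_def)

lemma lower_subset: "U \<in> lower_sets I r \<Longrightarrow> U \<subseteq> I"
  by (auto simp: lower_sets_def)

lemma lower_fsets [simp]: "U \<in> lower_sets I r \<Longrightarrow> U \<in> fsets I r"
  by (fastforce simp: lower_sets_def fsets_def)

lemma lower_gpairs: "U \<in> lower_sets I r \<Longrightarrow> V \<in> lower_sets I r \<Longrightarrow> U \<subseteq> V \<Longrightarrow> (U, V) \<in> gpairs I r"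
  using lower_fsets by (fastforce simp: lower_sets_def gpairs_def)

lemma singleton_fsets: "x \<in> I \<Longrightarrow> {x} \<in> fsets I r"
  using r_antisym by (auto simp: fsets_def)

lemma upperD:
  assumes "upper I r U J"
  shows "U \<in> lower_sets I r" "J \<subseteq> U" "U - J \<in> lower_sets I r"
  using assms by (auto simp: upper_def)

lemma upper_Diff: "U \<in> lower_sets I r \<Longrightarrow> V \<in> lower_sets I r \<Longrightarrow> upper I r U (U - V)"
  by (auto simp: upper_def Diff_Diff_Int)

lemma upper_fsets: "upper I r U J \<Longrightarrow> J \<in> fsets I r"
  unfolding upper_def fsets_def lower_sets_def by blast

lemma upper_hpairs: "upper I r U J \<Longrightarrow> (U, J) \<in> hpairs I r"
  using upper_fsets[of U J] lower_fsets[of U] unfolding upper_def hpairs_def lower_sets_def by blast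

lemma upper_down: "J \<in> fsets I r \<Longrightarrow> upper I r (down r J) J"
proof -
  assume J: "J \<in> fsets I r"
  have "down r J - J \<in> lower_sets I r"
    using J r_field r_trans unfolding lower_sets_def down_def fsets_def by blast
  then show ?thesis using subset_down[OF fsets_subset[OF J]] by (simp add: upper_def)
qed

lemma upper_widest: "J \<in> fsets I r \<Longrightarrow> upper I r (widest I r J) J"
  using r_field r_trans r_refl unfolding upper_def lower_sets_def widest_def fsets_def by blast

lemma upper_subset_widest: "upper I r U J \<Longrightarrow> U \<subseteq> widest I r J"
  unfolding upper_def lower_sets_def widest_def by blast

lemma upper_restrict: "upper I r V J \<Longrightarrow> U \<in> lower_sets I r \<Longrightarrow> U \<subseteq> V \<Longrightarrow> J \<subseteq> U \<Longrightarrow> upper I r U J"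
  unfolding upper_def lower_sets_def by blast

lemma gpairsD:
  assumes "(J, K) \<in> gpairs I r"
  shows "J \<in> fsets I r" "K \<in> fsets I r" "J \<subseteq> K"
    "\<And>j k. j \<in> J \<Longrightarrow> k \<in> K \<Longrightarrow> (k, j) \<in> r \<Longrightarrow> k \<in> J"
  using assms by (auto simp: gpairs_def)

lemma hpairsD:
  assumes "(J, K) \<in> hpairs I r"
  shows "J \<in> fsets I r" "K \<in> fsets I r" "K \<subseteq> J"
    "\<And>j k. j \<in> J \<Longrightarrow> k \<in> K \<Longrightarrow> (k, j) \<in> r \<Longrightarrow> j \<in> K"
  using assms by (auto simp: hpairs_def)

lemma down_gpairs:
  assumes "(J, K) \<in> gpairs I r"
  shows "down r J \<subseteq> down r K" "down r J \<inter> K = J"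
  using gpairsD[OF assms] subset_down[of J] fsets_subset[of J] down_mono[of J K]
  by (auto simp: down_def)

lemma upper_gpairs:
  assumes "(J, K) \<in> gpairs I r" "upper I r W K"
  shows "upper I r (W - (K - J)) J" "upper I r W (K - J)"
proof -
  note W = upperD[OF assms(2)] and G = gpairsD[OF assms(1)]
  have low: "W - (K - J) \<in> lower_sets I r"
  proof (rule lower_setsI)
    fix x y assume xy: "x \<in> W - (K - J)" "(y, x) \<in> r"
    then have "y \<in> W" using lower_closed[OF W(1)] by blast
    moreover have "y \<in> J" if "y \<in> K"
      using lower_closed[OF W(3), of x y] G(4)[of x y] that xy by blast
    ultimately show "y \<in> W - (K - J)" by blast
  qed (use lower_subset[OF W(1)] in blast)
  moreover have "W - (K - J) - J = W - K" using G(3) by blast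
  ultimately show "upper I r (W - (K - J)) J" "upper I r W (K - J)"
    using W G(3) by (auto simp: upper_def)
qed

lemma upper_hpairs_trans:
  assumes "(J, K) \<in> hpairs I r" "upper I r W J"
  shows "upper I r W K"
proof -
  note W = upperD[OF assms(2)] and H = hpairsD[OF assms(1)]
  have "W - K \<in> lower_sets I r"
  proof (rule lower_setsI)
    fix x y assume xy: "x \<in> W - K" "(y, x) \<in> r"
    then have "y \<in> W" using lower_closed[OF W(1)] by blast
    moreover have "y \<notin> K"
      using lower_closed[OF W(3), of x y] H(3) H(4)[of x y] xy by blast
    ultimately show "y \<in> W - K" by blast
  qed (use lower_subset[OF W(1)] in blast)
  then show ?thesis using W H(3) by (auto simp: upper_def)
qed

lemma gpairs_hpairs_Diff:
  assumes "(J, K) \<in> gpairs I r"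
  shows "(K, K - J) \<in> hpairs I r"
proof -
  note G = gpairsD[OF assms]
  have "K - J \<in> fsets I r"
    using upper_fsets[OF upper_gpairs(2)[OF assms upper_down[OF G(2)]]] .
  then show ?thesis using G unfolding hpairs_def by blast
qed

lemma gpairs_hpairs_Int:
  assumes "(J, K) \<in> gpairs I r" "(K, L) \<in> hpairs I r"
  shows "(J, J \<inter> L) \<in> hpairs I r" "(J \<inter> L, L) \<in> gpairs I r"
proof -
  note G = gpairsD[OF assms(1)] and H = hpairsD[OF assms(2)]
  have "J \<inter> L \<in> fsets I r"
    using G(1) H(2) unfolding fsets_def by blast
  then show "(J, J \<inter> L) \<in> hpairs I r" "(J \<inter> L, L) \<in> gpairs I r"
    using G H unfolding hpairs_def gpairs_def by blast+
qed

end

section \<open>Configurations from functors on lower sets\<close>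

text \<open>\<open>E\<close> and \<open>e\<close> are the values of a configuration on lower sets and their inclusions, and \<open>c U J\<close>
  presents \<open>T J\<close> as the quotient of \<open>E U\<close> by \<open>E (U - J)\<close>, compatibly for all \<open>U\<close> of which \<open>J\<close> is an upper
  part.\<close>

locale lower_system = exact_category C A + poset I r
  for C :: "('o, 'm) category_data" (structure) and A :: "'o set"
    and I :: "'i set" and r :: "'i rel" +
  fixes E :: "'i set \<Rightarrow> 'o" and e :: "'i set \<Rightarrow> 'i set \<Rightarrow> 'm"
    and T :: "'i set \<Rightarrow> 'o" and c :: "'i set \<Rightarrow> 'i set \<Rightarrow> 'm"
  assumes e_arrow: "\<lbrakk>U \<in> lower_sets I r; V \<in> lower_sets I r; U \<subseteq> V\<rbrakk> \<Longrightarrow> \<guillemotleft>e U V : E U \<rightarrow> E V\<guillemotright>"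
    and e_Id: "U \<in> lower_sets I r \<Longrightarrow> e U U = Id C (E U)"
    and e_Comp: "\<lbrakk>U \<in> lower_sets I r; V \<in> lower_sets I r; W \<in> lower_sets I r; U \<subseteq> V; V \<subseteq> W\<rbrakk>
      \<Longrightarrow> e V W \<cdot> e U V = e U W"
    and c_arrow: "upper I r U J \<Longrightarrow> \<guillemotleft>c U J : E U \<rightarrow> T J\<guillemotright>"
    and c_ses: "upper I r U J \<Longrightarrow> ses (e (U - J) U) (c U J)"
    and c_restrict: "\<lbrakk>upper I r U J; upper I r V J; U \<subseteq> V\<rbrakk> \<Longrightarrow> c V J \<cdot> e U V = c U J"
    and T_empty: "is_zero_object C (T {})"
    and T_singleton: "x \<in> I \<Longrightarrow> T {x} \<in> A"
    and finite_I: "finite I"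
begin

text \<open>The arrow induced on quotients by the inclusion of \<open>down r J\<close> into \<open>down r J \<union> down r K\<close>. If \<open>J\<close> is
  a lower part of \<open>K\<close> the union is \<open>down r K\<close>, and if \<open>K\<close> is an upper part of \<open>J\<close> it is \<open>down r J\<close>, so one
  formula serves for \<open>\<iota>\<close> and for \<open>\<pi>\<close>.\<close>

definition \<tau> :: "'i set \<Rightarrow> 'i set \<Rightarrow> 'm" where
  "\<tau> J K = (THE f. \<guillemotleft>f : T J \<rightarrow> T K\<guillemotright> \<and>
     f \<cdot> c (down r J) J = c (down r J \<union> down r K) K \<cdot> e (down r J) (down r J \<union> down r K))"

lemmas e_arr = e_arrow[unfolded arrow_iff]
lemmas c_arr = c_arrow[unfolded arrow_iff]

text \<open>The arrow \<open>\<tau> J K\<close> does not depend on the presentations of \<open>J\<close> and \<open>K\<close> used to compute it,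
  because each presentation of \<open>J\<close> contains the one by \<open>down r J\<close>. This single fact yields all the
  composition rules of a configuration: \<open>\<iota>\<close>, \<open>\<pi>\<close> and their composites are all of the form \<open>\<tau>\<close>.\<close>

lemma \<tau>_arrow_eq:
  assumes U: "upper I r U J" and W: "upper I r W K" and UW: "U \<subseteq> W" "U - J \<subseteq> W - K"
  shows "\<guillemotleft>\<tau> J K : T J \<rightarrow> T K\<guillemotright>" and "\<tau> J K \<cdot> c U J = c W K \<cdot> e U W"
proof -
  let ?dJ = "down r J" and ?d = "down r J \<union> down r K"
  note U' = upperD[OF U] and W' = upperD[OF W]
  note s = sesD[OF c_ses[OF U]] and sW = sesD[OF c_ses[OF W]]
  have J: "J \<in> fsets I r" and K: "K \<in> fsets I r" using U W by (simp_all add: upper_fsets)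
  have dJ: "upper I r ?dJ J" using upper_down[OF J] .
  have sub: "?dJ \<subseteq> U" "?d \<subseteq> W" "K \<subseteq> ?d"
    using down_subset[OF U'(1,2)] down_subset[OF W'(1,2)] subset_down[OF fsets_subset[OF K]] UW
    by auto
  have d: "upper I r ?d K" using upper_restrict[OF W _ sub(2,3)] by simp
  have "(c W K \<cdot> e U W) \<cdot> e (U - J) U = c W K \<cdot> e (U - J) W"
    using e_Comp[OF U'(3,1) W'(1)] e_arr[OF U'(3,1)] e_arr[OF U'(1) W'(1) UW(1)] c_arr[OF W] UW(1)
    by simp
  also have "\<dots> = (c W K \<cdot> e (W - K) W) \<cdot> e (U - J) (W - K)"
    using e_Comp[OF U'(3) W'(3,1) UW(2)] e_arr[OF U'(3) W'(3) UW(2)] e_arr[OF W'(3,1)] c_arr[OF W]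
    by simp
  finally have "null ((c W K \<cdot> e U W) \<cdot> e (U - J) U)"
    using sW(8) e_arr[OF U'(3) W'(3) UW(2)] e_arr[OF W'(3,1)] c_arr[OF W]
    by - (simp only:, rule null_Comp_left, simp_all)
  then obtain f where f: "\<guillemotleft>f : T J \<rightarrow> T K\<guillemotright>" "f \<cdot> c U J = c W K \<cdot> e U W"
    using cokernelE[OF s(2), of "c W K \<cdot> e U W"] e_arr[OF U'(3,1)] e_arr[OF U'(1) W'(1) UW(1)]
      c_arr[OF W] c_arr[OF U] by auto
  have f': "arr f" "dom f = T J" "cod f = T K" using f(1) by (simp_all add: arrow_iff)
  have "f \<cdot> c ?dJ J = (f \<cdot> c U J) \<cdot> e ?dJ U"
    using c_restrict[OF dJ U sub(1)] f' c_arr[OF U] e_arr[OF _ U'(1) sub(1)] by simp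
  also have "\<dots> = c W K \<cdot> e ?dJ W"
    using f(2) e_Comp[OF _ U'(1) W'(1) sub(1) UW(1)] c_arr[OF W] e_arr[OF U'(1) W'(1) UW(1)]
      e_arr[OF _ U'(1) sub(1)] by simp
  also have "\<dots> = (c W K \<cdot> e ?d W) \<cdot> e ?dJ ?d"
    using e_Comp[of ?dJ ?d W] c_arr[OF W] e_arr[of ?dJ ?d] e_arr[OF _ W'(1) sub(2)] sub W'(1) by simp
  also have "\<dots> = c ?d K \<cdot> e ?dJ ?d"
    using c_restrict[OF d W sub(2)] by simp
  finally have fc: "f \<cdot> c ?dJ J = c ?d K \<cdot> e ?dJ ?d" .
  have "\<tau> J K = f"
    unfolding \<tau>_def
  proof (rule the_equality)
    fix g assume g: "\<guillemotleft>g : T J \<rightarrow> T K\<guillemotright> \<and> g \<cdot> c ?dJ J = c ?d K \<cdot> e ?dJ ?d"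
    show "g = f"
      using g f' fc c_arr[OF dJ] sesD(4)[OF c_ses[OF dJ]]
      by - (rule epic_cancel[of "c ?dJ J"], simp_all add: arrow_iff)
  qed (use f(1) fc in simp)
  with f show "\<guillemotleft>\<tau> J K : T J \<rightarrow> T K\<guillemotright>" "\<tau> J K \<cdot> c U J = c W K \<cdot> e U W" by simp_all
qed

lemma \<tau>_eqI:
  assumes U: "upper I r U J" and W: "upper I r W K" and UW: "U \<subseteq> W" "U - J \<subseteq> W - K"
    and f: "\<guillemotleft>f : T J \<rightarrow> T K\<guillemotright>" "f \<cdot> c U J = c W K \<cdot> e U W"
  shows "\<tau> J K = f"
  using \<tau>_arrow_eq[OF U W UW] f sesD(4)[OF c_ses[OF U]] c_arr[OF U]
  by - (rule epic_cancel[of "c U J"], simp_all add: arrow_iff)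

lemma \<tau>_Id:
  assumes "J \<in> fsets I r"
  shows "\<tau> J J = Id C (T J)"
proof -
  note d = upper_down[OF assms]
  have "T J \<in> Obj C" using c_arr[OF d] cod_Obj[of "c (down r J) J"] by simp
  then show ?thesis
    using c_arr[OF d] upperD[OF d] by (intro \<tau>_eqI[OF d d]) (simp_all add: arrow_iff e_Id)
qed

lemma \<tau>_Comp:
  assumes U: "upper I r U J" and W: "upper I r W K" and Z: "upper I r Z L"
    and UW: "U \<subseteq> W" "U - J \<subseteq> W - K" and WZ: "W \<subseteq> Z" "W - K \<subseteq> Z - L"
  shows "\<tau> K L \<cdot> \<tau> J K = \<tau> J L"
proof -
  note a = \<tau>_arrow_eq[OF U W UW] and b = \<tau>_arrow_eq[OF W Z WZ]
  note ar = a(1)[unfolded arrow_iff] b(1)[unfolded arrow_iff] c_arr[OF U] c_arr[OF W] c_arr[OF Z]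
    e_arr[OF upperD(1)[OF U] upperD(1)[OF W] UW(1)] e_arr[OF upperD(1)[OF W] upperD(1)[OF Z] WZ(1)]
  have "(\<tau> K L \<cdot> \<tau> J K) \<cdot> c U J = \<tau> K L \<cdot> (c W K \<cdot> e U W)"
    using ar a(2) by simp
  also have "\<dots> = (\<tau> K L \<cdot> c W K) \<cdot> e U W"
    using ar by simp
  also have "\<dots> = c Z L \<cdot> (e W Z \<cdot> e U W)"
    using ar b(2) by simp
  also have "\<dots> = c Z L \<cdot> e U Z"
    using e_Comp[OF upperD(1)[OF U] upperD(1)[OF W] upperD(1)[OF Z] UW(1) WZ(1)] by simp
  finally show ?thesis
    using UW WZ ar by (intro \<tau>_eqI[OF U Z, symmetric]) (auto simp: arrow_iff)
qed

lemma gpairs_uppers: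
  assumes "(J, K) \<in> gpairs I r"
  shows "upper I r (down r J) J" "upper I r (down r K) K" "down r J \<subseteq> down r K"
    "down r J - J \<subseteq> down r K - K"
  using assms gpairsD[OF assms] down_gpairs[OF assms] by (auto simp: upper_down)

lemma hpairs_uppers:
  assumes "(J, K) \<in> hpairs I r"
  shows "upper I r (down r J) J" "upper I r (down r J) K" "down r J - J \<subseteq> down r J - K"
  using upper_hpairs_trans[OF assms upper_down] upper_down hpairsD[OF assms] by auto

text \<open>With \<open>W = down r K\<close> and \<open>U = W - (K - J)\<close>, this is the third isomorphism theorem for
  \<open>W - K \<subseteq> U \<subseteq> W\<close>, whose successive differences are \<open>J\<close> and \<open>K - J\<close>.\<close>

lemma ses_\<tau>:
  assumes JK: "(J, K) \<in> gpairs I r"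
  shows "\<guillemotleft>\<tau> J K : T J \<rightarrow> T K\<guillemotright>" "\<guillemotleft>\<tau> K (K - J) : T K \<rightarrow> T (K - J)\<guillemotright>"
    "ses (\<tau> J K) (\<tau> K (K - J))"
proof -
  let ?L = "K - J" and ?W = "down r K"
  let ?U = "?W - ?L"
  note W = gpairs_uppers(2)[OF JK]
  note U = upper_gpairs(1)[OF JK W] and L = upper_gpairs(2)[OF JK W]
  have JK': "J \<subseteq> K" "K \<subseteq> ?W" using JK upperD(2)[OF W] by (auto simp: gpairs_def)
  then have D: "?U - J = ?W - K" by auto
  have UW: "?U \<subseteq> ?W" "?U - J \<subseteq> ?W - K" "?W - K \<subseteq> ?W - ?L" using D by auto
  note l = upperD[OF W] upperD(1)[OF U]
  note t = \<tau>_arrow_eq[OF U W UW(1,2)] and p = \<tau>_arrow_eq[OF W L order.refl UW(3)]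
  show "\<guillemotleft>\<tau> J K : T J \<rightarrow> T K\<guillemotright>" "\<guillemotleft>\<tau> K ?L : T K \<rightarrow> T ?L\<guillemotright>" by (fact t p)+
  show "ses (\<tau> J K) (\<tau> K ?L)"
  proof (rule ses_of_quotients)
    show "ses (e (?W - K) ?U) (c ?U J)" using c_ses[OF U] D by simp
    show "ses (e ?U ?W \<cdot> e (?W - K) ?U) (c ?W K)"
      using c_ses[OF W] e_Comp[OF l(3,4,1)] UW by (simp add: D)
    show "ses (e ?U ?W) (c ?W ?L)" using c_ses[OF L] .
    show "cod (e (?W - K) ?U) = dom (e ?U ?W)"
      using e_arr[OF l(3,4)] e_arr[OF l(4,1)] UW by simp
    show "\<guillemotleft>\<tau> J K : cod (c ?U J) \<rightarrow> cod (c ?W K)\<guillemotright>" "\<guillemotleft>\<tau> K ?L : cod (c ?W K) \<rightarrow> cod (c ?W ?L)\<guillemotright>"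
      using t p c_arr[OF U] c_arr[OF W] c_arr[OF L] by simp_all
    show "\<tau> J K \<cdot> c ?U J = c ?W K \<cdot> e ?U ?W" using t(2) .
    show "\<tau> K ?L \<cdot> c ?W K = c ?W ?L"
      using p(2) e_Id[OF l(1)] c_arr[OF L] by simp
  qed
qed

text \<open>By the exact sequences above, \<open>T J\<close> is an iterated extension of the objects \<open>T {x}\<close> with \<open>x \<in> J\<close>.\<close>

lemma T_in_A:
  assumes "J \<in> fsets I r"
  shows "T J \<in> A"
proof -
  have "finite J" using assms finite_I fsets_subset finite_subset by metis
  then show ?thesis
    using assms
  proof (induction "card J" arbitrary: J)
    case 0
    then show ?case using zero_object_in_A[OF T_empty] by simp
  next
    case (Suc n)
    \<comment> \<open>Split off a minimal element of \<open>J\<close>.\<close>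
    have "\<exists>m\<in>J. \<forall>x\<in>J. (x, m) \<in> r \<longrightarrow> x = m"
    proof -
      have "J \<noteq> {}" using Suc.hyps(2) by auto
      moreover have "asymp_on J (\<lambda>x y. (x, y) \<in> r \<and> x \<noteq> y)"
        using r_antisym by (intro asymp_onI) blast
      moreover have "transp_on J (\<lambda>x y. (x, y) \<in> r \<and> x \<noteq> y)"
        using r_trans r_antisym by (intro transp_onI) blast
      ultimately show ?thesis
        using Finite_Set.bex_min_element[of J "\<lambda>x y. (x, y) \<in> r \<and> x \<noteq> y"] Suc.prems(1) by blast
    qed
    then obtain m where m: "m \<in> J" "\<And>x. x \<in> J \<Longrightarrow> (x, m) \<in> r \<Longrightarrow> x = m" by blast
    have "m \<in> I" using m Suc.prems fsets_subset by blast
    then have G: "({m}, J) \<in> gpairs I r"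
      using m Suc.prems singleton_fsets unfolding gpairs_def by auto
    have "T (J - {m}) \<in> A"
    proof (rule Suc.hyps(1))
      show "n = card (J - {m})" using Suc m by simp
      show "J - {m} \<in> fsets I r" using gpairs_hpairs_Diff[OF G] hpairsD by blast
    qed (use Suc in simp)
    moreover have "short_exact C (T {m}) (\<tau> {m} J) (T J) (\<tau> J (J - {m})) (T (J - {m}))"
      using ses_\<tau>[OF G] by (simp add: short_exact_iff)
    ultimately show ?case using A_extension T_singleton[OF \<open>m \<in> I\<close>] by blast
  qed
qed

text \<open>Both sides of the exchange rule between \<open>\<iota>\<close> and \<open>\<pi>\<close> are equal to \<open>\<tau> J L\<close>.\<close>

theorem is_configuration_\<tau>: "is_configuration C A I r \<lparr>\<sigma> = T, \<iota> = \<tau>, \<pi> = \<tau>\<rparr>"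
proof -
  have TO: "T J \<in> Obj C" if "J \<in> fsets I r" for J
    using T_in_A[OF that] A_subset by blast
  have "is_mono C (T J) (T K) (\<tau> J K)" if "(J, K) \<in> gpairs I r" for J K
    using ses_\<tau>[OF that] sesD(3)[OF ses_\<tau>(3)[OF that]] gpairsD[OF that] TO by (simp add: is_mono_iff)
  moreover have "is_epi C (T J) (T K) (\<tau> J K)" if JK: "(J, K) \<in> hpairs I r" for J K
  proof -
    note h = hpairs_uppers[OF JK] and HD = hpairsD[OF JK]
    note t = \<tau>_arrow_eq[OF h(1,2) order.refl h(3)]
    have "\<tau> J K \<cdot> c (down r J) J = c (down r J) K"
      using t(2) e_Id[OF upperD(1)[OF h(1)]] c_arr[OF h(2)] by simp
    moreover have "epic (c (down r J) K)" using sesD(4)[OF c_ses[OF h(2)]] .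
    ultimately have "epic (\<tau> J K)"
      using epic_of_Comp[of "\<tau> J K" "c (down r J) J"] t(1) c_arr[OF h(1)] by (simp add: arrow_iff)
    then show ?thesis using t(1) HD TO by (simp add: is_epi_iff)
  qed
  moreover have "short_exact C (T J) (\<tau> J K) (T K) (\<tau> K (K - J)) (T (K - J))"
    if "(J, K) \<in> gpairs I r" for J K
    using ses_\<tau>[OF that] by (simp add: short_exact_iff)
  moreover have "\<tau> J L = \<tau> K L \<cdot> \<tau> J K" if "(J, K) \<in> gpairs I r" "(K, L) \<in> gpairs I r" for J K L
    using \<tau>_Comp[OF gpairs_uppers(1,2)[OF that(1)] gpairs_uppers(2)[OF that(2)] gpairs_uppers(3,4)[OF that(1)]
        gpairs_uppers(3,4)[OF that(2)]] by simp
  moreover have "\<tau> J L = \<tau> K L \<cdot> \<tau> J K" if "(J, K) \<in> hpairs I r" "(K, L) \<in> hpairs I r" for J K L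
  proof -
    note h = hpairs_uppers[OF that(1)]
    have L: "down r J - K \<subseteq> down r J - L" using hpairsD[OF that(2)] by auto
    show ?thesis
      using \<tau>_Comp[OF h(1,2) upper_hpairs_trans[OF that(2) h(2)] order.refl h(3) order.refl L]
      by (rule sym)
  qed
  moreover have "\<tau> K L \<cdot> \<tau> J K = \<tau> (J \<inter> L) L \<cdot> \<tau> J (J \<inter> L)"
    if "(J, K) \<in> gpairs I r" "(K, L) \<in> hpairs I r" for J K L
  proof -
    note g = gpairs_uppers[OF that(1)] and h = hpairs_uppers[OF that(2)]
    note m = gpairs_hpairs_Int[OF that]
    note h' = hpairs_uppers[OF m(1)]
    have L: "L \<subseteq> K" using hpairsD[OF that(2)] by simp
    have "\<tau> K L \<cdot> \<tau> J K = \<tau> J L"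
      using \<tau>_Comp[OF g(1,2) h(2) g(3,4) order.refl h(3)] .
    moreover have "\<tau> (J \<inter> L) L \<cdot> \<tau> J (J \<inter> L) = \<tau> J L"
      using g(3) down_gpairs[OF that(1)] L
      by (intro \<tau>_Comp[OF g(1) h'(2) h(2) order.refl h'(3) g(3)]) auto
    ultimately show ?thesis by simp
  qed
  ultimately show ?thesis
    using T_in_A T_empty \<tau>_Id unfolding is_configuration_def by auto
qed

end

section \<open>The lower sets of a configuration\<close>

locale configuration = exact_category C A + poset I r
  for C :: "('o, 'm) category_data" (structure) and A :: "'o set"
    and I :: "'i set" and r :: "'i rel" +
  fixes S :: "('i, 'o, 'm) config_data"
  assumes config: "is_configuration C A I r S"
begin

lemma \<sigma>_in_A: "J \<in> fsets I r \<Longrightarrow> \<sigma> S J \<in> A"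
  using config by (simp add: is_configuration_def)

lemma \<sigma>_Obj [simp]: "J \<in> fsets I r \<Longrightarrow> \<sigma> S J \<in> Obj C"
  using \<sigma>_in_A A_subset by blast

lemma \<sigma>_empty: "is_zero_object C (\<sigma> S {})"
  using config by (simp add: is_configuration_def)

lemma \<iota>_monic:
  assumes "(J, K) \<in> gpairs I r"
  shows "\<guillemotleft>\<iota> S J K : \<sigma> S J \<rightarrow> \<sigma> S K\<guillemotright>" "monic (\<iota> S J K)"
proof -
  have "is_mono C (\<sigma> S J) (\<sigma> S K) (\<iota> S J K)"
    using config assms by (auto simp: is_configuration_def)
  then show "\<guillemotleft>\<iota> S J K : \<sigma> S J \<rightarrow> \<sigma> S K\<guillemotright>" "monic (\<iota> S J K)"
    using gpairsD[OF assms] by (simp_all add: is_mono_iff)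
qed

lemma \<pi>_epic:
  assumes "(J, K) \<in> hpairs I r"
  shows "\<guillemotleft>\<pi> S J K : \<sigma> S J \<rightarrow> \<sigma> S K\<guillemotright>" "epic (\<pi> S J K)"
proof -
  have "is_epi C (\<sigma> S J) (\<sigma> S K) (\<pi> S J K)"
    using config assms by (auto simp: is_configuration_def)
  then show "\<guillemotleft>\<pi> S J K : \<sigma> S J \<rightarrow> \<sigma> S K\<guillemotright>" "epic (\<pi> S J K)"
    using hpairsD[OF assms] by (simp_all add: is_epi_iff)
qed

lemmas \<iota>_arr = \<iota>_monic(1)[unfolded arrow_iff]
lemmas \<pi>_arr = \<pi>_epic(1)[unfolded arrow_iff]

lemma \<iota>_Id: "J \<in> fsets I r \<Longrightarrow> \<iota> S J J = Id C (\<sigma> S J)"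
  and \<pi>_Id: "J \<in> fsets I r \<Longrightarrow> \<pi> S J J = Id C (\<sigma> S J)"
  using config by (simp_all add: is_configuration_def)

lemma ses_\<iota>_\<pi>: "(J, K) \<in> gpairs I r \<Longrightarrow> ses (\<iota> S J K) (\<pi> S K (K - J))"
  using config by (auto simp: is_configuration_def short_exact_iff)

lemma \<iota>_Comp: "(J, K) \<in> gpairs I r \<Longrightarrow> (K, L) \<in> gpairs I r \<Longrightarrow> \<iota> S K L \<cdot> \<iota> S J K = \<iota> S J L"
  using config unfolding is_configuration_def by (elim conjE) (rule sym, blast)

lemma \<pi>_Comp: "(J, K) \<in> hpairs I r \<Longrightarrow> (K, L) \<in> hpairs I r \<Longrightarrow> \<pi> S K L \<cdot> \<pi> S J K = \<pi> S J L"
  using config unfolding is_configuration_def by (elim conjE) (rule sym, blast)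

lemma \<pi>_\<iota>:
  "(J, K) \<in> gpairs I r \<Longrightarrow> (K, L) \<in> hpairs I r \<Longrightarrow>
    \<pi> S K L \<cdot> \<iota> S J K = \<iota> S (J \<inter> L) L \<cdot> \<pi> S J (J \<inter> L)"
  using config unfolding is_configuration_def by (elim conjE) blast

lemma \<pi>_\<iota>_null:
  assumes "(J, K) \<in> gpairs I r" "(K, L) \<in> hpairs I r" "J \<inter> L = {}"
  shows "null (\<pi> S K L \<cdot> \<iota> S J K)"
proof -
  note m = gpairs_hpairs_Int[OF assms(1,2)]
  have "null (\<iota> S (J \<inter> L) L)"
    using zero_object_null[OF \<sigma>_empty] \<iota>_arr[OF m(2)] assms(3) by simp
  then show ?thesis
    using \<pi>_\<iota>[OF assms(1,2)] \<iota>_arr[OF m(2)] \<pi>_arr[OF m(1)] by simp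
qed

lemma upper_ses: "upper I r U J \<Longrightarrow> ses (\<iota> S (U - J) U) (\<pi> S U J)"
  using ses_\<iota>_\<pi>[OF lower_gpairs[of "U - J" U]] by (auto simp: upper_def double_diff)

lemma upper_\<pi>_\<iota>:
  assumes "upper I r U J" "upper I r V J" "U \<subseteq> V"
  shows "\<pi> S V J \<cdot> \<iota> S U V = \<pi> S U J"
proof -
  have "U \<inter> J = J" using upperD[OF assms(1)] by blast
  then show ?thesis
    using \<pi>_\<iota>[of U V J] lower_gpairs[of U V] upper_hpairs[OF assms(2)] assms(3) upperD(1)[OF assms(1)]
      upperD(1)[OF assms(2)] upper_fsets[OF assms(1)] \<iota>_Id[of J] \<pi>_arr[OF upper_hpairs[OF assms(1)]]
    by simp
qed

text \<open>\<open>\<sigma>\<close> is a lattice homomorphism from lower sets to subobjects: an element of \<open>\<sigma>(U)\<close> lies in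
  \<open>\<sigma>(V)\<close> if and only if it vanishes in \<open>\<sigma>(U - V)\<close>, which is a quotient both of \<open>\<sigma>(U)\<close> and,
  compatibly, of \<open>\<sigma>(U \<union> V)\<close>.\<close>

lemma lower_meet:
  assumes U: "U \<in> lower_sets I r" and V: "V \<in> lower_sets I r" and W: "W \<in> lower_sets I r"
    and sub: "U \<subseteq> W" "V \<subseteq> W"
    and f: "\<guillemotleft>f : X \<rightarrow> \<sigma> S U\<guillemotright>" and g: "\<guillemotleft>g : X \<rightarrow> \<sigma> S V\<guillemotright>" and fg: "\<iota> S U W \<cdot> f = \<iota> S V W \<cdot> g"
  shows "\<exists>h. \<guillemotleft>h : X \<rightarrow> \<sigma> S (U \<inter> V)\<guillemotright> \<and> \<iota> S (U \<inter> V) U \<cdot> h = f"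
proof -
  have cW: "upper I r W (W - V)" and cU: "upper I r U (U - V)" using upper_Diff U V W by blast+
  note gUW = lower_gpairs[OF U W sub(1)] and gVW = lower_gpairs[OF V W sub(2)]
  have eq: "U \<inter> (W - V) = U - V" "U - (U - V) = U \<inter> V" using sub by auto
  note m = gpairs_hpairs_Int[OF gUW upper_hpairs[OF cW], unfolded eq]
  have "\<iota> S (U - V) (W - V) \<cdot> (\<pi> S U (U - V) \<cdot> f) = (\<pi> S W (W - V) \<cdot> \<iota> S U W) \<cdot> f"
    using \<pi>_\<iota>[OF gUW upper_hpairs[OF cW]] eq \<iota>_arr[OF m(2)] \<pi>_arr[OF m(1)] f by (simp add: arrow_iff)
  also have "\<dots> = (\<pi> S W (W - V) \<cdot> \<iota> S V W) \<cdot> g"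
    using fg f g \<pi>_arr[OF upper_hpairs[OF cW]] \<iota>_arr[OF gUW] \<iota>_arr[OF gVW] by (simp add: arrow_iff)
  finally have eq': "\<iota> S (U - V) (W - V) \<cdot> (\<pi> S U (U - V) \<cdot> f) = (\<pi> S W (W - V) \<cdot> \<iota> S V W) \<cdot> g" .
  have "null ((\<pi> S W (W - V) \<cdot> \<iota> S V W) \<cdot> g)"
    using \<pi>_\<iota>_null[OF gVW upper_hpairs[OF cW]] \<pi>_arr[OF upper_hpairs[OF cW]] \<iota>_arr[OF gVW] g
    by - (rule null_Comp_left, auto simp: arrow_iff)
  then have "null (\<pi> S U (U - V) \<cdot> f)"
    unfolding eq'[symmetric]
    using \<iota>_arr[OF m(2)] \<pi>_arr[OF m(1)] f
    by - (rule monic_null[OF \<iota>_monic(2)[OF m(2)]], simp_all add: arrow_iff)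
  moreover have "kernel (\<iota> S (U \<inter> V) U) (\<pi> S U (U - V))"
    using sesD(1)[OF upper_ses[OF cU]] eq by simp
  moreover have "dom (\<iota> S (U \<inter> V) U) = \<sigma> S (U \<inter> V)"
    using \<iota>_arr[OF lower_gpairs[of "U \<inter> V" U]] U V by simp
  ultimately show ?thesis
    using f \<pi>_arr[OF m(1)] by - (rule kernelE[of "\<iota> S (U \<inter> V) U" "\<pi> S U (U - V)" f], auto simp: arrow_iff)
qed

text \<open>An arrow out of \<open>\<sigma>(U \<union> V)\<close> that kills \<open>\<sigma>(V)\<close> factors through \<open>\<sigma>(U - V)\<close>, onto which \<open>\<sigma>(U)\<close>
  already maps.\<close>

lemma lower_join:
  assumes U: "U \<in> lower_sets I r" and V: "V \<in> lower_sets I r"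
    and h: "arr h" "dom h = \<sigma> S (U \<union> V)"
    and null: "null (h \<cdot> \<iota> S U (U \<union> V))" "null (h \<cdot> \<iota> S V (U \<union> V))"
  shows "null h"
proof -
  let ?W = "U \<union> V" and ?L = "U - V"
  have W: "?W \<in> lower_sets I r" using U V by simp
  have "?W - V = ?L" by auto
  then have cW: "upper I r ?W ?L" and cU: "upper I r U ?L" using upper_Diff U V W by metis+
  have eq: "?W - ?L = V" by auto
  have "cokernel (\<pi> S ?W ?L) (\<iota> S V ?W)" using sesD(2)[OF upper_ses[OF cW]] eq by simp
  then obtain k where k: "\<guillemotleft>k : \<sigma> S ?L \<rightarrow> cod h\<guillemotright>" "k \<cdot> \<pi> S ?W ?L = h"
    using cokernelE[of "\<pi> S ?W ?L" "\<iota> S V ?W" h] h null \<iota>_arr[OF lower_gpairs[OF V W]]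
      \<pi>_arr[OF upper_hpairs[OF cW]] by auto
  have "k \<cdot> \<pi> S U ?L = (k \<cdot> \<pi> S ?W ?L) \<cdot> \<iota> S U ?W"
    using upper_\<pi>_\<iota>[OF cU cW] k(1) \<iota>_arr[OF lower_gpairs[OF U W]] \<pi>_arr[OF upper_hpairs[OF cW]]
    by (simp add: arrow_iff)
  then have "null (k \<cdot> \<pi> S U ?L)" using null(1) k(2) by simp
  then have "null k"
    using \<pi>_arr[OF upper_hpairs[OF cU]] k(1)
    by - (rule epic_null[OF \<pi>_epic(2)[OF upper_hpairs[OF cU]]], simp_all add: arrow_iff)
  then have "null (k \<cdot> \<pi> S ?W ?L)"
    using k(1) \<pi>_arr[OF upper_hpairs[OF cW]] by (simp add: arrow_iff)
  then show ?thesis using k(2) by simp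
qed

end

text \<open>A configuration is determined by its values on lower sets, because every \<open>\<sigma>(J)\<close> is the quotient
  of \<open>\<sigma>(widest J)\<close> by \<open>\<sigma>(widest J - J)\<close>. Using the widest presentation makes the comparison map on
  \<open>\<sigma>(J)\<close> compatible with all other presentations by restriction.\<close>

lemma (in exact_category) lower_comparison:
  assumes "configuration C A I r S1" and "configuration C A I r S2"
    and a: "\<And>U. U \<in> lower_sets I r \<Longrightarrow> \<guillemotleft>a U : \<sigma> S1 U \<rightarrow> \<sigma> S2 U\<guillemotright>"
    and a\<iota>: "\<And>U. U \<in> lower_sets I r \<Longrightarrow> \<iota> S2 U I \<cdot> a U = \<iota> S1 U I"
  obtains \<alpha> where "\<And>J. J \<in> fsets I r \<Longrightarrow> \<guillemotleft>\<alpha> J : \<sigma> S1 J \<rightarrow> \<sigma> S2 J\<guillemotright>"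
    and "\<And>U J. upper I r U J \<Longrightarrow> \<alpha> J \<cdot> \<pi> S1 U J = \<pi> S2 U J \<cdot> a U"
    and "\<And>J K. (J, K) \<in> gpairs I r \<Longrightarrow> \<alpha> K \<cdot> \<iota> S1 J K = \<iota> S2 J K \<cdot> \<alpha> J"
    and "\<And>J K. (J, K) \<in> hpairs I r \<Longrightarrow> \<alpha> K \<cdot> \<pi> S1 J K = \<pi> S2 J K \<cdot> \<alpha> J"
proof -
  interpret S1: configuration C A I r S1 by fact
  interpret S2: configuration C A I r S2 by fact
  note aa = a[unfolded arrow_iff]
  have nat: "a V \<cdot> \<iota> S1 U V = \<iota> S2 U V \<cdot> a U"
    if UV: "U \<in> lower_sets I r" "V \<in> lower_sets I r" "U \<subseteq> V" for U V
  proof (rule monic_cancel)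
    have VI: "V \<subseteq> I" using S1.lower_subset UV by blast
    note g = S1.lower_gpairs[OF UV] S1.lower_gpairs[OF UV(2) S1.whole_lower VI]
    note ar = S1.\<iota>_arr[OF g(1)] S1.\<iota>_arr[OF g(2)] S2.\<iota>_arr[OF g(1)] S2.\<iota>_arr[OF g(2)]
      aa[OF UV(1)] aa[OF UV(2)]
    show "monic (\<iota> S2 V I)" using S2.\<iota>_monic(2)[OF g(2)] .
    have "\<iota> S2 V I \<cdot> (a V \<cdot> \<iota> S1 U V) = (\<iota> S2 V I \<cdot> a V) \<cdot> \<iota> S1 U V"
      using ar by simp
    also have "\<dots> = \<iota> S1 U I"
      unfolding a\<iota>[OF UV(2)] using S1.\<iota>_Comp[OF g] .
    also have "\<dots> = (\<iota> S2 V I \<cdot> \<iota> S2 U V) \<cdot> a U"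
      unfolding S2.\<iota>_Comp[OF g] using a\<iota>[OF UV(1)] by simp
    also have "\<dots> = \<iota> S2 V I \<cdot> (\<iota> S2 U V \<cdot> a U)"
      using ar by simp
    finally show "\<iota> S2 V I \<cdot> (a V \<cdot> \<iota> S1 U V) = \<iota> S2 V I \<cdot> (\<iota> S2 U V \<cdot> a U)" .
  qed (use aa UV S1.\<iota>_arr[OF S1.lower_gpairs[OF UV]] S2.\<iota>_arr[OF S1.lower_gpairs[OF UV]]
      S2.\<iota>_arr[OF S1.lower_gpairs[OF UV(2) S1.whole_lower]] S1.lower_subset in auto)
  let ?W = "widest I r"
  have "\<exists>f. \<guillemotleft>f : \<sigma> S1 J \<rightarrow> \<sigma> S2 J\<guillemotright> \<and> f \<cdot> \<pi> S1 (?W J) J = \<pi> S2 (?W J) J \<cdot> a (?W J)"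
    if J: "J \<in> fsets I r" for J
  proof -
    note W = S1.upper_widest[OF J]
    note w = S1.upperD[OF W]
    note g = S1.lower_gpairs[OF w(3,1) Diff_subset]
    note ar = S1.\<iota>_arr[OF g] S2.\<iota>_arr[OF g] S1.\<pi>_arr[OF S1.upper_hpairs[OF W]]
      S2.\<pi>_arr[OF S1.upper_hpairs[OF W]] aa[OF w(1)] aa[OF w(3)]
    have "(\<pi> S2 (?W J) J \<cdot> a (?W J)) \<cdot> \<iota> S1 (?W J - J) (?W J) =
      (\<pi> S2 (?W J) J \<cdot> \<iota> S2 (?W J - J) (?W J)) \<cdot> a (?W J - J)"
      using nat[OF w(3,1) Diff_subset] ar by simp
    moreover have "null ((\<pi> S2 (?W J) J \<cdot> \<iota> S2 (?W J - J) (?W J)) \<cdot> a (?W J - J))"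
      using sesD(8)[OF S2.upper_ses[OF W]] ar by - (rule null_Comp_left, simp_all)
    ultimately have "null ((\<pi> S2 (?W J) J \<cdot> a (?W J)) \<cdot> \<iota> S1 (?W J - J) (?W J))" by simp
    then show ?thesis
      using cokernelE[OF sesD(2)[OF S1.upper_ses[OF W]], of "\<pi> S2 (?W J) J \<cdot> a (?W J)"] ar
      by auto
  qed
  then obtain \<alpha> where \<alpha>: "\<And>J. J \<in> fsets I r \<Longrightarrow> \<guillemotleft>\<alpha> J : \<sigma> S1 J \<rightarrow> \<sigma> S2 J\<guillemotright>"
    and \<alpha>W: "\<And>J. J \<in> fsets I r \<Longrightarrow> \<alpha> J \<cdot> \<pi> S1 (?W J) J = \<pi> S2 (?W J) J \<cdot> a (?W J)"
    by metis
  note \<alpha>a = \<alpha>[unfolded arrow_iff]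
  have \<alpha>\<pi>: "\<alpha> J \<cdot> \<pi> S1 U J = \<pi> S2 U J \<cdot> a U" if U: "upper I r U J" for U J
  proof -
    have J: "J \<in> fsets I r" using S1.upper_fsets[OF U] .
    note W = S1.upper_widest[OF J] and sub = S1.upper_subset_widest[OF U]
    note u = S1.upperD(1)[OF U] S1.upperD(1)[OF W]
    note g = S1.lower_gpairs[OF u sub]
    note ar = S1.\<iota>_arr[OF g] S2.\<iota>_arr[OF g] S1.\<pi>_arr[OF S1.upper_hpairs[OF W]]
      S2.\<pi>_arr[OF S1.upper_hpairs[OF W]] aa[OF u(1)] aa[OF u(2)] \<alpha>a[OF J]
    have "\<alpha> J \<cdot> \<pi> S1 U J = (\<alpha> J \<cdot> \<pi> S1 (?W J) J) \<cdot> \<iota> S1 U (?W J)"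
      unfolding S1.upper_\<pi>_\<iota>[OF U W sub, symmetric] using ar by simp
    also have "\<dots> = \<pi> S2 (?W J) J \<cdot> (a (?W J) \<cdot> \<iota> S1 U (?W J))"
      unfolding \<alpha>W[OF J] using ar by simp
    also have "\<dots> = (\<pi> S2 (?W J) J \<cdot> \<iota> S2 U (?W J)) \<cdot> a U"
      unfolding nat[OF u sub] using ar by simp
    also have "\<dots> = \<pi> S2 U J \<cdot> a U"
      unfolding S2.upper_\<pi>_\<iota>[OF U W sub] ..
    finally show ?thesis .
  qed
  show ?thesis
  proof (rule that[OF \<alpha> \<alpha>\<pi>])
    fix J K assume JK: "(J, K) \<in> gpairs I r"
    note G = S1.gpairsD[OF JK]
    note U = S1.upper_down[OF G(1)] and W = S1.upper_down[OF G(2)]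
    note sub = S1.down_gpairs[OF JK]
    note u = S1.upperD(1)[OF U] S1.upperD(1)[OF W]
    note g = S1.lower_gpairs[OF u sub(1)] and h = S1.upper_hpairs[OF W]
    note ar = S1.\<iota>_arr[OF g] S2.\<iota>_arr[OF g] S1.\<pi>_arr[OF h] S2.\<pi>_arr[OF h] aa[OF u(1)] aa[OF u(2)]
      \<alpha>a[OF G(1)] \<alpha>a[OF G(2)] S1.\<iota>_arr[OF JK] S2.\<iota>_arr[OF JK] S1.\<pi>_arr[OF S1.upper_hpairs[OF U]]
      S2.\<pi>_arr[OF S1.upper_hpairs[OF U]]
    note D1 = S1.\<pi>_\<iota>[OF g h, unfolded sub(2)] and D2 = S2.\<pi>_\<iota>[OF g h, unfolded sub(2)]
    show "\<alpha> K \<cdot> \<iota> S1 J K = \<iota> S2 J K \<cdot> \<alpha> J"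
    proof (rule epic_cancel)
      show "epic (\<pi> S1 (down r J) J)" using S1.\<pi>_epic(2)[OF S1.upper_hpairs[OF U]] .
      have "(\<alpha> K \<cdot> \<iota> S1 J K) \<cdot> \<pi> S1 (down r J) J =
        (\<alpha> K \<cdot> \<pi> S1 (down r K) K) \<cdot> \<iota> S1 (down r J) (down r K)"
        using ar D1 by simp
      also have "\<dots> = \<pi> S2 (down r K) K \<cdot> (a (down r K) \<cdot> \<iota> S1 (down r J) (down r K))"
        unfolding \<alpha>\<pi>[OF W] using ar by simp
      also have "\<dots> = (\<pi> S2 (down r K) K \<cdot> \<iota> S2 (down r J) (down r K)) \<cdot> a (down r J)"
        unfolding nat[OF u sub(1)] using ar by simp
      also have "\<dots> = \<iota> S2 J K \<cdot> (\<pi> S2 (down r J) J \<cdot> a (down r J))"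
        unfolding D2 using ar by simp
      also have "\<dots> = (\<iota> S2 J K \<cdot> \<alpha> J) \<cdot> \<pi> S1 (down r J) J"
        unfolding \<alpha>\<pi>[OF U, symmetric] using ar by simp
      finally show "(\<alpha> K \<cdot> \<iota> S1 J K) \<cdot> \<pi> S1 (down r J) J =
        (\<iota> S2 J K \<cdot> \<alpha> J) \<cdot> \<pi> S1 (down r J) J" .
    qed (use ar in simp_all)
  next
    fix J K assume JK: "(J, K) \<in> hpairs I r"
    note H = S1.hpairsD[OF JK]
    note U = S1.upper_down[OF H(1)]
    note V = S1.upper_hpairs_trans[OF JK U]
    note h = S1.upper_hpairs[OF U]
    note ar = S1.\<pi>_arr[OF h] S2.\<pi>_arr[OF h] S1.\<pi>_arr[OF JK] S2.\<pi>_arr[OF JK]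
      \<alpha>a[OF H(1)] \<alpha>a[OF H(2)] aa[OF S1.upperD(1)[OF U]]
    show "\<alpha> K \<cdot> \<pi> S1 J K = \<pi> S2 J K \<cdot> \<alpha> J"
    proof (rule epic_cancel)
      show "epic (\<pi> S1 (down r J) J)" using S1.\<pi>_epic(2)[OF h] .
      have "(\<alpha> K \<cdot> \<pi> S1 J K) \<cdot> \<pi> S1 (down r J) J = \<alpha> K \<cdot> \<pi> S1 (down r J) K"
        using ar S1.\<pi>_Comp[OF h JK] by simp
      also have "\<dots> = (\<pi> S2 J K \<cdot> \<pi> S2 (down r J) J) \<cdot> a (down r J)"
        unfolding S2.\<pi>_Comp[OF h JK] using \<alpha>\<pi>[OF V] .
      also have "\<dots> = \<pi> S2 J K \<cdot> (\<alpha> J \<cdot> \<pi> S1 (down r J) J)"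
        unfolding \<alpha>\<pi>[OF U] using ar by simp
      also have "\<dots> = (\<pi> S2 J K \<cdot> \<alpha> J) \<cdot> \<pi> S1 (down r J) J"
        using ar by simp
      finally show "(\<alpha> K \<cdot> \<pi> S1 J K) \<cdot> \<pi> S1 (down r J) J =
        (\<pi> S2 J K \<cdot> \<alpha> J) \<cdot> \<pi> S1 (down r J) J" .
    qed (use ar in simp_all)
  qed
qed

text \<open>Applied to \<open>a\<close> and to its inverse, the comparison gives an isomorphism of configurations.\<close>

lemma (in exact_category) config_iso_of_lower_isos:
  assumes S1: "configuration C A I r S1" and S2: "configuration C A I r S2"
    and a: "\<And>U. U \<in> lower_sets I r \<Longrightarrow> is_iso C (\<sigma> S1 U) (\<sigma> S2 U) (a U)"
    and a\<iota>: "\<And>U. U \<in> lower_sets I r \<Longrightarrow> \<iota> S2 U I \<cdot> a U = \<iota> S1 U I"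
  obtains \<alpha> where "is_config_iso C I r S1 S2 \<alpha>"
    and "\<And>U J. upper I r U J \<Longrightarrow> \<alpha> J \<cdot> \<pi> S1 U J = \<pi> S2 U J \<cdot> a U"
proof -
  interpret S1: configuration C A I r S1 by fact
  interpret S2: configuration C A I r S2 by fact
  have "\<exists>b. \<guillemotleft>b : \<sigma> S2 U \<rightarrow> \<sigma> S1 U\<guillemotright> \<and> b \<cdot> a U = Id C (\<sigma> S1 U) \<and> a U \<cdot> b = Id C (\<sigma> S2 U)"
    if U: "U \<in> lower_sets I r" for U
    using a[OF U] S1.\<sigma>_Obj[of U] S2.\<sigma>_Obj[of U] S1.lower_fsets[OF U]
    unfolding is_iso_def arrow_def by blast
  then obtain b where b: "\<And>U. U \<in> lower_sets I r \<Longrightarrow> \<guillemotleft>b U : \<sigma> S2 U \<rightarrow> \<sigma> S1 U\<guillemotright>"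
    and ba: "\<And>U. U \<in> lower_sets I r \<Longrightarrow> b U \<cdot> a U = Id C (\<sigma> S1 U)"
    and ab: "\<And>U. U \<in> lower_sets I r \<Longrightarrow> a U \<cdot> b U = Id C (\<sigma> S2 U)" by metis
  have a': "\<guillemotleft>a U : \<sigma> S1 U \<rightarrow> \<sigma> S2 U\<guillemotright>" if U: "U \<in> lower_sets I r" for U
    using a[OF U] S1.\<sigma>_Obj[of U] S2.\<sigma>_Obj[of U] S1.lower_fsets[OF U]
    unfolding is_iso_def arrow_def by blast
  have b\<iota>: "\<iota> S1 U I \<cdot> b U = \<iota> S2 U I" if U: "U \<in> lower_sets I r" for U
    unfolding a\<iota>[OF U, symmetric]
    using a'[OF U] b[OF U] ab[OF U] S2.\<iota>_arr[OF S1.lower_gpairs[OF U S1.whole_lower S1.lower_subset[OF U]]]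
    by (simp add: arrow_iff)
  obtain \<alpha> where \<alpha>: "\<And>J. J \<in> fsets I r \<Longrightarrow> \<guillemotleft>\<alpha> J : \<sigma> S1 J \<rightarrow> \<sigma> S2 J\<guillemotright>"
    "\<And>U J. upper I r U J \<Longrightarrow> \<alpha> J \<cdot> \<pi> S1 U J = \<pi> S2 U J \<cdot> a U"
    "\<And>J K. (J, K) \<in> gpairs I r \<Longrightarrow> \<alpha> K \<cdot> \<iota> S1 J K = \<iota> S2 J K \<cdot> \<alpha> J"
    "\<And>J K. (J, K) \<in> hpairs I r \<Longrightarrow> \<alpha> K \<cdot> \<pi> S1 J K = \<pi> S2 J K \<cdot> \<alpha> J"
    by (rule lower_comparison[OF S1 S2 a' a\<iota>], assumption, assumption, rule that)
  obtain \<beta> where \<beta>: "\<And>J. J \<in> fsets I r \<Longrightarrow> \<guillemotleft>\<beta> J : \<sigma> S2 J \<rightarrow> \<sigma> S1 J\<guillemotright>"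
    "\<And>U J. upper I r U J \<Longrightarrow> \<beta> J \<cdot> \<pi> S2 U J = \<pi> S1 U J \<cdot> b U"
    by (rule lower_comparison[OF S2 S1 b b\<iota>], assumption, assumption, rule that)
  have "is_iso C (\<sigma> S1 J) (\<sigma> S2 J) (\<alpha> J)" if J: "J \<in> fsets I r" for J
  proof (rule is_isoI[OF \<alpha>(1)[OF J] \<beta>(1)[OF J]])
    let ?U = "down r J"
    note U = S1.upper_down[OF J]
    note u = S1.upperD(1)[OF U] and h = S1.upper_hpairs[OF U]
    note ar = \<alpha>(1)[OF J] \<beta>(1)[OF J] a'[OF u] b[OF u] S1.\<pi>_epic(1)[OF h] S2.\<pi>_epic(1)[OF h]
    note ar = ar[unfolded arrow_iff]
    have "(\<beta> J \<cdot> \<alpha> J) \<cdot> \<pi> S1 ?U J = (\<beta> J \<cdot> \<pi> S2 ?U J) \<cdot> a ?U"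
      using \<alpha>(2)[OF U] ar by simp
    also have "\<dots> = \<pi> S1 ?U J"
      unfolding \<beta>(2)[OF U] using ba[OF u] ar by simp
    finally have *: "(\<beta> J \<cdot> \<alpha> J) \<cdot> \<pi> S1 ?U J = Id C (\<sigma> S1 J) \<cdot> \<pi> S1 ?U J"
      using ar by simp
    show "\<beta> J \<cdot> \<alpha> J = Id C (\<sigma> S1 J)"
      using ar J by - (rule epic_cancel[OF S1.\<pi>_epic(2)[OF h] *], simp_all)
    have "(\<alpha> J \<cdot> \<beta> J) \<cdot> \<pi> S2 ?U J = (\<alpha> J \<cdot> \<pi> S1 ?U J) \<cdot> b ?U"
      using \<beta>(2)[OF U] ar by simp
    also have "\<dots> = \<pi> S2 ?U J"
      unfolding \<alpha>(2)[OF U] using ab[OF u] ar by simp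
    finally have *: "(\<alpha> J \<cdot> \<beta> J) \<cdot> \<pi> S2 ?U J = Id C (\<sigma> S2 J) \<cdot> \<pi> S2 ?U J"
      using ar by simp
    show "\<alpha> J \<cdot> \<beta> J = Id C (\<sigma> S2 J)"
      using ar J by - (rule epic_cancel[OF S2.\<pi>_epic(2)[OF h] *], simp_all)
  qed
  then have "is_config_iso C I r S1 S2 \<alpha>"
    unfolding is_config_iso_def using \<alpha>(3,4) by auto
  then show ?thesis using that \<alpha>(2) by blast
qed

section \<open>Quotients of a lattice homomorphism on lower sets\<close>

text \<open>The assumptions \<open>meet\<close> and \<open>join\<close> say that \<open>E\<close> turns intersections and unions of lower sets
  into meets and joins of subobjects. They are what makes \<open>E(U) / E(U - J)\<close> depend on \<open>J\<close> only.\<close>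

locale lower_functor = abelian_category C + poset I r
  for C :: "('o, 'm) category_data" (structure) and I :: "'i set" and r :: "'i rel" +
  fixes E :: "'i set \<Rightarrow> 'o" and e :: "'i set \<Rightarrow> 'i set \<Rightarrow> 'm"
  assumes e_arrow: "\<lbrakk>U \<in> lower_sets I r; V \<in> lower_sets I r; U \<subseteq> V\<rbrakk> \<Longrightarrow> \<guillemotleft>e U V : E U \<rightarrow> E V\<guillemotright>"
    and e_monic: "\<lbrakk>U \<in> lower_sets I r; V \<in> lower_sets I r; U \<subseteq> V\<rbrakk> \<Longrightarrow> monic (e U V)"
    and e_Id: "U \<in> lower_sets I r \<Longrightarrow> e U U = Id C (E U)"
    and e_Comp: "\<lbrakk>U \<in> lower_sets I r; V \<in> lower_sets I r; W \<in> lower_sets I r; U \<subseteq> V; V \<subseteq> W\<rbrakk>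
      \<Longrightarrow> e V W \<cdot> e U V = e U W"
    and meet: "\<lbrakk>U \<in> lower_sets I r; V \<in> lower_sets I r; W \<in> lower_sets I r; U \<subseteq> W; V \<subseteq> W;
        \<guillemotleft>f : X \<rightarrow> E U\<guillemotright>; \<guillemotleft>g : X \<rightarrow> E V\<guillemotright>; e U W \<cdot> f = e V W \<cdot> g\<rbrakk>
      \<Longrightarrow> \<exists>h. \<guillemotleft>h : X \<rightarrow> E (U \<inter> V)\<guillemotright> \<and> e (U \<inter> V) U \<cdot> h = f"
    and join: "\<lbrakk>U \<in> lower_sets I r; V \<in> lower_sets I r; arr h; dom h = E (U \<union> V);
        null (h \<cdot> e U (U \<union> V)); null (h \<cdot> e V (U \<union> V))\<rbrakk> \<Longrightarrow> null h"
begin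

lemmas e_arr = e_arrow[unfolded arrow_iff]

text \<open>The second isomorphism theorem for \<open>U \<inter> (V - J) = U - J\<close> and \<open>U \<union> (V - J) = V\<close>.\<close>

lemma ses_restrict:
  assumes V: "upper I r V J" and U: "U \<in> lower_sets I r" "U \<subseteq> V" "J \<subseteq> U"
    and c: "ses (e (V - J) V) c"
  shows "ses (e (U - J) U) (c \<cdot> e U V)"
proof -
  note v = upperD[OF V]
  note u = upperD[OF upper_restrict[OF V U]]
  have eq: "U \<inter> (V - J) = U - J" "U \<union> (V - J) = V" using U v by auto
  have sub: "U - J \<subseteq> V - J" using U(2) by auto
  note ar = e_arr[OF U(1) v(1) U(2)] e_arr[OF v(3,1) Diff_subset] e_arr[OF u(3,1) Diff_subset]
    e_arr[OF u(3) v(3) sub]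
  note s = sesD[OF c]
  show ?thesis
  proof (rule ses_of_meet_and_join[OF c])
    show "monic (e U V)" "monic (e (U - J) U)"
      using e_monic U(1,2) v(1) u(3) by auto
    have "c \<cdot> (e U V \<cdot> e (U - J) U) = (c \<cdot> e (V - J) V) \<cdot> e (U - J) (V - J)"
      using e_Comp[OF u(3,1) v(1) Diff_subset U(2)] e_Comp[OF u(3) v(3,1) sub Diff_subset] ar s
      by simp
    moreover have "null ((c \<cdot> e (V - J) V) \<cdot> e (U - J) (V - J))"
      using ar s by - (rule null_Comp_left, simp_all)
    ultimately show "null (c \<cdot> (e U V \<cdot> e (U - J) U))" by simp
  next
    fix f g
    assume "arr f" "arr g" "dom f = dom g" "cod f = dom (e U V)" "cod g = dom (e (V - J) V)"
      "e U V \<cdot> f = e (V - J) V \<cdot> g"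
    then show "\<exists>h. \<guillemotleft>h : dom f \<rightarrow> dom (e (U - J) U)\<guillemotright> \<and> e (U - J) U \<cdot> h = f"
      using meet[OF U(1) v(3,1) U(2) Diff_subset, of f "dom f" g] ar unfolding eq
      by (simp add: arrow_iff)
  next
    fix h
    assume "arr h" "dom h = cod (e U V)" "null (h \<cdot> e U V)" "null (h \<cdot> e (V - J) V)"
    then show "null h" using join[OF U(1) v(3), of h] ar unfolding eq by simp
  qed (use ar in simp_all)
qed

end

lemma (in preadditive_category) cokernel_Comp_iso:
  assumes q: "cokernel q f" and u: "is_iso C (cod q) Y u" and Y: "Y \<in> Obj C"
  shows "cokernel (u \<cdot> q) f"
proof -
  note Q = cokernelD[OF q]
  obtain v where v: "\<guillemotleft>u : cod q \<rightarrow> Y\<guillemotright>" "\<guillemotleft>v : Y \<rightarrow> cod q\<guillemotright>" "v \<cdot> u = Id C (cod q)" "u \<cdot> v = Id C Y"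
    using u Y Q unfolding is_iso_def arrow_def by auto
  note v' = v(1,2)[unfolded arrow_iff]
  have "epic u"
    using epic_of_Comp[of u v] v v' Y by simp
  then have "epic (u \<cdot> q)" using epic_Comp[OF Q(1)] v' by simp
  then show ?thesis
  proof (rule cokernelI)
    fix h assume h: "arr h" "dom h = cod f" "null (h \<cdot> f)"
    obtain w where w: "\<guillemotleft>w : cod q \<rightarrow> cod h\<guillemotright>" "w \<cdot> q = h" using cokernelE[OF q h] by auto
    have "(w \<cdot> v) \<cdot> (u \<cdot> q) = w \<cdot> ((v \<cdot> u) \<cdot> q)"
      using w(1) v' Q by (simp add: arrow_iff)
    then have "(w \<cdot> v) \<cdot> (u \<cdot> q) = h" using v(3) w(2) Q by simp
    moreover have "\<guillemotleft>w \<cdot> v : cod (u \<cdot> q) \<rightarrow> cod h\<guillemotright>" using w(1) v' Q by (simp add: arrow_iff)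
    ultimately show "\<exists>w. \<guillemotleft>w : cod (u \<cdot> q) \<rightarrow> cod h\<guillemotright> \<and> w \<cdot> (u \<cdot> q) = h" by blast
  qed (use Q v' in simp_all)
qed

text \<open>Quotients may be chosen freely up to isomorphism. If \<open>E\<close> extends the lower sets of a configuration
  for a dominating order \<open>r0\<close>, then for the f-sets \<open>J\<close> of \<open>r0\<close> the quotient is chosen to be \<open>\<sigma>(J)\<close>, with
  the given projections. The choice is made on the widest presentation of \<open>J\<close> and restricted to the
  others, which makes all the projections onto \<open>T J\<close> compatible.\<close>

lemma (in exact_category) ex_lower_system:
  assumes "configuration C A I r0 S" and "lower_functor C I r E e"
    and rr: "r \<subseteq> r0" and fin: "finite I"
    and E: "\<And>U. U \<in> lower_sets I r0 \<Longrightarrow> E U = \<sigma> S U"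
    and e: "\<And>U V. U \<in> lower_sets I r0 \<Longrightarrow> V \<in> lower_sets I r0 \<Longrightarrow> U \<subseteq> V \<Longrightarrow> e U V = \<iota> S U V"
  obtains T c where "lower_system C A I r E e T c"
    and "\<And>J. J \<in> fsets I r0 \<Longrightarrow> T J = \<sigma> S J"
    and "\<And>U J. upper I r0 U J \<Longrightarrow> c U J = \<pi> S U J"
proof -
  interpret lower_functor C I r E e by fact
  interpret S: configuration C A I r0 S by fact
  let ?W = "widest I r" and ?V = "widest I r0"
  note low = lower_sets_antimono[OF rr, where I = I] and part = upper_antimono[OF rr, where I = I]
  note fs = fsets_antimono[OF rr, where I = I]
  have "\<exists>T q. \<guillemotleft>q : E (?W J) \<rightarrow> T\<guillemotright> \<and> ses (e (?W J - J) (?W J)) q \<and>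
      (J \<in> fsets I r0 \<longrightarrow> T = \<sigma> S J \<and> q \<cdot> e (?V J) (?W J) = \<pi> S (?V J) J)"
    if J: "J \<in> fsets I r" for J
  proof -
    note W = upper_widest[OF J]
    note w = upperD[OF W]
    note ar = e_arr[OF w(3,1) Diff_subset]
    obtain q where q: "cokernel q (e (?W J - J) (?W J))" using arr_ex_cokernel[of "e (?W J - J) (?W J)"] ar by blast
    note Q = cokernelD[OF q]
    have s: "ses (e (?W J - J) (?W J)) q" using ses_if_cokernel[OF e_monic[OF w(3,1)] q] by blast
    show ?thesis
    proof (cases "J \<in> fsets I r0")
      case False
      then show ?thesis using s Q ar by (intro exI[of _ "cod q"] exI[of _ q]) (simp add: arrow_iff)
    next
      case True
      note W0 = S.upper_widest[OF True]
      note w0 = S.upperD[OF W0]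
      have sub: "?V J \<subseteq> ?W J" using upper_subset_widest[OF part[OF W0]] .
      have "ses (e (?V J - J) (?V J)) (q \<cdot> e (?V J) (?W J))"
        using ses_restrict[OF W low[OF w0(1)] sub w0(2) s] .
      then have k: "cokernel (q \<cdot> e (?V J) (?W J)) (\<iota> S (?V J - J) (?V J))"
        using e[OF w0(3,1) Diff_subset] sesD(2) by simp
      have p: "cokernel (\<pi> S (?V J) J) (\<iota> S (?V J - J) (?V J))"
        using sesD(2)[OF S.upper_ses[OF W0]] .
      note ar' = e_arr[OF low[OF w0(1)] w(1) sub] S.\<pi>_arr[OF S.upper_hpairs[OF W0]]
      obtain u where u: "\<guillemotleft>u : cod q \<rightarrow> \<sigma> S J\<guillemotright>" "u \<cdot> (q \<cdot> e (?V J) (?W J)) = \<pi> S (?V J) J"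
        "is_iso C (cod q) (\<sigma> S J) u"
        using cokernel_isoE[OF k p] ar' ar Q by (metis arr_Comp(3))
      have "cokernel (u \<cdot> q) (e (?W J - J) (?W J))"
        using cokernel_Comp_iso[OF q u(3)] True by simp
      then have "ses (e (?W J - J) (?W J)) (u \<cdot> q)"
        using ses_if_cokernel[OF e_monic[OF w(3,1)]] by blast
      moreover have "(u \<cdot> q) \<cdot> e (?V J) (?W J) = \<pi> S (?V J) J"
        using u(1,2) ar ar' Q by (simp add: arrow_iff)
      ultimately show ?thesis
        using u(1) ar Q by (intro exI[of _ "\<sigma> S J"] exI[of _ "u \<cdot> q"]) (simp add: arrow_iff)
    qed
  qed
  then obtain T q where
    q: "\<And>J. J \<in> fsets I r \<Longrightarrow> \<guillemotleft>q J : E (?W J) \<rightarrow> T J\<guillemotright>"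
    and qs: "\<And>J. J \<in> fsets I r \<Longrightarrow> ses (e (?W J - J) (?W J)) (q J)"
    and T: "\<And>J. J \<in> fsets I r0 \<Longrightarrow> T J = \<sigma> S J"
    and q0: "\<And>J. J \<in> fsets I r0 \<Longrightarrow> q J \<cdot> e (?V J) (?W J) = \<pi> S (?V J) J"
    using fs by metis
  note qa = q[unfolded arrow_iff]
  define c where "c = (\<lambda>U J. q J \<cdot> e U (?W J))"
  have "lower_system C A I r E e T c"
  proof
    fix U J assume U: "upper I r U J"
    note J = upper_fsets[OF U]
    note u = upperD[OF U] and sub = upper_subset_widest[OF U]
    note w = upperD[OF upper_widest[OF J]]
    show "\<guillemotleft>c U J : E U \<rightarrow> T J\<guillemotright>"
      using e_arr[OF u(1) w(1) sub] qa[OF J] by (simp add: c_def arrow_iff)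
    show "ses (e (U - J) U) (c U J)"
      unfolding c_def using ses_restrict[OF upper_widest[OF J] u(1) sub u(2) qs[OF J]] .
  next
    fix U V J assume U: "upper I r U J" and V: "upper I r V J" and UV: "U \<subseteq> V"
    note J = upper_fsets[OF U]
    note u = upperD(1)[OF U] upperD(1)[OF V] and sub = upper_subset_widest[OF V]
    note w = upperD(1)[OF upper_widest[OF J]]
    show "c V J \<cdot> e U V = c U J"
      using e_Comp[OF u w UV sub] e_arr[OF u UV] e_arr[OF u(2) w sub] qa[OF J]
      by (simp add: c_def)
  next
    show "is_zero_object C (T {})"
      using T[of "{}"] S.\<sigma>_empty S.lower_fsets[OF S.empty_lower] by simp
  next
    fix x assume "x \<in> I"
    then show "T {x} \<in> A" using T S.singleton_fsets S.\<sigma>_in_A by simp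
  qed (use e_arrow e_Id e_Comp fin in blast)+
  moreover have "c U J = \<pi> S U J" if U: "upper I r0 U J" for U J
  proof -
    note J = S.upper_fsets[OF U]
    note W0 = S.upper_widest[OF J] and sub = S.upper_subset_widest[OF U]
    note w0 = S.upperD(1)[OF U] S.upperD(1)[OF W0]
    note W = upper_widest[OF fs[OF J]]
    have sub': "?V J \<subseteq> ?W J" using upper_subset_widest[OF part[OF W0]] .
    note ar = e_arr[OF low[OF w0(1)] low[OF w0(2)] sub] e_arr[OF low[OF w0(2)] upperD(1)[OF W] sub']
      qa[OF fs[OF J]]
    have "c U J = (q J \<cdot> e (?V J) (?W J)) \<cdot> e U (?V J)"
      using e_Comp[OF low[OF w0(1)] low[OF w0(2)] upperD(1)[OF W] sub sub'] ar
      by (simp add: c_def)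
    also have "\<dots> = \<pi> S U J"
      using q0[OF J] e[OF w0 sub] S.upper_\<pi>_\<iota>[OF U W0 sub] by simp
    finally show ?thesis .
  qed
  ultimately show ?thesis using that T by blast
qed

text \<open>With these choices the configuration built from \<open>E\<close> restricts to the given one on the nose: \<open>\<tau>\<close> is
  characterized by its composite with one projection, and the given \<open>\<iota>\<close> and \<open>\<pi>\<close> have the same
  composite by the exchange rule and the composition rule for projections.\<close>

lemma (in exact_category) ex_extension:
  assumes S: "configuration C A I r0 S" and F: "lower_functor C I r E e"
    and rr: "r \<subseteq> r0" and fin: "finite I"
    and E: "\<And>U. U \<in> lower_sets I r0 \<Longrightarrow> E U = \<sigma> S U"
    and e: "\<And>U V. U \<in> lower_sets I r0 \<Longrightarrow> V \<in> lower_sets I r0 \<Longrightarrow> U \<subseteq> V \<Longrightarrow> e U V = \<iota> S U V"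
  obtains S' c where "is_improvement C A I r0 r S S'"
    and "\<And>U V J. upper I r U J \<Longrightarrow> upper I r V J \<Longrightarrow> U \<subseteq> V \<Longrightarrow> c V J \<cdot> e U V = c U J"
    and "\<And>U J. upper I r0 U J \<Longrightarrow> c U J = \<pi> S U J"
    and "\<And>U W J K. upper I r U J \<Longrightarrow> upper I r W K \<Longrightarrow> U \<subseteq> W \<Longrightarrow> U - J \<subseteq> W - K \<Longrightarrow>
      \<iota> S' J K \<cdot> c U J = c W K \<cdot> e U W"
proof -
  obtain T c where Tc: "lower_system C A I r E e T c"
    and T: "\<And>J. J \<in> fsets I r0 \<Longrightarrow> T J = \<sigma> S J"
    and c: "\<And>U J. upper I r0 U J \<Longrightarrow> c U J = \<pi> S U J"
    by (rule ex_lower_system[OF S F rr fin E e], assumption+, rule that)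
  interpret lower_system C A I r E e T c by fact
  interpret S: configuration C A I r0 S by fact
  note low = lower_sets_antimono[OF rr, where I = I] and part = upper_antimono[OF rr, where I = I]
  have \<iota>: "\<tau> J K = \<iota> S J K" if JK: "(J, K) \<in> gpairs I r0" for J K
  proof -
    note G = S.gpairsD[OF JK]
    note U = S.upper_down[OF G(1)] and W = S.upper_down[OF G(2)]
    note sub = S.down_gpairs[OF JK]
    have sub': "down r0 J - J \<subseteq> down r0 K - K" using sub by blast
    note u = S.upperD(1)[OF U] S.upperD(1)[OF W]
    show ?thesis
    proof (rule \<tau>_eqI[OF part[OF U] part[OF W] sub(1) sub'])
      show "\<guillemotleft>\<iota> S J K : T J \<rightarrow> T K\<guillemotright>" using S.\<iota>_monic(1)[OF JK] T G(1,2) by simp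
      show "\<iota> S J K \<cdot> c (down r0 J) J = c (down r0 K) K \<cdot> e (down r0 J) (down r0 K)"
        using S.\<pi>_\<iota>[OF S.lower_gpairs[OF u sub(1)] S.upper_hpairs[OF W]] sub(2) c[OF U] c[OF W]
          e[OF u sub(1)] by simp
    qed
  qed
  have \<pi>: "\<tau> J K = \<pi> S J K" if JK: "(J, K) \<in> hpairs I r0" for J K
  proof -
    note H = S.hpairsD[OF JK]
    note U = S.upper_down[OF H(1)]
    note V = S.upper_hpairs_trans[OF JK U]
    note u = low[OF S.upperD(1)[OF U]]
    have sub: "down r0 J - J \<subseteq> down r0 J - K" using H(3) by blast
    show ?thesis
    proof (rule \<tau>_eqI[OF part[OF U] part[OF V] order.refl sub])
      show "\<guillemotleft>\<pi> S J K : T J \<rightarrow> T K\<guillemotright>" using S.\<pi>_epic(1)[OF JK] T H(1,2) by simp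
      show "\<pi> S J K \<cdot> c (down r0 J) J = c (down r0 J) K \<cdot> e (down r0 J) (down r0 J)"
        using S.\<pi>_Comp[OF S.upper_hpairs[OF U] JK] c[OF U] c[OF V] e_Id[OF u] c_arr[OF part[OF V]]
        by simp
    qed
  qed
  let ?S' = "\<lparr>\<sigma> = T, \<iota> = \<tau>, \<pi> = \<tau>\<rparr>"
  have "is_improvement C A I r0 r S ?S'"
    unfolding is_improvement_def using is_configuration_\<tau> T \<iota> \<pi> by auto
  then show ?thesis
    using c_restrict c \<tau>_arrow_eq(2) by (intro that[of ?S' c]) simp_all
qed

section \<open>Removing a covering relation\<close>

locale covering_pair = configuration C A I r S
  for C :: "('o, 'm) category_data" (structure) and A :: "'o set"
    and I :: "'i set" and r :: "'i rel" and S :: "('i, 'o, 'm) config_data" +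
  fixes i j :: 'i and r' :: "'i rel"
  assumes ij: "i \<noteq> j" "(i, j) \<in> r"
    and cover: "\<And>k. k \<in> I \<Longrightarrow> (i, k) \<in> r \<Longrightarrow> (k, j) \<in> r \<Longrightarrow> k = i \<or> k = j"
    and r': "r' = {(a, b). (a, b) \<in> r \<and> (a, b) \<noteq> (i, j)}"
    and finite_I: "finite I"
begin

lemma r'_subset: "r' \<subseteq> r"
  by (auto simp: r')

lemma ij_I: "i \<in> I" "j \<in> I"
  using ij r_field by auto

text \<open>Transitivity is where \<open>j\<close> has to cover \<open>i\<close>: no chain of other relations leads from \<open>i\<close> to \<open>j\<close>.\<close>

lemma partial_order_r': "partial_order_on I r'"
proof -
  have "trans r'"
  proof (rule transI)
    fix x y z assume xyz: "(x, y) \<in> r'" "(y, z) \<in> r'"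
    then have "(x, z) \<in> r" using r_trans by (auto simp: r')
    moreover have "(x, z) \<noteq> (i, j)"
      using xyz cover[of y] r_field by (auto simp: r')
    ultimately show "(x, z) \<in> r'" by (simp add: r')
  qed
  moreover have "antisym r'" using r_antisym by (auto simp: r' antisym_def)
  moreover have "refl_on I r'" using r_refl ij(1) by (auto simp: r' refl_on_def)
  ultimately show ?thesis
    using r_field unfolding partial_order_on_def preorder_on_def by (auto simp: r')
qed

sublocale N: poset I r'
  by unfold_locales (fact partial_order_r')

lemma dominates: "dominates_by I r r' 1"
proof -
  have "{(a, b). (a, b) \<in> r \<and> (a, b) \<notin> r'} = {(i, j)}" using ij by (auto simp: r')
  then show ?thesis
    using partial_order partial_order_r' r'_subset by (simp add: dominates_by_def)
qed

lemma ij_gpairs: "({i}, {i, j}) \<in> gpairs I r"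
  and ij_hpairs: "({i, j}, {j}) \<in> hpairs I r"
  and ji_gpairs': "({j}, {i, j}) \<in> gpairs I r'"
  and ij_fsets: "{i, j} \<in> fsets I r"
proof -
  show ij_f: "{i, j} \<in> fsets I r"
    unfolding fsets_def
  proof (intro CollectI conjI ballI impI)
    fix x h k assume "x \<in> I" "h \<in> {i, j}" "k \<in> {i, j}" "(h, x) \<in> r \<and> (x, k) \<in> r"
    then show "x \<in> {i, j}"
      using cover[of x] r_antisym[of x i] r_antisym[of x j] r_trans[of j x i] r_antisym[of i j] ij
      by auto
  qed (use ij_I in simp)
  then show g: "({i}, {i, j}) \<in> gpairs I r"
    using singleton_fsets[OF ij_I(1)] ij r_antisym by (auto simp: gpairs_def)
  have "{i, j} - {i} = {j}" using ij(1) by auto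
  then show "({i, j}, {j}) \<in> hpairs I r"
    using gpairs_hpairs_Diff[OF g] by simp
  have "fsets I r \<subseteq> fsets I r'"
    using r'_subset unfolding fsets_def by blast
  then have "{i, j} \<in> fsets I r'" using ij_f by blast
  then show "({j}, {i, j}) \<in> gpairs I r'"
    using N.singleton_fsets[OF ij_I(2)] unfolding gpairs_def by (auto simp: r')
qed

abbreviation \<iota>\<^sub>i :: 'm where "\<iota>\<^sub>i \<equiv> \<iota> S {i} {i, j}"
abbreviation \<pi>\<^sub>j :: 'm where "\<pi>\<^sub>j \<equiv> \<pi> S {i, j} {j}"

lemma \<iota>\<^sub>i_\<pi>\<^sub>j: "ses \<iota>\<^sub>i \<pi>\<^sub>j"
proof -
  have "{i, j} - {i} = {j}" using ij(1) by auto
  then show ?thesis using ses_\<iota>_\<pi>[OF ij_gpairs] by simp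
qed

lemmas \<iota>\<^sub>i_arr = \<iota>_arr[OF ij_gpairs]
lemmas \<pi>\<^sub>j_arr = \<pi>_arr[OF ij_hpairs]

lemmas fsets_r' = fsets_antimono[OF r'_subset, where I = I]

lemma gpairs_r': "(J, K) \<in> gpairs I r \<Longrightarrow> (J, K) \<in> gpairs I r'"
  using r'_subset fsets_r' unfolding gpairs_def by blast

lemma hpairs_r': "(J, K) \<in> hpairs I r \<Longrightarrow> (J, K) \<in> hpairs I r'"
  using r'_subset fsets_r' unfolding hpairs_def by blast

lemmas lower_r' = lower_sets_antimono[OF r'_subset, where I = I]

lemmas upper_r' = upper_antimono[OF r'_subset, where I = I]

text \<open>For \<open>U\<close> closed under \<open>r'\<close>, this is the closure under \<open>r\<close>.\<close>

definition cl :: "'i set \<Rightarrow> 'i set" where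
  "cl U = (if j \<in> U then insert i U else U)"

definition new :: "'i set \<Rightarrow> bool" where
  "new U \<longleftrightarrow> U \<in> lower_sets I r' \<and> j \<in> U \<and> i \<notin> U"

lemma cl_lower:
  assumes "U \<in> lower_sets I r'"
  shows "cl U \<in> lower_sets I r"
proof (rule lower_setsI)
  show "cl U \<subseteq> I" using assms ij_I N.lower_subset by (auto simp: cl_def)
  fix x y assume xy: "x \<in> cl U" "(y, x) \<in> r"
  show "y \<in> cl U"
  proof (cases "x \<in> U")
    case True
    then show ?thesis
      using N.lower_closed[OF assms, of x y] xy by (auto simp: cl_def r')
  next
    case False
    then have x: "x = i" "j \<in> U" using xy(1) by (auto simp: cl_def split: if_splits)
    show ?thesis
    proof (cases "y = i")
      case False
      then have "(y, j) \<in> r'" using r_trans[of y i j] xy(2) x(1) ij(2) by (auto simp: r')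
      then show ?thesis using N.lower_closed[OF assms x(2)] by (auto simp: cl_def)
    qed (use x in \<open>simp add: cl_def\<close>)
  qed
qed

lemma cl_mono: "U \<subseteq> V \<Longrightarrow> cl U \<subseteq> cl V"
  by (auto simp: cl_def)

lemma cl_not_new: "U \<in> lower_sets I r' \<Longrightarrow> \<not> new U \<Longrightarrow> cl U = U"
  by (auto simp: cl_def new_def)

lemma not_new_iff: "U \<in> lower_sets I r' \<Longrightarrow> \<not> new U \<longleftrightarrow> U \<in> lower_sets I r"
  using cl_lower[of U] cl_not_new[of U] lower_closed[of U j i] ij(2) by (auto simp: new_def)

lemma lower_not_new [simp]: "U \<in> lower_sets I r \<Longrightarrow> \<not> new U"
  using not_new_iff lower_r' by blast

lemma cl_eq: "U \<in> lower_sets I r \<Longrightarrow> cl U = U"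
  using cl_not_new lower_r' by simp

text \<open>An element of \<open>U\<close> above \<open>j\<close>, other than \<open>j\<close>, would be above \<open>i\<close> also for \<open>r'\<close>, and then \<open>i \<in> U\<close>. So \<open>j\<close>
  is maximal in \<open>U\<close>, and \<open>i\<close>, \<open>j\<close> can be removed from \<open>cl U\<close> in either order for \<open>r'\<close>.\<close>

lemma newD:
  assumes "new U"
  shows "U \<in> lower_sets I r'" "j \<in> U" "i \<notin> U" "cl U = insert i U"
    "U - {j} \<in> lower_sets I r" "upper I r (cl U) {i, j}" "upper I r (cl U) {j}"
    "upper I r' (cl U) {i}" "upper I r' U {j}"
proof -
  show U: "U \<in> lower_sets I r'" "j \<in> U" "i \<notin> U" and c: "cl U = insert i U"
    using assms by (auto simp: new_def cl_def)
  have ji: "y \<noteq> j" if "x \<in> U" "x \<noteq> j" "(y, x) \<in> r" for x y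
    using N.lower_closed[OF U(1) that(1), of i] r_trans[OF ij(2), of x] that U(3) by (auto simp: r')
  show low: "U - {j} \<in> lower_sets I r"
  proof (rule lower_setsI)
    fix x y assume "x \<in> U - {j}" "(y, x) \<in> r"
    then show "y \<in> U - {j}"
      using N.lower_closed[OF U(1), of x y] ji[of x y] by (auto simp: r')
  qed (use U N.lower_subset in blast)
  have clU: "cl U \<in> lower_sets I r" using cl_lower U(1) .
  moreover have eq: "cl U - {i, j} = U - {j}" "cl U - {i} = U" using U c by auto
  ultimately show "upper I r (cl U) {i, j}" "upper I r' (cl U) {i}"
    using low U c lower_r' by (auto simp: upper_def)
  have "cl U - {j} \<in> lower_sets I r"
  proof (rule lower_setsI)
    fix x y assume xy: "x \<in> cl U - {j}" "(y, x) \<in> r"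
    have "y \<noteq> j"
    proof (cases "x = i")
      case True
      then show ?thesis using xy(2) r_antisym[of i j] ij by auto
    qed (use ji[of x y] xy c in auto)
    then show "y \<in> cl U - {j}" using lower_closed[OF clU] xy by blast
  qed (use clU lower_subset in blast)
  then show "upper I r (cl U) {j}" using clU U(2) c by (auto simp: upper_def)
  show "upper I r' U {j}" using U lower_r'[OF low] by (auto simp: upper_def)
qed

lemma cl_gpairs: "U \<in> lower_sets I r' \<Longrightarrow> V \<in> lower_sets I r' \<Longrightarrow> U \<subseteq> V \<Longrightarrow> (cl U, cl V) \<in> gpairs I r"
  using lower_gpairs[OF cl_lower cl_lower cl_mono] .

end

section \<open>The new lower sets of a split covering pair\<close>

text \<open>A splitting of \<open>\<sigma>({i, j})\<close>, given by a retraction onto \<open>\<sigma>({i})\<close>. The complement of \<open>\<sigma>({i})\<close> is the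
  kernel of \<open>p\<close>.\<close>

locale split_pair = covering_pair C A I r S i j r'
  for C :: "('o, 'm) category_data" (structure) and A :: "'o set"
    and I :: "'i set" and r :: "'i rel" and S :: "('i, 'o, 'm) config_data"
    and i j :: 'i and r' :: "'i rel" +
  fixes p :: 'm
  assumes p_arrow: "\<guillemotleft>p : \<sigma> S {i, j} \<rightarrow> \<sigma> S {i}\<guillemotright>"
    and p_\<iota>\<^sub>i: "p \<cdot> \<iota>\<^sub>i = Id C (\<sigma> S {i})"
begin

lemmas p_arr = p_arrow[unfolded arrow_iff]

lemma p_epic: "epic p"
  using epic_of_Comp[of p \<iota>\<^sub>i] p_arr \<iota>\<^sub>i_arr p_\<iota>\<^sub>i singleton_fsets[OF ij_I(1)] by simp

lemma p_\<pi>\<^sub>j_null: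
  assumes x: "arr x" "cod x = \<sigma> S {i, j}" and null: "null (p \<cdot> x)" "null (\<pi>\<^sub>j \<cdot> x)"
  shows "null x"
proof -
  obtain y where y: "\<guillemotleft>y : dom x \<rightarrow> \<sigma> S {i}\<guillemotright>" "\<iota>\<^sub>i \<cdot> y = x"
    using kernelE[OF sesD(1)[OF \<iota>\<^sub>i_\<pi>\<^sub>j], of x] x null(2) \<iota>\<^sub>i_arr \<pi>\<^sub>j_arr by auto
  have "p \<cdot> (\<iota>\<^sub>i \<cdot> y) = (p \<cdot> \<iota>\<^sub>i) \<cdot> y" using y(1) p_arr \<iota>\<^sub>i_arr by (simp add: arrow_iff)
  then have "p \<cdot> x = y" using y p_\<iota>\<^sub>i by (simp add: arrow_iff)
  then have "null (\<iota>\<^sub>i \<cdot> y)" using null(1) y(1) \<iota>\<^sub>i_arr by (simp add: arrow_iff)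
  then show ?thesis using y(2) by simp
qed

text \<open>In an improvement in which \<open>\<pi>({i, j}, {i})\<close> is \<open>p\<close>, this is the projection \<open>\<pi>(cl U, {i})\<close>, whose kernel
  is \<open>\<sigma>(U)\<close>. Hence \<open>E(U)\<close> is defined as the kernel of \<open>\<chi> U\<close> for new \<open>U\<close>, and as \<open>\<sigma>(U)\<close> otherwise.\<close>

definition \<chi> :: "'i set \<Rightarrow> 'm" where
  "\<chi> U = p \<cdot> \<pi> S (cl U) {i, j}"

definition k :: "'i set \<Rightarrow> 'm" where
  "k U = (if new U then SOME f. kernel f (\<chi> U) else Id C (\<sigma> S U))"

definition E :: "'i set \<Rightarrow> 'o" where
  "E U = dom (k U)"

text \<open>\<open>E(U)\<close> is regarded as a subobject of \<open>\<sigma>(cl U)\<close> by means of \<open>k\<close>, and \<open>e\<close> is the inclusion.\<close>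

definition e :: "'i set \<Rightarrow> 'i set \<Rightarrow> 'm" where
  "e U V = (THE f. \<guillemotleft>f : E U \<rightarrow> E V\<guillemotright> \<and> k V \<cdot> f = \<iota> S (cl U) (cl V) \<cdot> k U)"

lemma \<pi>_cl_arr:
  assumes "new U"
  shows "arr (\<pi> S (cl U) {i, j})" "dom (\<pi> S (cl U) {i, j}) = \<sigma> S (cl U)"
    "cod (\<pi> S (cl U) {i, j}) = \<sigma> S {i, j}" "epic (\<pi> S (cl U) {i, j})"
  using \<pi>_epic[OF upper_hpairs[OF newD(6)[OF assms]]] by (simp_all add: arrow_iff)

lemma \<chi>_arr:
  assumes "new U"
  shows "arr (\<chi> U)" "dom (\<chi> U) = \<sigma> S (cl U)" "cod (\<chi> U) = \<sigma> S {i}" "epic (\<chi> U)"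
  using \<pi>_cl_arr[OF assms] p_arr p_epic epic_Comp unfolding \<chi>_def by auto

lemma k_kernel:
  assumes "new U"
  shows "kernel (k U) (\<chi> U)"
proof -
  have "\<exists>f. kernel f (\<chi> U)" using arr_ex_kernel[OF \<chi>_arr(1)[OF assms]] by blast
  then have "kernel (SOME f. kernel f (\<chi> U)) (\<chi> U)" by (rule someI_ex)
  then show ?thesis using assms by (simp add: k_def)
qed

lemma k_old: "U \<in> lower_sets I r \<Longrightarrow> k U = Id C (\<sigma> S U)"
  by (simp add: k_def)

lemma E_old: "U \<in> lower_sets I r \<Longrightarrow> E U = \<sigma> S U"
  by (simp add: E_def k_old)

lemma k_arr:
  assumes "U \<in> lower_sets I r'"
  shows "arr (k U)" "dom (k U) = E U" "cod (k U) = \<sigma> S (cl U)" "monic (k U)"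
proof -
  have "arr (k U) \<and> cod (k U) = \<sigma> S (cl U) \<and> monic (k U)"
  proof (cases "new U")
    case True
    then show ?thesis using kernelD[OF k_kernel[OF True]] \<chi>_arr[OF True] by simp
  next
    case False
    then have "U \<in> lower_sets I r" using not_new_iff assms by blast
    then show ?thesis by (simp add: k_old cl_eq)
  qed
  then show "arr (k U)" "dom (k U) = E U" "cod (k U) = \<sigma> S (cl U)" "monic (k U)"
    by (simp_all add: E_def)
qed

lemma \<chi>_restrict:
  assumes "new U" "new V" "U \<subseteq> V"
  shows "\<chi> V \<cdot> \<iota> S (cl U) (cl V) = \<chi> U"
  using upper_\<pi>_\<iota>[OF newD(6)[OF assms(1)] newD(6)[OF assms(2)] cl_mono[OF assms(3)]]
    \<pi>_cl_arr[OF assms(2)] p_arr \<iota>_arr[OF cl_gpairs[OF newD(1)[OF assms(1)] newD(1)[OF assms(2)] assms(3)]]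
  by (simp add: \<chi>_def)

lemma e_spec:
  assumes U: "U \<in> lower_sets I r'" and V: "V \<in> lower_sets I r'" and UV: "U \<subseteq> V"
  shows "\<guillemotleft>e U V : E U \<rightarrow> E V\<guillemotright>" and "k V \<cdot> e U V = \<iota> S (cl U) (cl V) \<cdot> k U"
proof -
  note ar = k_arr[OF U] k_arr[OF V] \<iota>_arr[OF cl_gpairs[OF U V UV]]
  have "\<exists>f. \<guillemotleft>f : E U \<rightarrow> E V\<guillemotright> \<and> k V \<cdot> f = \<iota> S (cl U) (cl V) \<cdot> k U"
  proof (cases "new V")
    case False
    then have "V \<in> lower_sets I r" using not_new_iff V by blast
    then show ?thesis
      using ar by (intro exI[of _ "\<iota> S (cl U) (cl V) \<cdot> k U"]) (simp add: k_old E_old cl_eq arrow_iff)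
  next
    case True
    note nV = newD[OF True]
    have "null (\<chi> V \<cdot> (\<iota> S (cl U) (cl V) \<cdot> k U))"
    proof (cases "new U")
      case nU: True
      have "\<chi> V \<cdot> (\<iota> S (cl U) (cl V) \<cdot> k U) = (\<chi> V \<cdot> \<iota> S (cl U) (cl V)) \<cdot> k U"
        using ar \<chi>_arr[OF True] by simp
      then show ?thesis
        using \<chi>_restrict[OF nU True UV] kernelD(5)[OF k_kernel[OF nU]] by simp
    next
      case False
      then have "cl U \<inter> {i, j} = {}" using UV nV U by (auto simp: cl_def new_def)
      then have "null (\<pi> S (cl V) {i, j} \<cdot> \<iota> S (cl U) (cl V))"
        using \<pi>_\<iota>_null[OF cl_gpairs[OF U V UV] upper_hpairs[OF nV(6)]] by simp
      then have "null ((p \<cdot> (\<pi> S (cl V) {i, j} \<cdot> \<iota> S (cl U) (cl V))) \<cdot> k U)"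
        using ar \<pi>_cl_arr[OF True] p_arr
        by - (rule null_Comp_left, rule null_Comp_right, simp_all)
      then show ?thesis
        using ar \<pi>_cl_arr[OF True] p_arr by (simp add: \<chi>_def)
    qed
    then show ?thesis
      using kernelE[OF k_kernel[OF True], of "\<iota> S (cl U) (cl V) \<cdot> k U"] ar \<chi>_arr[OF True] by auto
  qed
  then obtain f where f: "\<guillemotleft>f : E U \<rightarrow> E V\<guillemotright>" "k V \<cdot> f = \<iota> S (cl U) (cl V) \<cdot> k U" by blast
  have "e U V = f"
    unfolding e_def
  proof (rule the_equality)
    fix g assume "\<guillemotleft>g : E U \<rightarrow> E V\<guillemotright> \<and> k V \<cdot> g = \<iota> S (cl U) (cl V) \<cdot> k U"
    then show "g = f" using f ar by - (rule monic_cancel[of "k V"], simp_all add: arrow_iff)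
  qed (use f in blast)
  then show "\<guillemotleft>e U V : E U \<rightarrow> E V\<guillemotright>" "k V \<cdot> e U V = \<iota> S (cl U) (cl V) \<cdot> k U"
    using f by simp_all
qed

lemmas e_arr = e_spec(1)[unfolded arrow_iff]

lemma e_eqI:
  assumes U: "U \<in> lower_sets I r'" and V: "V \<in> lower_sets I r'" and UV: "U \<subseteq> V"
    and f: "\<guillemotleft>f : E U \<rightarrow> E V\<guillemotright>" "k V \<cdot> f = \<iota> S (cl U) (cl V) \<cdot> k U"
  shows "e U V = f"
  using e_spec[OF U V UV] f k_arr[OF V] by - (rule monic_cancel[of "k V"], simp_all add: arrow_iff)

lemma e_Id: "U \<in> lower_sets I r' \<Longrightarrow> e U U = Id C (E U)"
  using k_arr[of U] cl_lower[of U] \<iota>_Id[of "cl U"] dom_Obj[of "k U"]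
  by (intro e_eqI) (auto simp: arrow_iff)

lemma e_Comp:
  assumes U: "U \<in> lower_sets I r'" and V: "V \<in> lower_sets I r'" and W: "W \<in> lower_sets I r'"
    and UV: "U \<subseteq> V" "V \<subseteq> W"
  shows "e V W \<cdot> e U V = e U W"
proof (rule e_eqI[symmetric])
  have UW: "U \<subseteq> W" using UV by blast
  note ar = k_arr[OF U] k_arr[OF V] k_arr[OF W] e_arr[OF U V UV(1)] e_arr[OF V W UV(2)]
    \<iota>_arr[OF cl_gpairs[OF U V UV(1)]] \<iota>_arr[OF cl_gpairs[OF V W UV(2)]]
  show "\<guillemotleft>e V W \<cdot> e U V : E U \<rightarrow> E W\<guillemotright>" using ar by (simp add: arrow_iff)
  have "k W \<cdot> (e V W \<cdot> e U V) = (k W \<cdot> e V W) \<cdot> e U V" using ar by simp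
  also have "\<dots> = \<iota> S (cl V) (cl W) \<cdot> (k V \<cdot> e U V)"
    unfolding e_spec(2)[OF V W UV(2)] using ar by simp
  also have "\<dots> = (\<iota> S (cl V) (cl W) \<cdot> \<iota> S (cl U) (cl V)) \<cdot> k U"
    unfolding e_spec(2)[OF U V UV(1)] using ar by simp
  also have "\<dots> = \<iota> S (cl U) (cl W) \<cdot> k U"
    using \<iota>_Comp[OF cl_gpairs[OF U V UV(1)] cl_gpairs[OF V W UV(2)]] by simp
  finally show "k W \<cdot> (e V W \<cdot> e U V) = \<iota> S (cl U) (cl W) \<cdot> k U" .
qed (use U W UV in auto)

lemma e_monic:
  assumes U: "U \<in> lower_sets I r'" and V: "V \<in> lower_sets I r'" and UV: "U \<subseteq> V"
  shows "monic (e U V)"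
proof (rule monic_of_Comp)
  show "monic (k V \<cdot> e U V)"
    unfolding e_spec(2)[OF assms]
    using k_arr[OF U] \<iota>_monic(2)[OF cl_gpairs[OF assms]] \<iota>_arr[OF cl_gpairs[OF assms]]
    by (simp add: monic_Comp)
qed (use k_arr[OF V] e_arr[OF assms] in simp_all)

lemma e_old:
  assumes U: "U \<in> lower_sets I r" and V: "V \<in> lower_sets I r" and UV: "U \<subseteq> V"
  shows "e U V = \<iota> S U V"
  using \<iota>_arr[OF lower_gpairs[OF assms]] U V lower_r'
  by (intro e_eqI) (simp_all add: UV E_old k_old cl_eq arrow_iff)

lemma e_to_old:
  assumes U: "U \<in> lower_sets I r'" and V: "V \<in> lower_sets I r" and UV: "U \<subseteq> V"
  shows "e U V = \<iota> S (cl U) V \<cdot> k U"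
  using e_spec[OF U lower_r'[OF V] UV] e_arr[OF U lower_r'[OF V] UV] V by (simp add: k_old cl_eq E_old)

subsection \<open>Meets with new lower sets\<close>

text \<open>As \<open>V\<close> contains \<open>i\<close> but not \<open>j\<close>, the intersection of \<open>cl U \<inter> V\<close> with \<open>{i, j}\<close> is \<open>{i}\<close>, on which \<open>p\<close> is
  the identity. So \<open>\<chi> U\<close> restricts to the projection of \<open>\<sigma>(cl U \<inter> V)\<close> onto \<open>\<sigma>({i})\<close>, whose kernel is
  \<open>\<sigma>(U \<inter> V)\<close>.\<close>

lemma factor_new_old:
  assumes U: "new U" and V: "V \<in> lower_sets I r" and iV: "i \<in> V" "j \<notin> V"
    and h: "\<guillemotleft>h : X \<rightarrow> \<sigma> S (cl U \<inter> V)\<guillemotright>" and null: "null (\<chi> U \<cdot> (\<iota> S (cl U \<inter> V) (cl U) \<cdot> h))"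
  shows "\<exists>g. \<guillemotleft>g : X \<rightarrow> \<sigma> S (U \<inter> V)\<guillemotright> \<and> \<iota> S (U \<inter> V) (cl U \<inter> V) \<cdot> g = h"
proof -
  note u = newD[OF U]
  let ?N = "cl U \<inter> V" and ?M = "U \<inter> V"
  have N: "?N \<in> lower_sets I r" using cl_lower[OF u(1)] V by simp
  have M: "?M \<in> lower_sets I r"
    using not_new_iff[of ?M] u(1) lower_r'[OF V] iV by (auto simp: new_def)
  have eq: "?N - ?M = {i}" "?N \<inter> {i, j} = {i}" "?M \<subseteq> ?N" using u iV by auto
  have part: "upper I r ?N {i}" using upper_Diff[OF N M] eq by simp
  note gN = lower_gpairs[OF N cl_lower[OF u(1)] Int_lower1]
  have D: "\<pi> S (cl U) {i, j} \<cdot> \<iota> S ?N (cl U) = \<iota>\<^sub>i \<cdot> \<pi> S ?N {i}"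
    using \<pi>_\<iota>[OF gN upper_hpairs[OF u(6)]] eq by simp
  note ar = \<iota>_arr[OF gN] \<pi>_cl_arr[OF U] p_arr \<iota>\<^sub>i_arr \<pi>_arr[OF upper_hpairs[OF part]]
    h[unfolded arrow_iff]
  have "\<chi> U \<cdot> (\<iota> S ?N (cl U) \<cdot> h) = p \<cdot> ((\<pi> S (cl U) {i, j} \<cdot> \<iota> S ?N (cl U)) \<cdot> h)"
    using ar by (simp add: \<chi>_def)
  also have "\<dots> = (p \<cdot> \<iota>\<^sub>i) \<cdot> (\<pi> S ?N {i} \<cdot> h)"
    unfolding D using ar by simp
  also have "\<dots> = \<pi> S ?N {i} \<cdot> h"
    unfolding p_\<iota>\<^sub>i using ar by simp
  finally have "null (\<pi> S ?N {i} \<cdot> h)" using null by simp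
  moreover have "?N - {i} = ?M" using eq by auto
  then have "kernel (\<iota> S ?M ?N) (\<pi> S ?N {i})"
    using sesD(1)[OF upper_ses[OF part]] by simp
  ultimately show ?thesis
    using kernelE[of "\<iota> S ?M ?N" "\<pi> S ?N {i}" h] ar \<iota>_arr[OF lower_gpairs[OF M N eq(3)]] by auto
qed

text \<open>Elements of \<open>E(U) \<inter> E(V)\<close> are elements of \<open>\<sigma>(cl U \<inter> cl V)\<close> that \<open>\<chi> U\<close> and \<open>\<chi> V\<close> kill, as far as these
  are defined. If \<open>U \<inter> V\<close> is new, \<open>cl U \<inter> cl V\<close> is its closure and \<open>\<chi> (U \<inter> V)\<close> is a restriction of either
  map. Otherwise \<open>cl U \<inter> cl V\<close> exceeds \<open>U \<inter> V\<close> at most by \<open>i\<close>, and if it does,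
  exactly one of \<open>U\<close>, \<open>V\<close> is new.\<close>

lemma factor_meet:
  assumes U: "U \<in> lower_sets I r'" and V: "V \<in> lower_sets I r'"
    and h: "\<guillemotleft>h : X \<rightarrow> \<sigma> S (cl U \<inter> cl V)\<guillemotright>"
    and hU: "new U \<Longrightarrow> null (\<chi> U \<cdot> (\<iota> S (cl U \<inter> cl V) (cl U) \<cdot> h))"
    and hV: "new V \<Longrightarrow> null (\<chi> V \<cdot> (\<iota> S (cl U \<inter> cl V) (cl V) \<cdot> h))"
  shows "\<exists>g. \<guillemotleft>g : X \<rightarrow> E (U \<inter> V)\<guillemotright> \<and> \<iota> S (cl (U \<inter> V)) (cl U \<inter> cl V) \<cdot> (k (U \<inter> V) \<cdot> g) = h"
proof -
  let ?M = "U \<inter> V" and ?N = "cl U \<inter> cl V"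
  have M: "?M \<in> lower_sets I r'" and N: "?N \<in> lower_sets I r"
    using U V cl_lower by auto
  have NO: "\<iota> S ?N ?N = Id C (\<sigma> S ?N)" using \<iota>_Id N by simp
  note h' = h[unfolded arrow_iff]
  consider (new) "new ?M" | (same) "\<not> new ?M" "?N = ?M"
    | (left) "\<not> new ?M" "new U" "\<not> new V" "i \<in> V" "j \<notin> V"
    | (right) "\<not> new ?M" "new V" "\<not> new U" "i \<in> U" "j \<notin> U"
    using M U V
    by (cases "i \<in> U"; cases "i \<in> V"; cases "j \<in> U"; cases "j \<in> V")
      (auto simp: new_def cl_def insert_absorb)
  then show ?thesis
  proof cases
    case new
    have eq: "cl ?M = ?N" using newD(2)[OF new] by (auto simp: cl_def)
    have "null (\<chi> ?M \<cdot> h)"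
    proof (cases "new U")
      case True
      have "\<chi> ?M \<cdot> h = \<chi> U \<cdot> (\<iota> S ?N (cl U) \<cdot> h)"
        using \<chi>_restrict[OF new True] eq h' \<chi>_arr[OF True] \<iota>_arr[OF cl_gpairs[OF M U]]
        by (simp flip: \<chi>_restrict[OF new True])
      then show ?thesis using hU[OF True] by simp
    next
      case False
      then have True: "new V" using new U V by (auto simp: new_def)
      have "\<chi> ?M \<cdot> h = \<chi> V \<cdot> (\<iota> S ?N (cl V) \<cdot> h)"
        using \<chi>_restrict[OF new True] eq h' \<chi>_arr[OF True] \<iota>_arr[OF cl_gpairs[OF M V]]
        by (simp flip: \<chi>_restrict[OF new True])
      then show ?thesis using hV[OF True] by simp
    qed
    then obtain g where "\<guillemotleft>g : X \<rightarrow> E ?M\<guillemotright>" "k ?M \<cdot> g = h"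
      using kernelE[OF k_kernel[OF new], of h] h' \<chi>_arr[OF new] eq k_arr[OF M] by auto
    then show ?thesis using NO h' eq by auto
  next
    case same
    then have "?M \<in> lower_sets I r" using not_new_iff M by blast
    then show ?thesis
      using h' NO same by (intro exI[of _ h]) (simp add: arrow_iff E_old k_old cl_eq)
  next
    case left
    have old: "V \<in> lower_sets I r" "?M \<in> lower_sets I r" using not_new_iff left U V M by blast+
    obtain g where "\<guillemotleft>g : X \<rightarrow> \<sigma> S ?M\<guillemotright>" "\<iota> S ?M ?N \<cdot> g = h"
      using factor_new_old[OF left(2) old(1) left(4,5), of h X] h hU[OF left(2)] cl_eq[OF old(1)] by auto
    then show ?thesis using old by (intro exI[of _ g]) (simp add: arrow_iff E_old k_old cl_eq)
  next
    case right
    have old: "U \<in> lower_sets I r" "?M \<in> lower_sets I r" using not_new_iff right U V M by blast+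
    obtain g where "\<guillemotleft>g : X \<rightarrow> \<sigma> S ?M\<guillemotright>" "\<iota> S ?M ?N \<cdot> g = h"
      using factor_new_old[OF right(2) old(1) right(4,5), of h X] h hV[OF right(2)] cl_eq[OF old(1)]
      by (auto simp: Int_commute)
    then show ?thesis using old by (intro exI[of _ g]) (simp add: arrow_iff E_old k_old cl_eq)
  qed
qed

lemma \<chi>_k_null:
  assumes "new U" "arr f" "cod f = E U"
  shows "null (\<chi> U \<cdot> (k U \<cdot> f))"
proof -
  note a = k_arr[OF newD(1)[OF assms(1)]] \<chi>_arr[OF assms(1)]
  have "null ((\<chi> U \<cdot> k U) \<cdot> f)"
    using kernelD(5)[OF k_kernel[OF assms(1)]] a assms by - (rule null_Comp_left, simp_all)
  then show ?thesis using a assms by simp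
qed

lemma e_meet:
  assumes U: "U \<in> lower_sets I r'" and V: "V \<in> lower_sets I r'" and W: "W \<in> lower_sets I r'"
    and sub: "U \<subseteq> W" "V \<subseteq> W"
    and f: "\<guillemotleft>f : X \<rightarrow> E U\<guillemotright>" and g: "\<guillemotleft>g : X \<rightarrow> E V\<guillemotright>" and fg: "e U W \<cdot> f = e V W \<cdot> g"
  shows "\<exists>h. \<guillemotleft>h : X \<rightarrow> E (U \<inter> V)\<guillemotright> \<and> e (U \<inter> V) U \<cdot> h = f"
proof -
  let ?M = "U \<inter> V" and ?N = "cl U \<inter> cl V"
  have M: "?M \<in> lower_sets I r'" and N: "?N \<in> lower_sets I r" using U V cl_lower by auto
  note cls = cl_lower[OF U] cl_lower[OF V] cl_lower[OF W]
  note gUW = cl_gpairs[OF U W sub(1)] and gVW = cl_gpairs[OF V W sub(2)]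
  note gNU = lower_gpairs[OF N cls(1) Int_lower1] and gNV = lower_gpairs[OF N cls(2) Int_lower2]
  note gMN = lower_gpairs[OF cl_lower[OF M] N]
  note ar = k_arr[OF U] k_arr[OF V] k_arr[OF W] k_arr[OF M] \<iota>_arr[OF gUW] \<iota>_arr[OF gVW]
    \<iota>_arr[OF gNU] \<iota>_arr[OF gNV] e_arr[OF U W sub(1)] e_arr[OF V W sub(2)]
    f[unfolded arrow_iff] g[unfolded arrow_iff] e_arr[OF M U Int_lower1]
  have "\<iota> S (cl U) (cl W) \<cdot> (k U \<cdot> f) = (k W \<cdot> e U W) \<cdot> f"
    unfolding e_spec(2)[OF U W sub(1)] using ar by simp
  also have "\<dots> = (k W \<cdot> e V W) \<cdot> g"
    using fg ar by simp
  also have "\<dots> = \<iota> S (cl V) (cl W) \<cdot> (k V \<cdot> g)"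
    unfolding e_spec(2)[OF V W sub(2)] using ar by simp
  finally have eq: "\<iota> S (cl U) (cl W) \<cdot> (k U \<cdot> f) = \<iota> S (cl V) (cl W) \<cdot> (k V \<cdot> g)" .
  then obtain h where h: "\<guillemotleft>h : X \<rightarrow> \<sigma> S ?N\<guillemotright>" "\<iota> S ?N (cl U) \<cdot> h = k U \<cdot> f"
    using lower_meet[OF cls cl_mono[OF sub(1)] cl_mono[OF sub(2)], of "k U \<cdot> f" X "k V \<cdot> g"] ar
    by (auto simp: arrow_iff)
  have h': "\<iota> S ?N (cl V) \<cdot> h = k V \<cdot> g"
  proof (rule monic_cancel[OF \<iota>_monic(2)[OF gVW]])
    have "\<iota> S (cl V) (cl W) \<cdot> (\<iota> S ?N (cl V) \<cdot> h) = (\<iota> S (cl V) (cl W) \<cdot> \<iota> S ?N (cl V)) \<cdot> h"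
      using h(1) ar by (simp add: arrow_iff)
    also have "\<dots> = (\<iota> S (cl U) (cl W) \<cdot> \<iota> S ?N (cl U)) \<cdot> h"
      using \<iota>_Comp[OF gNU gUW] \<iota>_Comp[OF gNV gVW] by simp
    also have "\<dots> = \<iota> S (cl U) (cl W) \<cdot> (k U \<cdot> f)"
      unfolding h(2)[symmetric] using h(1) ar by (simp add: arrow_iff)
    finally show "\<iota> S (cl V) (cl W) \<cdot> (\<iota> S ?N (cl V) \<cdot> h) = \<iota> S (cl V) (cl W) \<cdot> (k V \<cdot> g)"
      using eq by simp
  qed (use h(1) ar in \<open>simp_all add: arrow_iff\<close>)
  have "null (\<chi> U \<cdot> (\<iota> S ?N (cl U) \<cdot> h))" if "new U"
    unfolding h(2) using \<chi>_k_null[OF that] ar by simp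
  moreover have "null (\<chi> V \<cdot> (\<iota> S ?N (cl V) \<cdot> h))" if "new V"
    unfolding h' using \<chi>_k_null[OF that] ar by simp
  ultimately obtain l where l: "\<guillemotleft>l : X \<rightarrow> E ?M\<guillemotright>" "\<iota> S (cl ?M) ?N \<cdot> (k ?M \<cdot> l) = h"
    using factor_meet[OF U V h(1)] by blast
  have clM: "cl ?M \<subseteq> ?N" using cl_mono[of ?M U] cl_mono[of ?M V] by auto
  have "e ?M U \<cdot> l = f"
  proof (rule monic_cancel[OF k_arr(4)[OF U]])
    have "k U \<cdot> (e ?M U \<cdot> l) = (k U \<cdot> e ?M U) \<cdot> l"
      using l(1) ar by (simp add: arrow_iff)
    also have "\<dots> = \<iota> S (cl ?M) (cl U) \<cdot> (k ?M \<cdot> l)"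
      unfolding e_spec(2)[OF M U Int_lower1]
      using l(1) ar \<iota>_arr[OF cl_gpairs[OF M U Int_lower1]] by (simp add: arrow_iff)
    also have "\<dots> = \<iota> S ?N (cl U) \<cdot> (\<iota> S (cl ?M) ?N \<cdot> (k ?M \<cdot> l))"
      unfolding \<iota>_Comp[OF gMN[OF clM] gNU, symmetric]
      using l(1) ar \<iota>_arr[OF gMN[OF clM]] by (simp add: arrow_iff)
    finally show "k U \<cdot> (e ?M U \<cdot> l) = k U \<cdot> f"
      using l(2) h(2) by simp
  qed (use l(1) ar in \<open>simp_all add: arrow_iff\<close>)
  then show ?thesis using l(1) by blast
qed

subsection \<open>Joins with new lower sets\<close>

text \<open>The projection of \<open>E(U)\<close> onto \<open>\<sigma>({j})\<close>, for lower sets \<open>U\<close> in which \<open>j\<close> is maximal.\<close>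

definition \<psi> :: "'i set \<Rightarrow> 'm" where
  "\<psi> U = \<pi> S (cl U) {j} \<cdot> k U"

text \<open>The quotient of \<open>\<sigma>(cl U)\<close> by \<open>\<sigma>(U - {j})\<close> is \<open>\<sigma>({i, j})\<close>. In it, \<open>E(U)\<close> is the kernel of \<open>p\<close>, which
  \<open>\<pi>\<^sub>j\<close> maps isomorphically onto \<open>\<sigma>({j})\<close>.\<close>

lemma ses_new:
  assumes U: "new U"
  shows "ses (e (U - {j}) U) (\<psi> U)"
proof (rule ses_if_kernel)
  note u = newD[OF U]
  let ?L = "U - {j}"
  have L': "?L \<in> lower_sets I r'" using lower_r'[OF u(5)] .
  have sub: "?L \<subseteq> cl U" "?L \<subseteq> U" using u(4) by auto
  note gL = lower_gpairs[OF u(5) cl_lower[OF u(1)] sub(1)]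
  have kL: "k U \<cdot> e ?L U = \<iota> S ?L (cl U)"
    using e_spec(2)[OF L' u(1) sub(2)] u(5) \<iota>_arr[OF gL] by (simp add: k_old cl_eq)
  note ar = k_arr[OF u(1)] e_arr[OF L' u(1) sub(2)] \<pi>_cl_arr[OF U] p_arr \<chi>_arr[OF U] \<iota>\<^sub>i_arr \<pi>\<^sub>j_arr
    \<iota>_arr[OF gL] \<pi>_arr[OF upper_hpairs[OF u(7)]]
  have \<pi>j: "\<pi>\<^sub>j \<cdot> \<pi> S (cl U) {i, j} = \<pi> S (cl U) {j}"
    using \<pi>_Comp[OF upper_hpairs[OF u(6)] ij_hpairs] .
  have \<psi>: "arr (\<psi> U)" "dom (\<psi> U) = E U" "cod (\<psi> U) = \<sigma> S {j}"
    using ar by (simp_all add: \<psi>_def)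
  show "epic (\<psi> U)"
  proof (rule epicI)
    fix g assume g: "arr g" "dom g = cod (\<psi> U)" "null (g \<cdot> \<psi> U)"
    \<comment> \<open>On \<open>\<sigma>(cl U)\<close>, \<open>g\<close> vanishes on the kernel of \<open>\<chi> U\<close>, so it factors through \<open>p\<close>. Then it
      is determined by its values on \<open>\<sigma>({i})\<close>, where it vanishes.\<close>
    have "null ((g \<cdot> \<pi> S (cl U) {j}) \<cdot> k U)" using g \<psi> ar by (simp add: \<psi>_def)
    then obtain v where v: "\<guillemotleft>v : cod (\<chi> U) \<rightarrow> cod g\<guillemotright>" "v \<cdot> \<chi> U = g \<cdot> \<pi> S (cl U) {j}"
      using cokernelE[OF epic_cokernel_of_kernel[OF \<chi>_arr(4)[OF U] k_kernel[OF U]],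
          of "g \<cdot> \<pi> S (cl U) {j}"] g \<psi> ar by auto
    note v' = v(1)[unfolded arrow_iff]
    have "(v \<cdot> p) \<cdot> \<pi> S (cl U) {i, j} = (g \<cdot> \<pi>\<^sub>j) \<cdot> \<pi> S (cl U) {i, j}"
      using v(2) v' g \<psi> ar \<pi>j by (simp add: \<chi>_def)
    then have vp: "v \<cdot> p = g \<cdot> \<pi>\<^sub>j"
      using v' g \<psi> ar by - (rule epic_cancel[OF \<pi>_cl_arr(4)[OF U]], simp_all)
    have "v = v \<cdot> (p \<cdot> \<iota>\<^sub>i)" unfolding p_\<iota>\<^sub>i using v' ar by simp
    also have "\<dots> = (v \<cdot> p) \<cdot> \<iota>\<^sub>i" using v' ar by simp
    also have "\<dots> = g \<cdot> (\<pi>\<^sub>j \<cdot> \<iota>\<^sub>i)" unfolding vp using g \<psi> ar by simp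
    finally have v_eq: "v = g \<cdot> (\<pi>\<^sub>j \<cdot> \<iota>\<^sub>i)" .
    have "null v"
      unfolding v_eq using sesD(8)[OF \<iota>\<^sub>i_\<pi>\<^sub>j] g \<psi> ar by simp
    then have "null (g \<cdot> \<pi>\<^sub>j)" unfolding vp[symmetric] using v' ar by simp
    then show "null g"
      using g \<psi> ar by - (rule epic_null[OF sesD(4)[OF \<iota>\<^sub>i_\<pi>\<^sub>j]], simp_all)
  qed (use \<psi> in simp)
  show "kernel (e ?L U) (\<psi> U)"
  proof (rule kernelI)
    have "\<psi> U \<cdot> e ?L U = \<pi> S (cl U) {j} \<cdot> \<iota> S ?L (cl U)"
      unfolding \<psi>_def kL[symmetric] using ar by simp
    moreover have "null (\<pi> S (cl U) {j} \<cdot> \<iota> S ?L (cl U))"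
      using \<pi>_\<iota>_null[OF gL upper_hpairs[OF u(7)]] by simp
    ultimately show "null (\<psi> U \<cdot> e ?L U)" by simp
    fix f assume f: "arr f" "cod f = dom (\<psi> U)" "null (\<psi> U \<cdot> f)"
    have "null (\<pi> S (cl U) {i, j} \<cdot> (k U \<cdot> f))"
    proof (rule p_\<pi>\<^sub>j_null)
      show "null (p \<cdot> (\<pi> S (cl U) {i, j} \<cdot> (k U \<cdot> f)))"
        using \<chi>_k_null[OF U] f \<psi> ar by (simp add: \<chi>_def)
      have "\<psi> U \<cdot> f = (\<pi>\<^sub>j \<cdot> \<pi> S (cl U) {i, j}) \<cdot> (k U \<cdot> f)"
        unfolding \<pi>j using f \<psi> ar by (simp add: \<psi>_def)
      then show "null (\<pi>\<^sub>j \<cdot> (\<pi> S (cl U) {i, j} \<cdot> (k U \<cdot> f)))"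
        using f \<psi> ar by simp
    qed (use f \<psi> ar in simp_all)
    moreover have "kernel (\<iota> S ?L (cl U)) (\<pi> S (cl U) {i, j})"
    proof -
      have "cl U - {i, j} = ?L" using u by auto
      then show ?thesis using sesD(1)[OF upper_ses[OF u(6)]] by simp
    qed
    ultimately obtain g where g: "\<guillemotleft>g : dom f \<rightarrow> \<sigma> S ?L\<guillemotright>" "\<iota> S ?L (cl U) \<cdot> g = k U \<cdot> f"
      using kernelE[of "\<iota> S ?L (cl U)" "\<pi> S (cl U) {i, j}" "k U \<cdot> f"] f \<psi> ar by auto
    have "e ?L U \<cdot> g = f"
    proof (rule monic_cancel[OF k_arr(4)[OF u(1)]])
      show "k U \<cdot> (e ?L U \<cdot> g) = k U \<cdot> f"
        using g ar E_old[OF u(5)] unfolding kL[symmetric] by (simp add: arrow_iff)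
    qed (use g(1) f \<psi> ar E_old[OF u(5)] in \<open>simp_all add: arrow_iff\<close>)
    then show "\<exists>g. \<guillemotleft>g : dom f \<rightarrow> dom (e ?L U)\<guillemotright> \<and> e ?L U \<cdot> g = f"
      using g(1) ar E_old[OF u(5)] by auto
  qed (use \<psi> ar e_monic[OF L' u(1) sub(2)] in simp_all)
qed

text \<open>If \<open>j\<close> is maximal in \<open>W\<close>, then \<open>E(W)\<close> is the sum of \<open>E(W - {j})\<close> and of \<open>E(U)\<close> for any new
  \<open>U \<subseteq> W\<close>, because \<open>E(U)\<close> already maps onto \<open>\<sigma>({j})\<close>.\<close>

lemma join_at_j:
  assumes W: "W \<in> lower_sets I r'" and Wj: "upper I r (cl W) {j}"
    and U: "new U" and UW: "U \<subseteq> W"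
    and h: "arr h" "dom h = E W" and null: "null (h \<cdot> e U W)" "null (h \<cdot> e (W - {j}) W)"
  shows "null h"
proof -
  note u = newD[OF U]
  note ar = k_arr[OF u(1)] k_arr[OF W] e_arr[OF u(1) W UW] \<iota>_arr[OF cl_gpairs[OF u(1) W UW]]
    \<pi>_arr[OF upper_hpairs[OF Wj]] \<pi>_arr[OF upper_hpairs[OF u(7)]]
  have coker: "cokernel (\<psi> W) (e (W - {j}) W)"
  proof (cases "new W")
    case True
    then show ?thesis using sesD(2)[OF ses_new] by blast
  next
    case False
    then have old: "W \<in> lower_sets I r" using not_new_iff W by blast
    note w = upperD[OF Wj, unfolded cl_eq[OF old]]
    show ?thesis
      using sesD(2)[OF upper_ses[OF Wj]] ar e_old[OF w(3,1) Diff_subset]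
      by (simp add: \<psi>_def k_old[OF old] cl_eq[OF old])
  qed
  have \<psi>: "arr (\<psi> W)" "dom (\<psi> W) = E W" "cod (\<psi> W) = \<sigma> S {j}"
    "arr (\<psi> U)" "dom (\<psi> U) = E U" "cod (\<psi> U) = \<sigma> S {j}"
    using ar by (simp_all add: \<psi>_def)
  obtain v where v: "\<guillemotleft>v : \<sigma> S {j} \<rightarrow> cod h\<guillemotright>" "v \<cdot> \<psi> W = h"
    using cokernelE[OF coker, of h] h null(2) \<psi> cokernelD(4)[OF coker] by auto
  note v' = v(1)[unfolded arrow_iff]
  have "\<psi> W \<cdot> e U W = \<pi> S (cl W) {j} \<cdot> (k W \<cdot> e U W)"
    using ar by (simp add: \<psi>_def)
  also have "\<dots> = (\<pi> S (cl W) {j} \<cdot> \<iota> S (cl U) (cl W)) \<cdot> k U"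
    unfolding e_spec(2)[OF u(1) W UW] using ar by simp
  also have "\<dots> = \<psi> U"
    unfolding upper_\<pi>_\<iota>[OF u(7) Wj cl_mono[OF UW]] \<psi>_def ..
  finally have "v \<cdot> \<psi> U = (v \<cdot> \<psi> W) \<cdot> e U W"
    using v' \<psi> ar by simp
  then have "null (v \<cdot> \<psi> U)" using v(2) null(1) by simp
  then have "null v"
    using v' \<psi> by - (rule epic_null[OF sesD(4)[OF ses_new[OF U]]], simp_all)
  then have "null (v \<cdot> \<psi> W)" using v' \<psi> by simp
  then show ?thesis using v(2) by simp
qed

lemma null_restrict:
  assumes "U \<in> lower_sets I r'" "V \<in> lower_sets I r'" "W \<in> lower_sets I r'" "U \<subseteq> V" "V \<subseteq> W"
    and "arr h" "dom h = E W" "null (h \<cdot> e V W)"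
  shows "null (h \<cdot> e U W)"
proof -
  note ar = e_arr[OF assms(1,2,4)] e_arr[OF assms(2,3,5)]
  have "null ((h \<cdot> e V W) \<cdot> e U V)"
    using ar assms by - (rule null_Comp_left, simp_all)
  then show ?thesis using ar assms by (simp add: e_Comp)
qed

lemma join_old:
  assumes U: "U \<in> lower_sets I r" and V: "V \<in> lower_sets I r" and W: "W \<in> lower_sets I r'"
    and UVW: "U \<union> V \<subseteq> W"
    and h: "arr h" "dom h = E W" and null: "null (h \<cdot> e U W)" "null (h \<cdot> e V W)"
  shows "null (h \<cdot> e (U \<union> V) W)"
proof -
  have UV: "U \<union> V \<in> lower_sets I r" using U V by simp
  have UV': "U \<union> V \<in> lower_sets I r'" using lower_r'[OF UV] .
  note ar = e_arr[OF UV' W UVW]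
  have *: "null ((h \<cdot> e (U \<union> V) W) \<cdot> \<iota> S X (U \<union> V))"
    if X: "X \<in> lower_sets I r" "X \<subseteq> U \<union> V" and nX: "null (h \<cdot> e X W)" for X
    using e_Comp[OF lower_r'[OF X(1)] UV' W X(2) UVW] e_old[OF X(1) UV X(2)] nX h ar
      e_arr[OF lower_r'[OF X(1)] UV' X(2)] by simp
  show ?thesis
    by (rule lower_join[OF U V _ _ *[OF U Un_upper1 null(1)] *[OF V Un_upper2 null(2)]])
      (use h ar E_old[OF UV] in simp_all)
qed

text \<open>The lower sets \<open>U - {j}\<close> and \<open>V\<close> are old, so their join is known. It is all of \<open>U \<union> V\<close> or misses just
  \<open>j\<close>.\<close>

lemma join_new_old:
  assumes U: "new U" and V: "V \<in> lower_sets I r'" "\<not> new V"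
    and h: "arr h" "dom h = E (U \<union> V)"
    and null: "null (h \<cdot> e U (U \<union> V))" "null (h \<cdot> e V (U \<union> V))"
  shows "null h"
proof -
  let ?W = "U \<union> V"
  note u = newD[OF U]
  have old: "V \<in> lower_sets I r" using not_new_iff V by blast
  have W: "?W \<in> lower_sets I r'" using u(1) V by simp
  have Uj: "U - {j} \<subseteq> U" "(U - {j}) \<union> V \<subseteq> ?W" by auto
  have n: "null (h \<cdot> e ((U - {j}) \<union> V) ?W)"
    using null_restrict[OF lower_r'[OF u(5)] u(1) W Uj(1) Un_upper1 h null(1)]
    by (rule join_old[OF u(5) old W Uj(2) h _ null(2)])
  show ?thesis
  proof (cases "j \<in> V")
    case True
    then have eq: "(U - {j}) \<union> V = ?W" by auto
    have "?W \<in> lower_sets I r" using u(5) old Un_lower eq by metis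
    then show ?thesis using n h e_Id[OF W] unfolding eq by simp
  next
    case False
    then have eq: "(U - {j}) \<union> V = ?W - {j}" by auto
    have low: "?W - {j} \<in> lower_sets I r" using Un_lower[OF u(5) old] eq by simp
    have "upper I r (cl ?W) {j}"
    proof (cases "new ?W")
      case True
      then show ?thesis using newD by blast
    next
      case nW: False
      then have "?W \<in> lower_sets I r" using not_new_iff W by blast
      then show ?thesis using low u(2) by (simp add: upper_def cl_eq)
    qed
    then show ?thesis using join_at_j[OF W _ U Un_upper1 h null(1)] n eq by simp
  qed
qed

lemma e_join:
  assumes U: "U \<in> lower_sets I r'" and V: "V \<in> lower_sets I r'"
    and h: "arr h" "dom h = E (U \<union> V)"
    and null: "null (h \<cdot> e U (U \<union> V))" "null (h \<cdot> e V (U \<union> V))"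
  shows "null h"
proof -
  let ?W = "U \<union> V"
  have W: "?W \<in> lower_sets I r'" using U V by simp
  consider "\<not> new U" "\<not> new V" | "new U" "\<not> new V" | "\<not> new U" "new V" | "new U" "new V" by blast
  then show ?thesis
  proof cases
    case 1
    then have "U \<in> lower_sets I r" "V \<in> lower_sets I r" using not_new_iff U V by blast+
    then show ?thesis
      using join_old[OF _ _ W order.refl h null] h e_Id[OF W] by simp
  next
    case 2
    then show ?thesis using join_new_old[OF _ V _ h null] by blast
  next
    case 3
    then show ?thesis
      using join_new_old[of V U h] U h null by (simp add: Un_commute)
  next
    case 4
    note u = newD[OF 4(1)] and v = newD[OF 4(2)]
    have nW: "new ?W" using u(2,3) v(3) W by (simp add: new_def)
    have sub: "U - {j} \<subseteq> U" "V - {j} \<subseteq> V" "(U - {j}) \<union> (V - {j}) \<subseteq> ?W"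
      and eq: "(U - {j}) \<union> (V - {j}) = ?W - {j}" by auto
    have "null (h \<cdot> e ((U - {j}) \<union> (V - {j})) ?W)"
      using null_restrict[OF lower_r'[OF u(5)] U W sub(1) Un_upper1 h null(1)]
        null_restrict[OF lower_r'[OF v(5)] V W sub(2) Un_upper2 h null(2)]
      by (rule join_old[OF u(5) v(5) W sub(3) h])
    then show ?thesis
      using join_at_j[OF W newD(7)[OF nW] 4(1) Un_upper1 h null(1)] eq by simp
  qed
qed

lemma lower_functor_E: "lower_functor C I r' E e"
proof unfold_locales
  fix U V W :: "'i set" and f X g
  assume "U \<in> lower_sets I r'" "V \<in> lower_sets I r'" "W \<in> lower_sets I r'" "U \<subseteq> W" "V \<subseteq> W"
    "\<guillemotleft>f : X \<rightarrow> E U\<guillemotright>" "\<guillemotleft>g : X \<rightarrow> E V\<guillemotright>" "e U W \<cdot> f = e V W \<cdot> g"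
  then show "\<exists>h. \<guillemotleft>h : X \<rightarrow> E (U \<inter> V)\<guillemotright> \<and> e (U \<inter> V) U \<cdot> h = f" by (rule e_meet)
next
  fix U V :: "'i set" and h
  assume "U \<in> lower_sets I r'" "V \<in> lower_sets I r'" "arr h" "dom h = E (U \<union> V)"
    "null (h \<cdot> e U (U \<union> V))" "null (h \<cdot> e V (U \<union> V))"
  then show "null h" by (rule e_join)
qed (use e_spec(1) e_monic e_Id e_Comp in blast)+

end

section \<open>Sections and improvements\<close>

text \<open>The element \<open>x - s (g x)\<close> of the middle term is killed by \<open>g\<close>, so it comes from the left term.
  This defines a retraction \<open>p\<close>, and \<open>s\<close> becomes the inclusion of the kernel of \<open>p\<close>.\<close>

lemma (in preadditive_category) section_retraction:
  assumes fg: "ses f g" and s: "\<guillemotleft>s : cod g \<rightarrow> dom g\<guillemotright>" "g \<cdot> s = Id C (cod g)"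
  obtains p where "\<guillemotleft>p : cod f \<rightarrow> dom f\<guillemotright>" "p \<cdot> f = Id C (dom f)" "null (p \<cdot> s)"
    and "\<And>x. arr x \<Longrightarrow> cod x = cod f \<Longrightarrow> null (p \<cdot> x) \<Longrightarrow> s \<cdot> (g \<cdot> x) = x"
proof -
  note F = sesD[OF fg]
  note s' = s(1)[unfolded arrow_iff]
  let ?Y = "dom g"
  have Y: "?Y \<in> Obj C" using F by simp
  obtain d where d: "\<guillemotleft>d : ?Y \<rightarrow> ?Y\<guillemotright>" "Id C ?Y = (s \<cdot> g) \<^bold>+ d"
    using ex_difference[of "Id C ?Y" "s \<cdot> g"] s' F by auto
  note d' = d(1)[unfolded arrow_iff]
  have sg: "\<guillemotleft>s \<cdot> g : ?Y \<rightarrow> ?Y\<guillemotright>" using s' F by (simp add: arrow_iff)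
  have H: "s \<cdot> g \<in> Hom C ?Y ?Y" "d \<in> Hom C ?Y ?Y" "g \<in> Hom C ?Y (cod g)"
    using sg d(1) F by (auto simp: arrow_def in_Hom_iff)
  have "g \<cdot> (s \<cdot> g) = (g \<cdot> s) \<cdot> g" using s' F by simp
  then have gsg: "g \<cdot> (s \<cdot> g) = g" using s(2) F by simp
  have "g = g \<cdot> ((s \<cdot> g) \<^bold>+ d)" unfolding d(2)[symmetric] using F by simp
  also have "\<dots> = g \<^bold>+ (g \<cdot> d)"
    using Comp_Add[of ?Y ?Y "cod g" "s \<cdot> g" d g] H F Y unfolding gsg by simp
  finally have "null (g \<cdot> d)"
    using F d' by - (rule Add_cancel_Zero[of g ?Y "cod g"], simp_all add: arrow_iff)
  then obtain p where p: "\<guillemotleft>p : ?Y \<rightarrow> dom f\<guillemotright>" "f \<cdot> p = d"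
    using kernelE[OF F(1), of d] d' by auto
  note p' = p(1)[unfolded arrow_iff]
  have split: "x = (s \<cdot> (g \<cdot> x)) \<^bold>+ (f \<cdot> (p \<cdot> x))" if x: "arr x" "cod x = ?Y" for x
  proof -
    have "x = ((s \<cdot> g) \<^bold>+ d) \<cdot> x" unfolding d(2)[symmetric] using x by simp
    also have "\<dots> = ((s \<cdot> g) \<cdot> x) \<^bold>+ (d \<cdot> x)"
      using Add_Comp[of "dom x" ?Y ?Y x "s \<cdot> g" d] x H Y by (simp add: in_Hom_iff)
    finally show ?thesis using x s' F p' by (simp flip: p(2))
  qed
  show ?thesis
  proof (rule that[of p])
    show "\<guillemotleft>p : cod f \<rightarrow> dom f\<guillemotright>" using p F by simp
    show "p \<cdot> f = Id C (dom f)"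
    proof (rule monic_cancel[OF F(3)])
      have "null (s \<cdot> (g \<cdot> f))" using s' F by simp
      then have "(s \<cdot> (g \<cdot> f)) \<^bold>+ (f \<cdot> (p \<cdot> f)) = f \<cdot> (p \<cdot> f)"
        using s' F p' by - (rule Add_null(2)[of _ "dom f" "cod f"], simp_all add: arrow_iff)
      then show "f \<cdot> (p \<cdot> f) = f \<cdot> Id C (dom f)" using split[of f] F by simp
    qed (use p' F in simp_all)
    have "g \<cdot> s = Id C (cod g)" by (fact s(2))
    then have "s = s \<^bold>+ (f \<cdot> (p \<cdot> s))" using split[of s] s' by simp
    then have "null (f \<cdot> (p \<cdot> s))"
      using s' F p' by - (rule Add_cancel_Zero[of s "cod g" ?Y], simp_all add: arrow_iff)
    then show "null (p \<cdot> s)"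
      using s' F p' by - (rule monic_null[OF F(3)], simp_all)
    fix x assume x: "arr x" "cod x = cod f" "null (p \<cdot> x)"
    then have "null (f \<cdot> (p \<cdot> x))" using p' F by simp
    then have "(s \<cdot> (g \<cdot> x)) \<^bold>+ (f \<cdot> (p \<cdot> x)) = s \<cdot> (g \<cdot> x)"
      using x s' F p' by - (rule Add_null(1)[of _ "dom x" ?Y], simp_all add: arrow_iff)
    then show "s \<cdot> (g \<cdot> x) = x" using split[of x] x F by simp
  qed
qed

context split_pair
begin

text \<open>In the configuration built from \<open>E\<close>, the subobject \<open>\<sigma>({j})\<close> of \<open>\<sigma>({i, j})\<close> is the kernel of
  \<open>p\<close>. It suffices to compare on the epimorphism \<open>\<psi> U\<close> onto \<open>\<sigma>({j})\<close>, for the smallest new \<open>U\<close>.\<close>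

lemma ex_improvement_with_section:
  assumes s: "\<guillemotleft>s : \<sigma> S {j} \<rightarrow> \<sigma> S {i, j}\<guillemotright>"
    and ker: "\<And>x. arr x \<Longrightarrow> cod x = \<sigma> S {i, j} \<Longrightarrow> null (p \<cdot> x) \<Longrightarrow> s \<cdot> (\<pi>\<^sub>j \<cdot> x) = x"
  shows "\<exists>S'. is_improvement C A I r r' S S' \<and> \<iota> S' {j} {i, j} = s"
proof -
  obtain S' c where S': "is_improvement C A I r r' S S'"
    and c: "\<And>U V J. upper I r' U J \<Longrightarrow> upper I r' V J \<Longrightarrow> U \<subseteq> V \<Longrightarrow> c V J \<cdot> e U V = c U J"
      "\<And>U J. upper I r U J \<Longrightarrow> c U J = \<pi> S U J"
      "\<And>U W J K. upper I r' U J \<Longrightarrow> upper I r' W K \<Longrightarrow> U \<subseteq> W \<Longrightarrow> U - J \<subseteq> W - K \<Longrightarrow>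
        \<iota> S' J K \<cdot> c U J = c W K \<cdot> e U W"
    by (rule ex_extension[OF configuration_axioms lower_functor_E r'_subset finite_I E_old e_old],
        assumption+, rule that)
  interpret S': configuration C A I r' S'
    using S' by unfold_locales (simp add: is_improvement_def)
  let ?U = "down r' {j}"
  have U: "upper I r' ?U {j}"
    using N.upper_down[OF N.singleton_fsets[OF ij_I(2)]] .
  have "i \<notin> ?U" by (simp add: down_def r')
  then have nU: "new ?U"
    using N.upperD[OF U] by (simp add: new_def)
  note u = newD[OF nU]
  have sub: "?U \<subseteq> cl ?U" "?U - {j} \<subseteq> cl ?U - {i, j}" using u(4,3) by auto
  note W = cl_lower[OF u(1)]
  have eUW: "e ?U (cl ?U) = k ?U"
    using e_to_old[OF u(1) W sub(1)] \<iota>_Id[of "cl ?U"] W k_arr[OF u(1)] by simp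
  have c\<psi>: "c ?U {j} = \<psi> ?U"
    using c(1)[OF U upper_r'[OF u(7)] sub(1)] c(2)[OF u(7)] eUW by (simp add: \<psi>_def)
  let ?x = "\<pi> S (cl ?U) {i, j} \<cdot> k ?U"
  note ar = \<pi>_cl_arr[OF nU] k_arr[OF u(1)] p_arr s[unfolded arrow_iff] \<pi>\<^sub>j_arr
  have \<iota>\<psi>: "\<iota> S' {j} {i, j} \<cdot> \<psi> ?U = ?x"
    using c(3)[OF U upper_r'[OF u(6)] sub] c(2)[OF u(6)] eUW by (simp add: c\<psi>)
  have "null (p \<cdot> ?x)"
    using kernelD(5)[OF k_kernel[OF nU]] ar by (simp add: \<chi>_def)
  then have "s \<cdot> (\<pi>\<^sub>j \<cdot> ?x) = ?x" using ker ar by simp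
  moreover have "\<psi> ?U = \<pi>\<^sub>j \<cdot> ?x"
    unfolding \<psi>_def \<pi>_Comp[OF upper_hpairs[OF u(6)] ij_hpairs, symmetric] using ar by simp
  ultimately have s\<psi>: "s \<cdot> \<psi> ?U = ?x" by simp
  have "\<sigma> S' {j} = \<sigma> S {j}" "\<sigma> S' {i, j} = \<sigma> S {i, j}"
    using S' ij_fsets singleton_fsets[OF ij_I(2)] by (simp_all add: is_improvement_def)
  then have "\<iota> S' {j} {i, j} = s"
    using \<iota>\<psi> s\<psi> sesD(4)[OF ses_new[OF nU]] ar S'.\<iota>_arr[OF ji_gpairs']
      \<pi>_arr[OF upper_hpairs[OF u(7)]]
    by - (rule epic_cancel[of "\<psi> ?U"], simp_all add: \<psi>_def)
  then show ?thesis using S' by blast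
qed

end

context covering_pair
begin

text \<open>The retraction belonging to \<open>s\<close> is the datum from which the functor \<open>E\<close> is built.\<close>

lemma ex_improvement:
  assumes s: "\<guillemotleft>s : \<sigma> S {j} \<rightarrow> \<sigma> S {i, j}\<guillemotright>" "\<pi>\<^sub>j \<cdot> s = Id C (\<sigma> S {j})"
  shows "\<exists>S'. is_improvement C A I r r' S S' \<and> \<iota> S' {j} {i, j} = s"
proof -
  obtain p where p: "\<guillemotleft>p : cod \<iota>\<^sub>i \<rightarrow> dom \<iota>\<^sub>i\<guillemotright>" "p \<cdot> \<iota>\<^sub>i = Id C (dom \<iota>\<^sub>i)"
    and ker: "\<And>x. arr x \<Longrightarrow> cod x = cod \<iota>\<^sub>i \<Longrightarrow> null (p \<cdot> x) \<Longrightarrow> s \<cdot> (\<pi>\<^sub>j \<cdot> x) = x"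
    using section_retraction[OF \<iota>\<^sub>i_\<pi>\<^sub>j, of s] s \<pi>\<^sub>j_arr by auto
  interpret split_pair C A I r S i j r' p
    using p \<iota>\<^sub>i_arr by unfold_locales simp_all
  show ?thesis using ex_improvement_with_section[OF s(1)] ker \<iota>\<^sub>i_arr by simp
qed

lemma improvementD:
  assumes "is_improvement C A I r r' S S'"
  shows "configuration C A I r' S'" "J \<in> fsets I r \<Longrightarrow> \<sigma> S' J = \<sigma> S J"
    "(J, K) \<in> gpairs I r \<Longrightarrow> \<iota> S' J K = \<iota> S J K" "(J, K) \<in> hpairs I r \<Longrightarrow> \<pi> S' J K = \<pi> S J K"
proof -
  show "configuration C A I r' S'"
    using assms by unfold_locales (simp add: is_improvement_def)
qed (use assms in \<open>auto simp: is_improvement_def\<close>)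

lemma improvement_section:
  assumes "is_improvement C A I r r' S S'"
  shows "\<guillemotleft>\<iota> S' {j} {i, j} : \<sigma> S {j} \<rightarrow> \<sigma> S {i, j}\<guillemotright>" "\<pi>\<^sub>j \<cdot> \<iota> S' {j} {i, j} = Id C (\<sigma> S {j})"
proof -
  note S' = improvementD[OF assms]
  interpret S': configuration C A I r' S' by (fact S'(1))
  have j: "{j} \<in> fsets I r" using singleton_fsets[OF ij_I(2)] .
  have \<sigma>: "\<sigma> S' {j} = \<sigma> S {j}" "\<sigma> S' {i, j} = \<sigma> S {i, j}" using S'(2) ij_fsets j by simp_all
  show "\<guillemotleft>\<iota> S' {j} {i, j} : \<sigma> S {j} \<rightarrow> \<sigma> S {i, j}\<guillemotright>"
    using S'.\<iota>_monic(1)[OF ji_gpairs'] \<sigma> by simp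
  have "{j} \<inter> {j} = {j}" by simp
  then show "\<pi>\<^sub>j \<cdot> \<iota> S' {j} {i, j} = Id C (\<sigma> S {j})"
    using S'.\<pi>_\<iota>[OF ji_gpairs' hpairs_r'[OF ij_hpairs]] S'(4)[OF ij_hpairs]
      S'.\<iota>_Id[OF fsets_r'[OF j]] S'.\<pi>_Id[OF fsets_r'[OF j]] \<sigma> j by simp
qed

text \<open>The retraction \<open>\<pi>({i, j}, {i})\<close> is a cokernel of the section, which determines it up to an
  automorphism of \<open>\<sigma>({i})\<close>, and this is the identity because the retraction is one of \<open>\<iota>\<^sub>i\<close>.\<close>

lemma same_retraction:
  assumes S1: "is_improvement C A I r r' S S1" and S2: "is_improvement C A I r r' S S2"
    and eq: "\<iota> S1 {j} {i, j} = \<iota> S2 {j} {i, j}"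
  shows "\<pi> S1 {i, j} {i} = \<pi> S2 {i, j} {i}"
proof -
  interpret S1: configuration C A I r' S1 by (rule improvementD(1)[OF S1])
  interpret S2: configuration C A I r' S2 by (rule improvementD(1)[OF S2])
  have i: "{i} \<in> fsets I r" using singleton_fsets[OF ij_I(1)] .
  note \<sigma> = improvementD(2)[OF S1 i] improvementD(2)[OF S2 i] improvementD(2)[OF S1 ij_fsets]
    improvementD(2)[OF S2 ij_fsets]
  have e: "{i, j} - {j} = {i}" using ij(1) by auto
  have h: "({i, j}, {i}) \<in> hpairs I r'"
    using N.gpairs_hpairs_Diff[OF ji_gpairs'] e by simp
  note ar = S1.\<pi>_arr[OF h] S2.\<pi>_arr[OF h] S1.\<iota>_arr[OF ji_gpairs'] \<iota>\<^sub>i_arr \<sigma>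
  have ret: "\<pi> S' {i, j} {i} \<cdot> \<iota>\<^sub>i = Id C (\<sigma> S {i})" if S': "is_improvement C A I r r' S S'" for S'
  proof -
    interpret S': configuration C A I r' S' by (rule improvementD(1)[OF S'])
    have "{i} \<inter> {i} = {i}" by simp
    then show ?thesis
      using S'.\<pi>_\<iota>[OF gpairs_r'[OF ij_gpairs] h] improvementD(3)[OF S' ij_gpairs]
        S'.\<iota>_Id[OF fsets_r'[OF i]] S'.\<pi>_Id[OF fsets_r'[OF i]] improvementD(2)[OF S' i] i by simp
  qed
  have s1: "ses (\<iota> S1 {j} {i, j}) (\<pi> S1 {i, j} {i})" and s2: "ses (\<iota> S1 {j} {i, j}) (\<pi> S2 {i, j} {i})"
    using S1.ses_\<iota>_\<pi>[OF ji_gpairs'] S2.ses_\<iota>_\<pi>[OF ji_gpairs'] e eq by simp_all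
  obtain u where u: "\<guillemotleft>u : \<sigma> S {i} \<rightarrow> \<sigma> S {i}\<guillemotright>" "u \<cdot> \<pi> S1 {i, j} {i} = \<pi> S2 {i, j} {i}"
    using cokernelE[OF sesD(2)[OF s1], of "\<pi> S2 {i, j} {i}"] sesD(7,8)[OF s2] ar by auto
  have "u = u \<cdot> (\<pi> S1 {i, j} {i} \<cdot> \<iota>\<^sub>i)" unfolding ret[OF S1] using u(1) by (simp add: arrow_iff)
  also have "\<dots> = (u \<cdot> \<pi> S1 {i, j} {i}) \<cdot> \<iota>\<^sub>i" using u(1) ar by (simp add: arrow_iff)
  also have "\<dots> = Id C (\<sigma> S {i})" unfolding u(2) by (rule ret[OF S2])
  finally show ?thesis using u(2) ar by simp
qed

text \<open>For a new lower set \<open>U\<close>, every improvement makes \<open>\<sigma>(U)\<close> the kernel of the composite of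
  \<open>\<pi>(cl U, {i, j})\<close> with the retraction, so improvements with the same section agree on all lower
  sets.\<close>

lemma canonical_iso_if_same_section:
  assumes S1: "is_improvement C A I r r' S S1" and S2: "is_improvement C A I r r' S S2"
    and eq: "\<iota> S1 {j} {i, j} = \<iota> S2 {j} {i, j}"
  shows "\<exists>\<alpha>. is_config_iso C I r' S1 S2 \<alpha> \<and> (\<forall>J \<in> fsets I r. \<alpha> J = Id C (\<sigma> S J))"
proof -
  note c1 = improvementD(1)[OF S1] and c2 = improvementD(1)[OF S2]
  note \<sigma>\<^sub>1 = improvementD(2)[OF S1] and \<sigma>\<^sub>2 = improvementD(2)[OF S2]
  note \<iota>\<^sub>1 = improvementD(3)[OF S1] and \<iota>\<^sub>2 = improvementD(3)[OF S2]
  note \<pi>\<^sub>1 = improvementD(4)[OF S1] and \<pi>\<^sub>2 = improvementD(4)[OF S2]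
  interpret S1: configuration C A I r' S1 by (fact c1)
  interpret S2: configuration C A I r' S2 by (fact c2)
  have e: "{i, j} - {j} = {i}" using ij(1) by auto
  have h: "({i, j}, {i}) \<in> hpairs I r'"
    using N.gpairs_hpairs_Diff[OF ji_gpairs'] e by simp
  have "\<exists>a. is_iso C (\<sigma> S1 U) (\<sigma> S2 U) a \<and> \<iota> S2 U I \<cdot> a = \<iota> S1 U I \<and>
      (U \<in> lower_sets I r \<longrightarrow> a = Id C (\<sigma> S U))"
    if U: "U \<in> lower_sets I r'" for U
  proof (cases "new U")
    case False
    then have old: "U \<in> lower_sets I r" using not_new_iff U by blast
    note g = lower_gpairs[OF old whole_lower lower_subset[OF old]]
    have "is_iso C (\<sigma> S U) (\<sigma> S U) (Id C (\<sigma> S U))"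
      using old by (intro is_isoI[of _ _ _ "Id C (\<sigma> S U)"]) (simp_all add: arrow_iff)
    then show ?thesis
      using \<sigma>\<^sub>1 \<sigma>\<^sub>2 old \<iota>\<^sub>1[OF g] \<iota>\<^sub>2[OF g] \<iota>_arr[OF g]
      by (intro exI[of _ "Id C (\<sigma> S U)"]) simp
  next
    case True
    note u = newD[OF True]
    have sub: "U \<subseteq> cl U" "cl U - {i} = U" using u(3,4) by auto
    note W = cl_lower[OF U]
    note g = N.lower_gpairs[OF U lower_r'[OF W] sub(1)]
    note gI = lower_gpairs[OF W whole_lower lower_subset[OF W]]
    have "\<pi> S1 (cl U) {i} = \<pi> S2 (cl U) {i}"
      using S1.\<pi>_Comp[OF hpairs_r'[OF upper_hpairs[OF u(6)]] h]
        S2.\<pi>_Comp[OF hpairs_r'[OF upper_hpairs[OF u(6)]] h]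
        \<pi>\<^sub>1[OF upper_hpairs[OF u(6)]] \<pi>\<^sub>2[OF upper_hpairs[OF u(6)]]
        same_retraction[OF S1 S2 eq] by simp
    then have ker: "kernel (\<iota> S1 U (cl U)) (\<pi> S2 (cl U) {i})" "kernel (\<iota> S2 U (cl U)) (\<pi> S2 (cl U) {i})"
      using sesD(1)[OF S1.upper_ses[OF u(8)]] sesD(1)[OF S2.upper_ses[OF u(8)]] sub by simp_all
    note ar = S1.\<iota>_arr[OF g] S2.\<iota>_arr[OF g] S2.\<iota>_arr[OF gpairs_r'[OF gI]]
    obtain a where a: "\<guillemotleft>a : \<sigma> S1 U \<rightarrow> \<sigma> S2 U\<guillemotright>" "\<iota> S2 U (cl U) \<cdot> a = \<iota> S1 U (cl U)"
      "is_iso C (\<sigma> S1 U) (\<sigma> S2 U) a"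
      using kernel_isoE[OF ker] ar by auto
    have "\<iota> S2 U I \<cdot> a = \<iota> S2 (cl U) I \<cdot> (\<iota> S2 U (cl U) \<cdot> a)"
      unfolding S2.\<iota>_Comp[OF g gpairs_r'[OF gI], symmetric] using a(1) ar by (simp add: arrow_iff)
    also have "\<dots> = \<iota> S1 U I"
      unfolding a(2) using S1.\<iota>_Comp[OF g gpairs_r'[OF gI]] \<iota>\<^sub>1[OF gI] \<iota>\<^sub>2[OF gI] by simp
    finally show ?thesis using a(3) True by auto
  qed
  then obtain a where a: "\<And>U. U \<in> lower_sets I r' \<Longrightarrow> is_iso C (\<sigma> S1 U) (\<sigma> S2 U) (a U)"
    "\<And>U. U \<in> lower_sets I r' \<Longrightarrow> \<iota> S2 U I \<cdot> a U = \<iota> S1 U I"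
    "\<And>U. U \<in> lower_sets I r \<Longrightarrow> a U = Id C (\<sigma> S U)"
    using lower_r' by metis
  obtain \<alpha> where \<alpha>: "is_config_iso C I r' S1 S2 \<alpha>"
    "\<And>U J. upper I r' U J \<Longrightarrow> \<alpha> J \<cdot> \<pi> S1 U J = \<pi> S2 U J \<cdot> a U"
    by (rule config_iso_of_lower_isos[OF c1 c2 a(1,2)], assumption, assumption, rule that)
  have "\<alpha> J = Id C (\<sigma> S J)" if J: "J \<in> fsets I r" for J
  proof -
    note U = upper_down[OF J]
    note h = upper_hpairs[OF U]
    have \<alpha>J: "arr (\<alpha> J)" "dom (\<alpha> J) = \<sigma> S J" "cod (\<alpha> J) = \<sigma> S J"
      using \<alpha>(1) fsets_r'[OF J] \<sigma>\<^sub>1[OF J] \<sigma>\<^sub>2[OF J] J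
      by (auto simp: is_config_iso_def is_iso_def in_Hom_iff)
    have "\<alpha> J \<cdot> \<pi> S (down r J) J = \<pi> S (down r J) J"
      using \<alpha>(2)[OF upper_r'[OF U]] a(3)[OF upperD(1)[OF U]] \<pi>\<^sub>1[OF h] \<pi>\<^sub>2[OF h] \<pi>_arr[OF h]
      by simp
    then show ?thesis
      using \<alpha>J \<pi>_arr[OF h] J by - (rule epic_cancel[OF \<pi>_epic(2)[OF h]], simp_all)
  qed
  then show ?thesis using \<alpha>(1) by blast
qed

lemma same_section_if_canonical_iso:
  assumes S1: "is_improvement C A I r r' S S1" and S2: "is_improvement C A I r r' S S2"
    and \<alpha>: "is_config_iso C I r' S1 S2 \<alpha>" "\<forall>J \<in> fsets I r. \<alpha> J = Id C (\<sigma> S J)"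
  shows "\<iota> S1 {j} {i, j} = \<iota> S2 {j} {i, j}"
proof -
  note s = improvement_section(1)[OF S1, unfolded arrow_iff]
    improvement_section(1)[OF S2, unfolded arrow_iff]
  have "\<alpha> {i, j} \<cdot> \<iota> S1 {j} {i, j} = \<iota> S2 {j} {i, j} \<cdot> \<alpha> {j}"
    using \<alpha>(1) ji_gpairs' by (auto simp: is_config_iso_def)
  then show ?thesis using \<alpha>(2) ij_fsets singleton_fsets[OF ij_I(2)] s by simp
qed

lemma canonical_iso_rel_eq:
  "canonical_iso_rel C A I r r' S = {(S1, S2). S1 \<in> improvements C A I r r' S \<and>
     S2 \<in> improvements C A I r r' S \<and> \<iota> S1 {j} {i, j} = \<iota> S2 {j} {i, j}}"
  using canonical_iso_if_same_section same_section_if_canonical_iso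
  unfolding canonical_iso_rel_def improvements_def by blast

end

lemma bij_betw_quotient_image:
  assumes "R = {(x, y). x \<in> M \<and> y \<in> M \<and> F x = F y}"
  shows "\<exists>\<Phi>. bij_betw \<Phi> (M // R) (F ` M)"
proof
  have R: "R `` {x} = {y \<in> M. F y = F x}" if "x \<in> M" for x
    using that by (auto simp: assms)
  have F: "the_elem (F ` (R `` {x})) = F x" if "x \<in> M" for x
  proof -
    have "F ` (R `` {x}) = {F x}" using R[OF that] that by auto
    then show ?thesis by simp
  qed
  show "bij_betw (\<lambda>X. the_elem (F ` X)) (M // R) (F ` M)"
    unfolding bij_betw_def
  proof
    show "inj_on (\<lambda>X. the_elem (F ` X)) (M // R)"
      using F R by (auto simp: inj_on_def quotient_def)
    have "M // R = (\<lambda>x. R `` {x}) ` M" by (auto simp: quotient_def)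
    then show "(\<lambda>X. the_elem (F ` X)) ` (M // R) = F ` M"
      using F by (simp add: image_image)
  qed
qed

context covering_pair
begin

text \<open>The splitting provides one section \<open>s\<close> and its retraction \<open>p\<close>. Composition with \<open>p\<close> is a bijection from
  sections to \<open>Hom(\<sigma>({j}), \<sigma>({i}))\<close>, with inverse \<open>f \<mapsto> s + \<iota>\<^sub>i f\<close>, and the section of an improvement
  determines its class.\<close>

lemma improvements_correspond_to_Hom:
  assumes split: "split_short_exact C (\<sigma> S {i}) \<iota>\<^sub>i (\<sigma> S {i, j}) \<pi>\<^sub>j (\<sigma> S {j})"
  shows "(\<exists>S'. is_improvement C A I r r' S S') \<and>
    (\<exists>\<Phi>. bij_betw \<Phi> (improvements C A I r r' S // canonical_iso_rel C A I r r' S)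
              (Hom C (\<sigma> S {j}) (\<sigma> S {i})))"
proof -
  let ?X = "\<sigma> S {i}" and ?Y = "\<sigma> S {i, j}" and ?Z = "\<sigma> S {j}"
  have O: "?X \<in> Obj C" "?Z \<in> Obj C"
    using singleton_fsets ij_I by simp_all
  obtain B i\<^sub>1 i\<^sub>2 p\<^sub>1 p\<^sub>2 \<phi> where B: "is_direct_sum C ?X ?Z B i\<^sub>1 i\<^sub>2 p\<^sub>1 p\<^sub>2" "is_iso C B ?Y \<phi>"
    "\<pi>\<^sub>j \<cdot> \<phi> = p\<^sub>2"
    using split unfolding split_short_exact_def by blast
  let ?s = "\<phi> \<cdot> i\<^sub>2"
  have ar: "arr i\<^sub>2" "dom i\<^sub>2 = ?Z" "cod i\<^sub>2 = B" "arr \<phi>" "dom \<phi> = B" "cod \<phi> = ?Y" "p\<^sub>2 \<cdot> i\<^sub>2 = Id C ?Z"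
    using B O ij_fsets by (auto simp: is_direct_sum_def is_iso_def in_Hom_iff)
  have s: "\<guillemotleft>?s : ?Z \<rightarrow> ?Y\<guillemotright>" using ar by (simp add: arrow_iff)
  have "(\<pi>\<^sub>j \<cdot> \<phi>) \<cdot> i\<^sub>2 = Id C ?Z" unfolding B(3) by (rule ar(7))
  then have \<pi>s: "\<pi>\<^sub>j \<cdot> ?s = Id C ?Z" using ar \<pi>\<^sub>j_arr by simp
  obtain p where p: "\<guillemotleft>p : ?Y \<rightarrow> ?X\<guillemotright>" "p \<cdot> \<iota>\<^sub>i = Id C ?X"
    and ps: "null (p \<cdot> ?s)"
    and ker: "\<And>x. arr x \<Longrightarrow> cod x = ?Y \<Longrightarrow> null (p \<cdot> x) \<Longrightarrow> ?s \<cdot> (\<pi>\<^sub>j \<cdot> x) = x"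
    using section_retraction[OF \<iota>\<^sub>i_\<pi>\<^sub>j, of ?s] s \<pi>s \<pi>\<^sub>j_arr \<iota>\<^sub>i_arr by auto
  note a = s[unfolded arrow_iff] p(1)[unfolded arrow_iff] \<iota>\<^sub>i_arr \<pi>\<^sub>j_arr
  let ?M = "improvements C A I r r' S" and ?F = "\<lambda>S'. p \<cdot> \<iota> S' {j} {i, j}"
  have add: "g \<cdot> (t \<^bold>+ d) = (g \<cdot> t) \<^bold>+ (g \<cdot> d)"
    if "arr g" "dom g = ?Y" "\<guillemotleft>t : ?Z \<rightarrow> ?Y\<guillemotright>" "\<guillemotleft>d : ?Z \<rightarrow> ?Y\<guillemotright>" for g t d
    using that Comp_Add[of ?Z ?Y "cod g" t d g] by (auto simp: arrow_def in_Hom_iff)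
  have inj: "t = t'"
    if t: "\<guillemotleft>t : ?Z \<rightarrow> ?Y\<guillemotright>" "\<pi>\<^sub>j \<cdot> t = Id C ?Z" and t': "\<guillemotleft>t' : ?Z \<rightarrow> ?Y\<guillemotright>" "\<pi>\<^sub>j \<cdot> t' = Id C ?Z"
      and eq: "p \<cdot> t = p \<cdot> t'" for t t'
  proof -
    note b = t(1)[unfolded arrow_iff] t'(1)[unfolded arrow_iff]
    obtain d where d: "\<guillemotleft>d : ?Z \<rightarrow> ?Y\<guillemotright>" "t = t' \<^bold>+ d"
      using ex_difference[of t t'] b by auto
    have n: "null (g \<cdot> d)" if g: "arr g" "dom g = ?Y" "g \<cdot> t = g \<cdot> t'" for g
    proof (rule Add_cancel_Zero)
      show "(g \<cdot> t') \<^bold>+ (g \<cdot> d) = g \<cdot> t'"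
        using add[OF g(1,2) t'(1) d(1)] g(3) d(2) by simp
      show "\<guillemotleft>g \<cdot> t' : ?Z \<rightarrow> cod g\<guillemotright>" "\<guillemotleft>g \<cdot> d : ?Z \<rightarrow> cod g\<guillemotright>"
        using b d(1) g by (simp_all add: arrow_iff)
    qed
    have nd: "null (p \<cdot> d)" "null (\<pi>\<^sub>j \<cdot> d)" using n eq t(2) t'(2) a by simp_all
    have "?s \<cdot> (\<pi>\<^sub>j \<cdot> d) = d" using ker[of d] d(1) nd(1) by (simp add: arrow_iff)
    moreover from nd(2) have "null (?s \<cdot> (\<pi>\<^sub>j \<cdot> d))"
      using a d(1) by - (rule null_Comp_right, simp_all add: arrow_iff)
    ultimately have "null d" by simp
    then show ?thesis using Add_null(1)[OF t'(1) d(1)] d(2) by simp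
  qed
  have surj: "\<exists>S' \<in> ?M. ?F S' = f" if f: "f \<in> Hom C ?Z ?X" for f
  proof -
    have f': "arr f" "dom f = ?Z" "cod f = ?X" using f O by (simp_all add: in_Hom_iff)
    let ?t = "?s \<^bold>+ (\<iota>\<^sub>i \<cdot> f)"
    have \<iota>f: "\<guillemotleft>\<iota>\<^sub>i \<cdot> f : ?Z \<rightarrow> ?Y\<guillemotright>" using f' a by (simp add: arrow_iff)
    have t: "\<guillemotleft>?t : ?Z \<rightarrow> ?Y\<guillemotright>" using Add_arrow[OF s \<iota>f] .
    have "null ((\<pi>\<^sub>j \<cdot> \<iota>\<^sub>i) \<cdot> f)"
      using sesD(8)[OF \<iota>\<^sub>i_\<pi>\<^sub>j] f' a by - (rule null_Comp_left, simp_all)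
    then have "\<pi>\<^sub>j \<cdot> ?t = \<pi>\<^sub>j \<cdot> ?s"
      unfolding add[OF \<pi>\<^sub>j_arr[THEN conjunct1] \<pi>\<^sub>j_arr[THEN conjunct2, THEN conjunct1] s \<iota>f]
      using f' a by - (rule Add_null(1)[of _ ?Z ?Z], simp_all add: arrow_iff)
    then obtain S' where S': "is_improvement C A I r r' S S'" "\<iota> S' {j} {i, j} = ?t"
      using ex_improvement[OF t] \<pi>s by auto
    have "(p \<cdot> \<iota>\<^sub>i) \<cdot> f = f" unfolding p(2) using f' by simp
    then have "p \<cdot> (\<iota>\<^sub>i \<cdot> f) = f" using f' a by simp
    then have "p \<cdot> ?t = (p \<cdot> ?s) \<^bold>+ f"
      using add[of p, OF _ _ s \<iota>f] a by simp
    also have "\<dots> = f"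
      using ps f' a by - (rule Add_null(2)[of _ ?Z ?X], simp_all add: arrow_iff)
    finally show ?thesis using S' by (intro bexI[of _ S']) (simp_all add: improvements_def)
  qed
  have Hom: "?F S' \<in> Hom C ?Z ?X" if "S' \<in> ?M" for S'
    using improvement_section(1)[of S'] that a O by (simp add: improvements_def arrow_iff in_Hom_iff)
  have "?F ` ?M = Hom C ?Z ?X"
    using surj Hom by blast
  moreover have "canonical_iso_rel C A I r r' S = {(S1, S2). S1 \<in> ?M \<and> S2 \<in> ?M \<and> ?F S1 = ?F S2}"
    unfolding canonical_iso_rel_eq using inj improvement_section by (auto simp: improvements_def)
  ultimately show ?thesis
    using ex_improvement[OF s \<pi>s] bij_betw_quotient_image[of _ ?M ?F] by auto
qed

end

theorem proposition6p9:
  fixes C :: "('o, 'm) category_data" and A :: "'o set"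
    and I :: "'i set" and r r' :: "'i rel" and i j :: 'i
    and S :: "('i, 'o, 'm) config_data"
  assumes "exact_category C A"
    and "finite I" and "partial_order_on I r"
    and "is_configuration C A I r S"
    and "i \<in> I" and "j \<in> I" and "i \<noteq> j" and "(i, j) \<in> r"
    and "\<not> (\<exists>k \<in> I. i \<noteq> k \<and> k \<noteq> j \<and> (i, k) \<in> r \<and> (k, j) \<in> r)"
    and "split_short_exact C (\<sigma> S {i}) (\<iota> S {i} {i, j}) (\<sigma> S {i, j}) (\<pi> S {i, j} {j}) (\<sigma> S {j})"
    and "r' = {(a, b). (a, b) \<in> r \<and> (a, b) \<noteq> (i, j)}"
  shows "dominates_by I r r' 1 \<and>
    (\<exists>S'. is_improvement C A I r r' S S') \<and>
    (\<exists>\<Phi>. bij_betw \<Phi> (improvements C A I r r' S // canonical_iso_rel C A I r r' S)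
              (Hom C (\<sigma> S {j}) (\<sigma> S {i})))"
proof -
  interpret exact_category C A by fact
  interpret covering_pair C A I r S i j r'
    using assms by unfold_locales auto
  show ?thesis
    using dominates improvements_correspond_to_Hom assms(10) by blast
qed

end
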